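(* Let $D:\mathbb R^2\setminus\{0\}\to\mathbb R$ be nonnegative and continuously differentiable, and assume that $D$ is bounded and that $\lim_{x\to 0}\sqrt{|x|}\,\nabla D(x)=0$. Consider the damped Kepler system $$\ddot x+D(x)\dot x=-\frac{x}{|x|^3},\qquad x\in\mathbb R^2\setminus\{0\}.$$ Fix a flight time $T>0$ and points $A,B\in\mathbb R^2\setminus\{0\}$. Then: (a) If $A$ and $B$ lie on the same ray starting at the origin, then there exists a unique rectilinear arc from $A$ to $B$ with flight time $T$. (b) If $A$ and $B$ do not lie on the same ray starting at the origin, then there exists at least one arc from $A$ to $B$ with flight time $T$ rotating clockwise, and at least one arc from $A$ to $B$ with flight time $T$ rotating counterclockwise.
   Context: Solutions are classical: twice continuously differentiable and never passing through $0$. For a solution $x$, its angular momentum $c(t)=\det(x(t),\dot x(t))$ has constant sign; the solution is called rectilinear (living in a ray) if $c\equiv 0$, rotating counterclockwise if $c>0$, and rotating clockwise if $c<0$. Writing $x(t)=r(t)(\cos\theta(t),\sin\theta(t))$ with $r>0$ and $\theta$ a continuous lift of the argument, a solution $x:[-T,0]\to\mathbb R^2\setminus\{0\}$ is called an arc from $A:=x(-T)$ to $B:=x(0)$ with flight time $T$ if $|\theta(0)-\theta(-T)|<2\pi$. *)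

theory Defs
  imports "HOL-Analysis.Analysis"
begin

text \<open>The plane R^2 is modelled by the type complex (as a real inner product space).\<close>

definition det2 :: "complex \<Rightarrow> complex \<Rightarrow> real" where
  "det2 a b = Re a * Im b - Im a * Re b"

definition damping_ok :: "(complex \<Rightarrow> real) \<Rightarrow> (complex \<Rightarrow> complex) \<Rightarrow> bool" where
  "damping_ok D gradD \<longleftrightarrow>
     (\<forall>x. x \<noteq> 0 \<longrightarrow> 0 \<le> D x) \<and>
     (\<forall>x. x \<noteq> 0 \<longrightarrow> (D has_derivative (\<lambda>h. gradD x \<bullet> h)) (at x)) \<and>
     continuous_on (- {0}) gradD \<and>
     bounded (D ` (- {0})) \<and>
     ((\<lambda>x. sqrt (norm x) *\<^sub>R gradD x) \<longlongrightarrow> 0) (at 0)"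

definition kepler_solution ::
  "(complex \<Rightarrow> real) \<Rightarrow> real \<Rightarrow> (real \<Rightarrow> complex) \<Rightarrow> (real \<Rightarrow> complex) \<Rightarrow> (real \<Rightarrow> complex) \<Rightarrow> bool" where
  "kepler_solution D T x x' x'' \<longleftrightarrow>
     continuous_on {-T..0} x'' \<and>
     (\<forall>t\<in>{-T..0}.
        (x has_vector_derivative x' t) (at t within {-T..0}) \<and>
        (x' has_vector_derivative x'' t) (at t within {-T..0}) \<and>
        x t \<noteq> 0 \<and>
        x'' t + D (x t) *\<^sub>R x' t = - ((1 / norm (x t) ^ 3) *\<^sub>R x t))"

definition arc_condition :: "real \<Rightarrow> (real \<Rightarrow> complex) \<Rightarrow> bool" where
  "arc_condition T x \<longleftrightarrow>
     (\<exists>\<theta>. continuous_on {-T..0} \<theta> \<and>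
        (\<forall>t\<in>{-T..0}. x t = complex_of_real (norm (x t)) * cis (\<theta> t)) \<and>
        \<bar>\<theta> 0 - \<theta> (-T)\<bar> < 2 * pi)"

definition is_arc ::
  "(complex \<Rightarrow> real) \<Rightarrow> real \<Rightarrow> complex \<Rightarrow> complex \<Rightarrow> (real \<Rightarrow> complex) \<Rightarrow> (real \<Rightarrow> complex) \<Rightarrow> bool" where
  "is_arc D T A B x x' \<longleftrightarrow>
     (\<exists>x''. kepler_solution D T x x' x'') \<and> x (-T) = A \<and> x 0 = B \<and> arc_condition T x"

definition rectilinear_arc :: "(complex \<Rightarrow> real) \<Rightarrow> real \<Rightarrow> complex \<Rightarrow> complex \<Rightarrow> (real \<Rightarrow> complex) \<Rightarrow> bool" where
  "rectilinear_arc D T A B x \<longleftrightarrow>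
     (\<exists>x'. is_arc D T A B x x' \<and> (\<forall>t\<in>{-T..0}. det2 (x t) (x' t) = 0))"

definition ccw_arc :: "(complex \<Rightarrow> real) \<Rightarrow> real \<Rightarrow> complex \<Rightarrow> complex \<Rightarrow> (real \<Rightarrow> complex) \<Rightarrow> bool" where
  "ccw_arc D T A B x \<longleftrightarrow>
     (\<exists>x'. is_arc D T A B x x' \<and> (\<forall>t\<in>{-T..0}. det2 (x t) (x' t) > 0))"

definition cw_arc :: "(complex \<Rightarrow> real) \<Rightarrow> real \<Rightarrow> complex \<Rightarrow> complex \<Rightarrow> (real \<Rightarrow> complex) \<Rightarrow> bool" where
  "cw_arc D T A B x \<longleftrightarrow>
     (\<exists>x'. is_arc D T A B x x' \<and> (\<forall>t\<in>{-T..0}. det2 (x t) (x' t) < 0))"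

definition same_ray :: "complex \<Rightarrow> complex \<Rightarrow> bool" where
  "same_ray A B \<longleftrightarrow> (\<exists>c>0. B = c *\<^sub>R A)"

end

theory Submission
  imports Defs
begin

text \<open>
  A rectilinear arc solves \<open>r'' + D r' = - 1 / r\<^sup>2\<close>, that is \<open>(r' + G r)' = - 1 / r\<^sup>2\<close> with
  \<open>G' = D\<close> along the ray. As \<open>- 1 / r\<^sup>2\<close> increases with \<open>r\<close>, integrating the difference of two
  solutions between consecutive zeros gives uniqueness; existence follows by shooting in the velocity.

  For rotating arcs, follow the motion backward in time from \<open>B\<close> and use the angle \<open>s\<close> swept since
  \<open>B\<close> as independent variable. With \<open>u = 1 / r\<close> and \<open>c\<close> the angular momentum, the damping drops out
  of Clairaut's equation \<open>u'' + u = 1 / c\<^sup>2\<close> and only drives \<open>c' = D / u\<^sup>2\<close>, while the elapsed time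
  satisfies \<open>t' = 1 / (c u\<^sup>2)\<close>. The arcs correspond to parameters \<open>p = u' 0\<close> and
  \<open>k = 1 / (c 0)\<^sup>2\<close> for which \<open>u\<close> attains \<open>1 / norm A\<close> and \<open>t\<close> attains \<open>T\<close> at the prescribed
  angle \<open>\<alpha>\<close>. On a large rectangle of parameters, \<open>u \<alpha>\<close> is too small for the least and too large for
  the greatest \<open>k\<close>, and wherever \<open>u \<alpha>\<close> is right, the flight is too slow for the least and too fast
  for the greatest \<open>p\<close>; so Brouwer's theorem yields a common solution.
\<close>

section \<open>Parameter-dependent Lipschitz initial value problems\<close>

text \<open>The obstacle is that a motion shot from \<open>B\<close> may escape before it has swept
  the angle \<alpha>, so its end values need not exist on a whole rectangle of parameters. In the
  angular variable, collision means that \<open>u\<close> becomes infinite, which bounded forcing in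
  a linear equation cannot cause; escape means that \<open>u\<close> reaches 0. The equations are
  therefore continued past escape, and the continuation is charged so much extra time that no
  continued motion can arrive at time \<open>T\<close>. Going backward makes the angular momentum
  grow, so for positive \<open>k\<close> the forcing decreases from its initial value
  \<open>k\<close>, and within time \<open>T\<close> it keeps at least the share
  \<open>exp (- 2 * M * T)\<close>. These two bounds carry all estimates of \<open>u\<close>. The
  condition on the gradient at 0 yields that \<open>D / u^2\<close> is Lipschitz in \<open>u\<close>
  on every half-line \<open>u \<ge> \<epsilon>\<close>, all the way to collision. Hence the
  truncated system is globally Lipschitz and its end values depend continuously on \<open>p\<close>
  and \<open>k\<close>.\<close>

text \<open>
  Picard iteration is a contraction with factor 1/2 for the sup norm weighted by
  \<open>exp (- c * t)\<close>, uniformly in the parameter, so its fixed point depends continuously on the parameter.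
\<close>

lemma ode_family:
  fixes f :: "'p::metric_space \<Rightarrow> real \<Rightarrow> 'a::banach \<Rightarrow> 'a"
  assumes Q: "compact Q" and S: "0 \<le> S" and L: "0 \<le> L"
    and cont: "continuous_on (Q \<times> {0..S} \<times> UNIV) (\<lambda>(q,t,x). f q t x)"
    and lip: "\<And>q t x y. q \<in> Q \<Longrightarrow> t \<in> {0..S} \<Longrightarrow> norm (f q t x - f q t y) \<le> L * norm (x - y)"
    and x0: "continuous_on Q x0"
  obtains X where
    "\<And>q t. q \<in> Q \<Longrightarrow> t \<in> {0..S} \<Longrightarrow>
       (X q has_vector_derivative f q t (X q t)) (at t within {0..S})"
    "\<And>q. q \<in> Q \<Longrightarrow> X q 0 = x0 q"
    "\<And>t. t \<in> {0..S} \<Longrightarrow> continuous_on Q (\<lambda>q. X q t)"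
proof -
  define c where "c = 2 * L + 1"
  have c: "c > 0" "L / c \<le> 1/2" using L by (auto simp: c_def field_simps)
  \<comment> \<open>Clamping the time extends every curve to the whole line as a bounded continuous
    function, so that the contraction principle applies on one complete space for all
    parameters.\<close>
  define cl where "cl t = max 0 (min S t)" for t :: real
  have cl: "cl t \<in> {0..S}" for t using S by (auto simp: cl_def)
  have cl_id: "cl t = t" if "t \<in> {0..S}" for t using that by (auto simp: cl_def)
  have cl_cont: "continuous_on A cl" for A unfolding cl_def by (intro continuous_intros)
  \<comment> \<open>The unknown \<open>z\<close> is the weighted curve
    \<open>exp (- c * t) *\<^sub>R X q t\<close>, for which the weighted norm is the plain sup
    norm.\<close>
  define h where "h q z s = f q s (exp (c * s) *\<^sub>R z s)" for q and z :: "real \<Rightarrow> 'a" and s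
  have h_cont2: "continuous_on (Q \<times> {0..S}) (\<lambda>(q,s). h q z s)" if "continuous_on UNIV z" for z
  proof -
    have "continuous_on (Q \<times> {0..S}) (\<lambda>w. (\<lambda>(q,t,x). f q t x) (fst w, snd w, exp (c * snd w) *\<^sub>R z (snd w)))"
      by (rule continuous_on_compose2[OF cont])
         (auto intro!: continuous_intros continuous_on_compose2[OF that])
    then show ?thesis by (simp add: h_def case_prod_unfold)
  qed
  have h_cont: "continuous_on {0..S} (h q z)" if "continuous_on UNIV z" "q \<in> Q" for q z
    using continuous_on_compose2[OF h_cont2[OF that(1)], of "{0..S}" "\<lambda>s. (q, s)"] that
    by (fastforce intro!: continuous_intros)
  have h_int: "h q z integrable_on {0..t}" if "continuous_on UNIV z" "q \<in> Q" "t \<in> {0..S}" for q z t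
    using that by (intro integrable_continuous_real continuous_on_subset[OF h_cont]) auto
  define P where "P q z t = exp (- c * cl t) *\<^sub>R (x0 q + integral {0..cl t} (h q z))" for q z t
  have P_bc: "P q z \<in> bcontfun" if z: "continuous_on UNIV z" and q: "q \<in> Q" for q z
  proof -
    let ?J = "\<lambda>t. exp (- c * t) *\<^sub>R (x0 q + integral {0..t} (h q z))"
    have J: "continuous_on {0..S} ?J"
      by (intro continuous_intros indefinite_integral_continuous_1 h_int z q) (use S in auto)
    have PJ: "P q z = ?J \<circ> cl" by (auto simp: P_def)
    have 1: "continuous_on UNIV (P q z)"
      unfolding PJ by (rule continuous_on_compose[OF cl_cont continuous_on_subset[OF J]]) (use cl in auto)
    have "range (P q z) \<subseteq> ?J ` {0..S}" unfolding PJ using cl by auto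
    moreover have "bounded (?J ` {0..S})"
      by (intro compact_imp_bounded compact_continuous_image J) auto
    ultimately show ?thesis using 1 bounded_subset by (auto simp: bcontfun_def)
  qed
  have exp_int: "((\<lambda>s. L * exp (c * s) * d) has_integral (L / c * d * (exp (c * t) - 1))) {0..t}"
    if "0 \<le> t" for t d
  proof -
    have "((\<lambda>s. L * exp (c * s) * d) has_integral (L / c * d * exp (c * t) - L / c * d * exp (c * 0))) {0..t}"
      by (rule fundamental_theorem_of_calculus)
         (use that c in \<open>auto intro!: derivative_eq_intros simp: has_real_derivative_iff_has_vector_derivative[symmetric]\<close>)
    then show ?thesis by (simp add: algebra_simps)
  qed
  have P_contr: "dist (P q z t) (P q w t) \<le> 1/2 * d"
    if z: "continuous_on UNIV z" and w: "continuous_on UNIV w" and q: "q \<in> Q" and d: "\<And>s. dist (z s) (w s) \<le> d"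
    for q z w d t
  proof -
    let ?t = "cl t"
    have t: "?t \<in> {0..S}" by (rule cl)
    have "d \<ge> 0" using d[of 0] zero_le_dist[of "z 0" "w 0"] by linarith
    have "norm (integral {0..?t} (\<lambda>s. h q z s - h q w s)) \<le> integral {0..?t} (\<lambda>s. L * exp (c * s) * d)"
    proof (rule integral_norm_bound_integral)
      show "(\<lambda>s. h q z s - h q w s) integrable_on {0..?t}"
        by (intro integrable_diff h_int z w q t)
      show "(\<lambda>s. L * exp (c * s) * d) integrable_on {0..?t}" using exp_int t by auto
      fix s assume "s \<in> {0..?t}"
      with t have s: "s \<in> {0..S}" by auto
      have "norm (h q z s - h q w s) \<le> L * norm (exp (c * s) *\<^sub>R z s - exp (c * s) *\<^sub>R w s)"
        unfolding h_def by (rule lip[OF q s])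
      also have "\<dots> = L * (exp (c * s) * dist (z s) (w s))"
        by (simp add: scaleR_diff_right[symmetric] dist_norm)
      also have "\<dots> \<le> L * (exp (c * s) * d)"
        using d L by (intro mult_left_mono) auto
      finally show "norm (h q z s - h q w s) \<le> L * exp (c * s) * d" by simp
    qed
    also have "\<dots> = L / c * d * (exp (c * ?t) - 1)" by (intro integral_unique exp_int) (use t in auto)
    finally have 1: "norm (integral {0..?t} (h q z) - integral {0..?t} (h q w)) \<le> L / c * d * (exp (c * ?t) - 1)"
      using integral_diff[OF h_int[OF z q t] h_int[OF w q t]] by simp
    have "dist (P q z t) (P q w t) = exp (- c * ?t) * norm (integral {0..?t} (h q z) - integral {0..?t} (h q w))"
      by (simp add: P_def dist_norm scaleR_diff_right[symmetric])
    also have "\<dots> \<le> exp (- c * ?t) * (L / c * d * (exp (c * ?t) - 1))"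
      using 1 by (intro mult_left_mono) auto
    also have "\<dots> = L / c * d * (1 - exp (- c * ?t))"
      by (simp add: algebra_simps exp_minus)
    also have "\<dots> \<le> L / c * d * 1"
      using \<open>d \<ge> 0\<close> L c by (intro mult_left_mono) auto
    also have "\<dots> \<le> 1/2 * d" using mult_right_mono[OF c(2) \<open>d \<ge> 0\<close>] by simp
    finally show ?thesis .
  qed
  have "\<exists>z. apply_bcontfun z = P q (apply_bcontfun z)" if q: "q \<in> Q" for q
  proof -
    define F where "F z = Bcontfun (P q (apply_bcontfun z))" for z
    have F: "apply_bcontfun (F z) = P q (apply_bcontfun z)" for z
      unfolding F_def by (rule Bcontfun_inverse[OF P_bc[OF _ q]]) auto
    have "\<exists>!z. F z = z"
    proof (rule banach_fix_type[of "1/2"])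
      show "\<forall>x y. dist (F x) (F y) \<le> 1/2 * dist x y"
      proof (intro allI dist_bound)
        fix x y s
        show "dist (apply_bcontfun (F x) s) (apply_bcontfun (F y) s) \<le> 1/2 * dist x y"
          unfolding F by (rule P_contr[OF _ _ q]) (auto intro: dist_bounded)
      qed
    qed auto
    then show ?thesis using F by metis
  qed
  then obtain Z where Z: "\<And>q. q \<in> Q \<Longrightarrow> apply_bcontfun (Z q) = P q (apply_bcontfun (Z q))"
    by metis
  define X where "X q t = exp (c * t) *\<^sub>R Z q t" for q t
  have X_eq: "X q t = x0 q + integral {0..t} (\<lambda>s. f q s (X q s))" if "q \<in> Q" "t \<in> {0..S}" for q t
  proof -
    have "X q t = exp (c * t) *\<^sub>R P q (Z q) t" unfolding X_def using Z[OF that(1)] by metis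
    also have "\<dots> = x0 q + integral {0..t} (h q (Z q))"
      unfolding P_def cl_id[OF that(2)] by (simp add: exp_minus)
    also have "h q (Z q) = (\<lambda>s. f q s (X q s))" by (auto simp: h_def X_def)
    finally show ?thesis .
  qed
  have Xc: "continuous_on {0..S} (\<lambda>s. f q s (X q s))" if "q \<in> Q" for q
    using h_cont[of "apply_bcontfun (Z q)" q] that by (simp add: h_def X_def)
  show ?thesis
  proof (rule that[of X])
    fix q t assume q: "q \<in> Q" and t: "t \<in> {0..S}"
    have "((\<lambda>u. x0 q + integral {0..u} (\<lambda>s. f q s (X q s))) has_vector_derivative f q t (X q t)) (at t within {0..S})"
      using integral_has_vector_derivative[OF Xc[OF q] t] by (auto intro!: derivative_eq_intros)
    then show "(X q has_vector_derivative f q t (X q t)) (at t within {0..S})"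
      by (rule has_vector_derivative_transform[OF t, rotated]) (use X_eq q in auto)
  next
    fix q assume "q \<in> Q"
    then show "X q 0 = x0 q" using X_eq[of q 0] S by simp
  next
    fix t assume t: "t \<in> {0..S}"
    have "continuous_on Q Z"
      unfolding continuous_on_iff
    proof (intro ballI allI impI)
      fix q and e :: real assume q: "q \<in> Q" and e: "e > 0"
      \<comment> \<open>Budget: \<open>e / 4\<close> from the right-hand side and
        \<open>e / 8\<close> from the initial value move the map by at most
        \<open>3 * e / 8\<close>. The contraction factor 1/2 doubles this to
        \<open>3 * e / 4\<close> for the fixed points.\<close>
      define e' where "e' = e / (4 * (S + 1))"
      have e': "e' > 0" "S * e' \<le> e / 4" using S e by (auto simp: e'_def field_simps)
      have "uniformly_continuous_on (Q \<times> {0..S}) (\<lambda>(p,s). h p (Z q) s)"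
        by (intro compact_uniformly_continuous h_cont2 compact_Times Q) auto
      then obtain d1 where d1: "d1 > 0"
        "\<And>w w'. \<lbrakk>w \<in> Q \<times> {0..S}; w' \<in> Q \<times> {0..S}; dist w' w < d1\<rbrakk> \<Longrightarrow>
          dist ((\<lambda>(p,s). h p (Z q) s) w') ((\<lambda>(p,s). h p (Z q) s) w) < e'"
        unfolding uniformly_continuous_on_def using e'(1) by metis
      obtain d2 where d2: "d2 > 0" "\<And>p. p \<in> Q \<Longrightarrow> dist p q < d2 \<Longrightarrow> dist (x0 p) (x0 q) < e / 8"
        using x0 q e unfolding continuous_on_iff by (metis zero_less_divide_iff zero_less_numeral)
      have "dist (Z p) (Z q) < e" if p: "p \<in> Q" and pq: "dist p q < min d1 d2" for p
      proof -
        have step: "dist (P p (Z q) s) (P q (Z q) s) \<le> 3 * e / 8" for s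
        proof -
          let ?t = "cl s"
          have t: "?t \<in> {0..S}" by (rule cl)
          have "norm (integral {0..?t} (\<lambda>s. h p (Z q) s - h q (Z q) s)) \<le> integral {0..?t} (\<lambda>s. e')"
          proof (rule integral_norm_bound_integral)
            show "(\<lambda>s. h p (Z q) s - h q (Z q) s) integrable_on {0..?t}"
              by (intro integrable_diff h_int p q t) auto
            show "(\<lambda>s. e') integrable_on {0..?t}" by auto
            fix s assume "s \<in> {0..?t}"
            with t have s: "s \<in> {0..S}" by auto
            show "norm (h p (Z q) s - h q (Z q) s) \<le> e'"
              using d1(2)[of "(q,s)" "(p,s)"] p q s pq by (auto simp: dist_Pair_Pair dist_norm)
          qed
          also have "\<dots> = ?t * e'" using t by simp
          also have "\<dots> \<le> S * e'" using t e' by (intro mult_right_mono) auto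
          also have "\<dots> \<le> e / 4" by (rule e')
          finally have 1: "norm (integral {0..?t} (h p (Z q)) - integral {0..?t} (h q (Z q))) \<le> e / 4"
            using integral_diff[OF h_int[OF _ p t, of "Z q"] h_int[OF _ q t, of "Z q"]] by simp
          have "dist (P p (Z q) s) (P q (Z q) s) = exp (- c * ?t) * norm (x0 p - x0 q + (integral {0..?t} (h p (Z q)) - integral {0..?t} (h q (Z q))))"
            unfolding P_def dist_norm scaleR_diff_right[symmetric] norm_scaleR by (simp add: algebra_simps)
          also have "\<dots> \<le> 1 * norm (x0 p - x0 q + (integral {0..?t} (h p (Z q)) - integral {0..?t} (h q (Z q))))"
            using t c by (intro mult_right_mono) auto
          also have "\<dots> \<le> norm (x0 p - x0 q) + e / 4"
            using norm_triangle_ineq[of "x0 p - x0 q"] 1 by (smt (verit))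
          also have "\<dots> \<le> 3 * e / 8" using d2(2)[OF p] pq by (simp add: dist_norm)
          finally show ?thesis .
        qed
        have "dist (Z p) (Z q) \<le> 1/2 * dist (Z p) (Z q) + 3 * e / 8"
        proof (rule dist_bound)
          fix s
          have "dist (Z p s) (Z q s) = dist (P p (Z p) s) (P q (Z q) s)" using Z p q by metis
          also have "\<dots> \<le> dist (P p (Z p) s) (P p (Z q) s) + dist (P p (Z q) s) (P q (Z q) s)"
            by (rule dist_triangle)
          also have "\<dots> \<le> 1/2 * dist (Z p) (Z q) + 3 * e / 8"
            by (intro add_mono step P_contr p) (auto intro: dist_bounded)
          finally show "dist (Z p s) (Z q s) \<le> 1/2 * dist (Z p) (Z q) + 3 * e / 8" .
        qed
        then show ?thesis using e by simp
      qed
      then show "\<exists>d>0. \<forall>p\<in>Q. dist p q < d \<longrightarrow> dist (Z p) (Z q) < e"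
        using d1(1) d2(1) by (intro exI[of _ "min d1 d2"]) auto
    qed
    then have Zt: "continuous_on Q (\<lambda>q. Z q t)"
      unfolding continuous_on_iff using dist_fun_lt_imp_dist_val_lt by metis
    show "continuous_on Q (\<lambda>q. X q t)"
      unfolding X_def by (intro continuous_intros Zt)
  qed
qed

section \<open>A relaxed form of the theorem of Poincare and Miranda\<close>

text \<open>On the compact set where \<open>g\<close> is not positive, \<open>|f|\<close> has a
  positive minimum, so a large multiple of it outweighs the minimum of \<open>g\<close>.\<close>

lemma positive_on_compact_zero_set:
  fixes f g :: "'a::metric_space \<Rightarrow> real"
  assumes K: "compact K" and f: "continuous_on K f" and g: "continuous_on K g"
    and pos: "\<And>x. x \<in> K \<Longrightarrow> f x = 0 \<Longrightarrow> g x > 0"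
  obtains C where "C \<ge> 0" "\<And>x c. x \<in> K \<Longrightarrow> c \<ge> C \<Longrightarrow> g x + c * \<bar>f x\<bar> > 0"
proof -
  define K' where "K' = {x \<in> K. g x \<le> 0}"
  have K': "compact K'"
    unfolding K'_def using continuous_closedin_preimage[OF g, of "{..0}"] K
    by (simp add: closedin_compact vimage_def Int_def)
  show ?thesis
  proof (cases "K' = {}")
    case True
    then show ?thesis by (intro that[of 0]) (force simp: K'_def intro: add_pos_nonneg)+
  next
    case False
    have sub: "K' \<subseteq> K" by (auto simp: K'_def)
    obtain x0 where x0: "x0 \<in> K'" "\<And>x. x \<in> K' \<Longrightarrow> \<bar>f x0\<bar> \<le> \<bar>f x\<bar>"
      using continuous_attains_inf[OF K' False, of "\<lambda>x. \<bar>f x\<bar>"]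
        continuous_on_subset[OF f sub] by (auto intro: continuous_intros)
    obtain x1 where x1: "x1 \<in> K'" "\<And>x. x \<in> K' \<Longrightarrow> g x1 \<le> g x"
      using continuous_attains_inf[OF K' False continuous_on_subset[OF g sub]] by auto
    define m where "m = \<bar>f x0\<bar>"
    have m: "m > 0" using pos[of x0] x0(1) by (fastforce simp: m_def K'_def)
    define C where "C = (1 - g x1) / m"
    have g1: "g x1 \<le> 0" using x1(1) by (auto simp: K'_def)
    show ?thesis
    proof (rule that[of C])
      show C0: "C \<ge> 0" using g1 m by (auto simp: C_def)
      fix x c assume x: "x \<in> K" and c: "c \<ge> C"
      show "g x + c * \<bar>f x\<bar> > 0"
      proof (cases "g x \<le> 0")
        case True
        then have xK: "x \<in> K'" using x by (auto simp: K'_def)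
        have "1 - g x1 = C * m" using m by (simp add: C_def)
        also have "\<dots> \<le> c * \<bar>f x\<bar>"
          using c C0 m x0(2)[OF xK] by (intro mult_mono) (auto simp: m_def)
        finally show ?thesis using x1(2)[OF xK] by linarith
      next
        case False
        then show ?thesis using c C0 by (intro add_pos_nonneg) auto
      qed
    qed
  qed
qed

text \<open>
  Unlike in the classical statement, the sign of \<open>G\<close> on the two vertical sides is prescribed only where \<open>F\<close> vanishes.
  Adding to \<open>G\<close> a large multiple of \<open>|F|\<close>, with a sign that changes from side to side, reduces this to the
  classical situation.
\<close>

lemma poincare_miranda_relaxed:
  fixes F G :: "real \<times> real \<Rightarrow> real" and P N :: real
  assumes P: "P > 0" and N: "N > 0"
    and F: "continuous_on ({-P..P} \<times> {-N..N}) F" and G: "continuous_on ({-P..P} \<times> {-N..N}) G"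
    and bot: "\<And>p. p \<in> {-P..P} \<Longrightarrow> F (p, -N) < 0"
    and top: "\<And>p. p \<in> {-P..P} \<Longrightarrow> F (p, N) > 0"
    and left: "\<And>k. k \<in> {-N..N} \<Longrightarrow> F (-P, k) = 0 \<Longrightarrow> G (-P, k) > 0"
    and right: "\<And>k. k \<in> {-N..N} \<Longrightarrow> F (P, k) = 0 \<Longrightarrow> G (P, k) < 0"
  obtains p k where "p \<in> {-P..P}" "k \<in> {-N..N}" "F (p, k) = 0" "G (p, k) = 0"
proof -
  let ?R = "{-P..P} \<times> {-N..N}"
  have edge: "continuous_on {-N..N} (\<lambda>k. H (q, k))" if "continuous_on ?R H" "q \<in> {-P..P}" for H :: "real \<times> real \<Rightarrow> real" and q
    by (rule continuous_on_compose2[OF that(1)]) (use that(2) in \<open>auto intro!: continuous_intros\<close>)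
  have Pm: "- P \<in> {-P..P}" "P \<in> {-P..P}" using P by auto
  obtain C1 where C1: "C1 \<ge> 0" "\<And>k c. k \<in> {-N..N} \<Longrightarrow> c \<ge> C1 \<Longrightarrow> G (-P,k) + c * \<bar>F (-P,k)\<bar> > 0"
    using positive_on_compact_zero_set[OF compact_Icc edge[OF F Pm(1)] edge[OF G Pm(1)] left] by blast
  have "continuous_on {-N..N} (\<lambda>k. - G (P,k))" using edge[OF G, of P] P by (auto intro: continuous_intros)
  then obtain C2 where C2: "C2 \<ge> 0" "\<And>k c. k \<in> {-N..N} \<Longrightarrow> c \<ge> C2 \<Longrightarrow> - G (P,k) + c * \<bar>F (P,k)\<bar> > 0"
    using positive_on_compact_zero_set[OF compact_Icc edge[OF F Pm(2)], of "\<lambda>k. - G (P,k)"] right continuous_on_minus[OF edge[OF G Pm(2)]] by simp blast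
  define c where "c = max C1 C2"
  define H where "H w = G w - c * (fst w / P) * \<bar>F w\<bar>" for w
  have H: "continuous_on ?R H" unfolding H_def using P by (intro continuous_intros F G) auto
  define cl where "cl b x = max (- b) (min b x)" for b x :: real
  \<comment> \<open>Each coordinate is displaced and clamped back to the rectangle. On every side
    the signs of \<open>H\<close> and \<open>F\<close> push strictly inward, so at a fixed point no
    clamp is active and both displacements vanish.\<close>
  define f where "f w = (cl P (fst w + H w), cl N (snd w - F w))" for w
  have contf: "continuous_on ?R f" unfolding f_def cl_def by (intro continuous_intros F H)
  have "f \<in> ?R \<rightarrow> ?R" using P N by (auto simp: f_def cl_def)
  then obtain w where w: "w \<in> ?R" "f w = w"
    using brouwer[of ?R f] contf P N by (auto simp: compact_Times convex_Times)
  obtain p k where pk: "w = (p, k)" by (cases w)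
  have p: "p \<in> {-P..P}" and k: "k \<in> {-N..N}" using w pk by auto
  have e1: "cl P (p + H (p,k)) = p" and e2: "cl N (k - F (p,k)) = k" using w(2) pk by (auto simp: f_def)
  have "k \<noteq> N" "k \<noteq> - N" using e2 top[OF p] bot[OF p] N by (auto simp: cl_def max_def min_def split: if_splits)
  then have F0: "F (p,k) = 0" using e2 k by (auto simp: cl_def max_def min_def split: if_splits)
  have "p \<noteq> P"
  proof
    assume "p = P"
    then have "H (p,k) < 0" using C2(2)[OF k, of c] P by (auto simp: H_def c_def)
    then show False using e1 P \<open>p = P\<close> by (auto simp: cl_def max_def min_def split: if_splits)
  qed
  moreover have "p \<noteq> - P"
  proof
    assume "p = - P"
    then have "H (p,k) > 0" using C1(2)[OF k, of c] P by (auto simp: H_def c_def)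
    then show False using e1 P \<open>p = - P\<close> by (auto simp: cl_def max_def min_def split: if_splits)
  qed
  ultimately have "H (p,k) = 0" using e1 p by (auto simp: cl_def max_def min_def split: if_splits)
  then show ?thesis using that[OF p k F0] F0 by (simp add: H_def)
qed

section \<open>The forced harmonic oscillator\<close>

lemma increment_ge:
  fixes f :: "real \<Rightarrow> real"
  assumes "a \<le> b" "\<And>x. x \<in> {a..b} \<Longrightarrow> (f has_real_derivative f' x) (at x within {a..b})"
    and "\<And>x. x \<in> {a..b} \<Longrightarrow> c \<le> f' x"
  shows "c * (b - a) \<le> f b - f a"
proof (cases "a < b")
  case True
  have "\<exists>x\<in>{a<..<b}. f b - f a = (\<lambda>x. (*) (f' x)) x (b - a)"
    by (rule mvt_simple[OF True]) (use assms(2) in \<open>auto simp: has_field_derivative_def\<close>)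
  then obtain x where "x \<in> {a<..<b}" "f b - f a = f' x * (b - a)" by auto
  then show ?thesis using assms(3)[of x] True by (auto intro!: mult_right_mono)
qed (use assms(1) in auto)

lemma increment_le:
  fixes f :: "real \<Rightarrow> real"
  assumes "a \<le> b" "\<And>x. x \<in> {a..b} \<Longrightarrow> (f has_real_derivative f' x) (at x within {a..b})"
    and "\<And>x. x \<in> {a..b} \<Longrightarrow> f' x \<le> c"
  shows "f b - f a \<le> c * (b - a)"
proof -
  have "- c * (b - a) \<le> - f b - (- f a)"
    by (rule increment_ge[where f' = "\<lambda>x. - f' x"]) (use assms in \<open>auto intro: DERIV_minus\<close>)
  then show ?thesis by simp
qed

lemma one_minus_cos_le: "1 - cos s \<le> s\<^sup>2 / 2" for s :: real
proof -
  have "1 - cos s = 2 * (sin (s/2))\<^sup>2" using cos_double_sin[of "s/2"] by simp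
  also have "(sin (s/2))\<^sup>2 \<le> (s/2)\<^sup>2" using abs_sin_x_le_abs_x[of "s/2"] by (simp only: abs_le_square_iff)
  finally show ?thesis by (simp add: power_divide)
qed

lemma cos_ge_one_minus:
  fixes s :: real
  assumes "0 \<le> s"
  shows "1 - s \<le> cos s"
proof (cases "s \<le> 2")
  case True
  then have "s\<^sup>2 / 2 \<le> s" using mult_right_mono[of s 2 s] assms by (simp add: power2_eq_square)
  then show ?thesis using one_minus_cos_le[of s] by linarith
next
  case False
  then show ?thesis using cos_ge_minus_one[of s] by linarith
qed

lemma sin_ge_chord:
  fixes s b :: real
  assumes "0 < b" "b \<le> pi" "0 \<le> s" "s \<le> b"
  shows "sin b / b * s \<le> sin s"
proof -
  have "concave_on {0..pi} sin"
    by (rule f''_le0_imp_concave[where f' = cos and f'' = "\<lambda>x. - sin x"])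
       (auto intro!: derivative_eq_intros sin_ge_zero)
  from concave_onD[OF this, of "s / b" 0 b] assms show ?thesis by (simp add: field_simps)
qed

lemma sin_ge_half:
  fixes s :: real
  assumes "0 \<le> s" "s \<le> 1"
  shows "s / 2 \<le> sin s"
proof -
  have "1 / 2 * (s - 0) \<le> sin s - sin 0"
  proof (rule increment_ge[where f' = cos])
    fix x assume "x \<in> {0..s}"
    then have "x\<^sup>2 \<le> 1" using assms by (auto simp: power_le_one)
    then show "1 / 2 \<le> cos x" using one_minus_cos_le[of x] by linarith
  qed (use assms in \<open>auto intro!: derivative_eq_intros\<close>)
  then show ?thesis using assms by simp
qed

lemma zero_derivative_at_interior_min:
  fixes f :: "real \<Rightarrow> real"
  assumes d: "(f has_real_derivative l) (at c within {a..b})" and c: "a < c" "c < b"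
    and min: "\<And>s. s \<in> {a..b} \<Longrightarrow> f c \<le> f s"
  shows "l = 0"
proof (rule DERIV_local_min[where d = "min (c - a) (b - c)"])
  show "(f has_real_derivative l) (at c)" using d at_within_interior[of c "{a..b}"] c by simp
qed (use c in \<open>auto intro!: min\<close>)

lemma zero_derivative_at_interior_max:
  fixes f :: "real \<Rightarrow> real"
  assumes d: "(f has_real_derivative l) (at c within {a..b})" and c: "a < c" "c < b"
    and max: "\<And>s. s \<in> {a..b} \<Longrightarrow> f s \<le> f c"
  shows "l = 0"
  using zero_derivative_at_interior_min[OF DERIV_minus[OF d] c] max by simp

locale forced_oscillator =
  fixes \<alpha> :: real and u y g :: "real \<Rightarrow> real"
  assumes du: "\<And>s. s \<in> {0..\<alpha>} \<Longrightarrow> (u has_real_derivative y s) (at s within {0..\<alpha>})"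
    and dy: "\<And>s. s \<in> {0..\<alpha>} \<Longrightarrow> (y has_real_derivative g s - u s) (at s within {0..\<alpha>})"
begin

text \<open>The Wronskian of \<open>u - G\<close> with the homogeneous solution
  \<open>sin (s - c)\<close>. Its derivative involves only the excess forcing \<open>g - G\<close>,
  and at \<open>s = c\<close> it equals \<open>u c - G\<close>; this is variation of constants
  without integrals.\<close>

definition wr :: "real \<Rightarrow> real \<Rightarrow> real \<Rightarrow> real" where
  "wr c G s = (u s - G) * cos (s - c) - y s * sin (s - c)"

lemma wr_increment_ge:
  assumes "0 \<le> a" "a \<le> b" "b \<le> \<alpha>" "\<And>s. s \<in> {a..b} \<Longrightarrow> B \<le> - (g s - G) * sin (s - c)"
  shows "B * (b - a) \<le> wr c G b - wr c G a"
proof (rule increment_ge[where f' = "\<lambda>s. - (g s - G) * sin (s - c)"])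
  fix s assume s: "s \<in> {a..b}"
  have 1: "(u has_real_derivative y s) (at s within {a..b})"
    "(y has_real_derivative g s - u s) (at s within {a..b})"
    using du[of s] dy[of s] s assms by (auto intro: has_field_derivative_subset)
  show "(wr c G has_real_derivative - (g s - G) * sin (s - c)) (at s within {a..b})"
    unfolding wr_def by (auto intro!: derivative_eq_intros 1) (simp add: algebra_simps)
qed (use assms in auto)

lemma negated: "forced_oscillator \<alpha> (\<lambda>s. - u s) (\<lambda>s. - y s) (\<lambda>s. - g s)"
  by standard (use DERIV_minus[OF du] DERIV_minus[OF dy] in auto)

lemma reflected: "forced_oscillator \<alpha> (\<lambda>s. u (\<alpha> - s)) (\<lambda>s. - y (\<alpha> - s)) (\<lambda>s. g (\<alpha> - s))"
proof
  fix s assume s: "s \<in> {0..\<alpha>}"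
  have im: "(\<lambda>s. \<alpha> - s) ` {0..\<alpha>} \<subseteq> {0..\<alpha>}" by auto
  have r: "((\<lambda>s. \<alpha> - s) has_real_derivative -1) (at s within {0..\<alpha>})"
    by (auto intro!: derivative_eq_intros)
  show "((\<lambda>s. u (\<alpha> - s)) has_real_derivative - y (\<alpha> - s)) (at s within {0..\<alpha>})"
    using DERIV_image_chain[OF has_field_derivative_subset[OF du im] r] s by (simp add: o_def)
  show "((\<lambda>s. - y (\<alpha> - s)) has_real_derivative g (\<alpha> - s) - u (\<alpha> - s)) (at s within {0..\<alpha>})"
    using DERIV_minus[OF DERIV_image_chain[OF has_field_derivative_subset[OF dy im] r]] s by (simp add: o_def)
qed

text \<open>The kernel \<open>sin (b - s)\<close> is nonnegative on a span of at most
  \<open>pi\<close>, so replacing the forcing by a smaller constant can only lower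
  \<open>u b\<close>. The bound is the solution for that constant.\<close>

lemma lower_forward:
  assumes "0 \<le> a" "a \<le> b" "b \<le> \<alpha>" "b - a \<le> pi" "\<And>s. s \<in> {a..b} \<Longrightarrow> G \<le> g s"
  shows "G + (u a - G) * cos (b - a) + y a * sin (b - a) \<le> u b"
proof -
  have "0 * (b - a) \<le> wr b G b - wr b G a"
  proof (rule wr_increment_ge)
    fix s assume s: "s \<in> {a..b}"
    then have "0 \<le> sin (b - s)" using assms by (intro sin_ge_zero) auto
    then have "sin (s - b) \<le> 0" using sin_minus[of "s - b"] by simp
    then show "0 \<le> - (g s - G) * sin (s - b)"
      using assms(5)[OF s] by (auto intro!: mult_nonpos_nonpos)
  qed (use assms in auto)
  moreover have "cos (a - b) = cos (b - a)" "sin (a - b) = - sin (b - a)"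
    using cos_minus[of "b - a"] sin_minus[of "b - a"] by auto
  ultimately show ?thesis by (simp add: wr_def)
qed

lemma upper_forward:
  assumes "0 \<le> a" "a \<le> b" "b \<le> \<alpha>" "b - a \<le> pi" "\<And>s. s \<in> {a..b} \<Longrightarrow> g s \<le> G"
  shows "u b \<le> G + (u a - G) * cos (b - a) + y a * sin (b - a)"
  using forced_oscillator.lower_forward[OF negated, of a b "- G"] assms by (simp add: algebra_simps)

lemma lower_backward:
  assumes "0 \<le> b" "b \<le> a" "a \<le> \<alpha>" "a - b \<le> pi" "\<And>s. s \<in> {b..a} \<Longrightarrow> G \<le> g s"
  shows "G + (u a - G) * cos (a - b) - y a * sin (a - b) \<le> u b"
  using forced_oscillator.lower_forward[OF reflected, of "\<alpha> - a" "\<alpha> - b" G] assms by simp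

lemma upper_backward:
  assumes "0 \<le> b" "b \<le> a" "a \<le> \<alpha>" "a - b \<le> pi" "\<And>s. s \<in> {b..a} \<Longrightarrow> g s \<le> G"
  shows "u b \<le> G + (u a - G) * cos (a - b) - y a * sin (a - b)"
  using forced_oscillator.lower_backward[OF negated, of b a "- G"] assms by (simp add: algebra_simps)

text \<open>For constant forcing the derivative of the Wronskian vanishes whatever the sign of the
  kernel, so the span may be of any length.\<close>

lemma exact:
  assumes "0 \<le> a" "a \<le> b" "b \<le> \<alpha>" "\<And>s. s \<in> {a..b} \<Longrightarrow> g s = G"
  shows "u b = G + (u a - G) * cos (b - a) + y a * sin (b - a)"
proof -
  interpret neg: forced_oscillator \<alpha> "\<lambda>s. - u s" "\<lambda>s. - y s" "\<lambda>s. - g s" by (rule negated)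
  have "0 * (b - a) \<le> wr b G b - wr b G a" by (rule wr_increment_ge) (use assms in auto)
  moreover have "0 * (b - a) \<le> neg.wr b (- G) b - neg.wr b (- G) a"
    by (rule neg.wr_increment_ge) (use assms in auto)
  moreover have "cos (a - b) = cos (b - a)" "sin (a - b) = - sin (b - a)"
    using cos_minus[of "b - a"] sin_minus[of "b - a"] by auto
  ultimately show ?thesis by (simp add: wr_def neg.wr_def algebra_simps)
qed

end

section \<open>The truncated Clairaut system\<close>

lemma neg_le_of_abs_le: "\<bar>a\<bar> \<le> b \<Longrightarrow> - b \<le> a" for a b :: real
  by linarith

text \<open>
  The data of Clairaut's equation: \<open>ub\<close> and \<open>ua\<close> are the inverse radii at the start (the point \<open>B\<close>) and
  at the end of the backward motion, \<open>d s v\<close> is the damping at swept angle \<open>s\<close> and inverse radius \<open>v\<close>.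
\<close>

locale kepler_shooting =
  fixes \<alpha> M T ua ub \<epsilon> \<Lambda> :: real and d :: "real \<Rightarrow> real \<Rightarrow> real"
  assumes alpha: "0 < \<alpha>" "\<alpha> < 2 * pi"
    and M: "0 < M" and T: "0 < T" and ua: "0 < ua" and ub: "0 < ub"
    and eps: "0 < \<epsilon>" "2 * \<epsilon> < min ua ub" "\<epsilon> \<le> sin (\<alpha>/2) * min ua ub" "4 * exp (M * T) * T * (\<epsilon> * sqrt \<epsilon>) < 1"
    and Lam: "0 < \<Lambda>" "T < \<Lambda> * \<epsilon>" "pi < \<alpha> \<Longrightarrow> T < \<Lambda> * \<epsilon> * (\<alpha> - pi)"
    and d: "\<And>s v. s \<in> {0..\<alpha>} \<Longrightarrow> v > 0 \<Longrightarrow> 0 \<le> d s v \<and> d s v \<le> M"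
begin

definition loss :: "real \<Rightarrow> real" where "loss x = max 0 (min x (M * T))"
definition floor_u :: "real \<Rightarrow> real" where "floor_u v = max v \<epsilon>"
text \<open>The largest factor by which damping bounded by \<open>M\<close> can change the angular
  momentum within time \<open>T\<close>.\<close>

definition \<kappa> :: real where "\<kappa> = exp (M * T)"

lemma floor_u: "floor_u v > 0" "floor_u v \<ge> \<epsilon>" "floor_u v \<ge> v" using eps by (auto simp: floor_u_def)
lemma loss: "0 \<le> loss x" "loss x \<le> M * T" using M T by (auto simp: loss_def)
lemma loss_mono: "x \<le> x' \<Longrightarrow> loss x \<le> loss x'" by (auto simp: loss_def)
lemma kappa: "\<kappa> \<ge> 1" using M T by (auto simp: \<kappa>_def)

text \<open>Constants for \<open>end_above_target\<close>. A constant forcing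
  \<open>k / \<kappa>\<^sup>2\<close> contributes \<open>m * k\<close> at the angle \<alpha>, and at
  least \<open>2 * \<delta> * k\<close> already at the angle \<open>m / 8\<close>. The summands of
  \<open>C_top\<close> ensure in turn that \<open>k \<ge> 1\<close>, that
  \<open>\<delta> * k\<close> outweighs the end values and the initial slope, and that the forcing
  hardly varies while \<open>u\<close> is at least \<open>\<delta> * k\<close>.\<close>

definition m :: real where "m = (1 - cos \<alpha>) / \<kappa>\<^sup>2"
definition \<delta> :: real where "\<delta> = min ((1 - cos (m / 8)) / (2 * \<kappa>\<^sup>2)) (m / 4)"
definition C_top :: real where "C_top = 1 + (ua + ub + 1) / \<delta> + 128 * pi * M / (m * \<delta>\<^sup>2)"

lemma cos_alpha: "cos \<alpha> < 1"
proof -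
  have "cos \<alpha> \<noteq> 1"
  proof
    assume "cos \<alpha> = 1"
    then have "\<alpha> \<in> {x. cos x = 1}" by simp
    then obtain n :: int where n: "\<alpha> = n * 2 * pi" by (auto simp: cos_one_2pi_int)
    then have "0 < n" "n < 1" using alpha pi_gt_zero by (auto simp: zero_less_mult_iff)
    then show False by simp
  qed
  then show ?thesis using cos_le_one[of \<alpha>] by linarith
qed

lemma m: "0 < m" "m \<le> 2"
proof -
  show "0 < m" using cos_alpha kappa by (auto simp: m_def)
  have "m \<le> (1 - cos \<alpha>) / 1" unfolding m_def using kappa cos_alpha by (intro divide_left_mono) auto
  then show "m \<le> 2" using cos_ge_minus_one[of \<alpha>] unfolding div_by_1 by linarith
qed

lemma delta: "0 < \<delta>" "\<delta> \<le> m / 4" "\<delta> \<le> (1 - cos (m / 8)) / (2 * \<kappa>\<^sup>2)"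
proof -
  have "cos (m / 8) < cos 0" using m pi_gt3 by (intro cos_monotone_0_pi) auto
  then show "0 < \<delta>" using m kappa by (auto simp: \<delta>_def)
qed (auto simp: \<delta>_def)

lemma C_top: "C_top \<ge> 1" "C_top * \<delta> \<ge> ua + ub + 1" "C_top \<ge> 128 * pi * M / (m * \<delta>\<^sup>2)"
proof -
  have *: "(ua + ub + 1) / \<delta> \<ge> 0" "128 * pi * M / (m * \<delta>\<^sup>2) \<ge> 0" using m delta M ua ub by auto
  then show "C_top \<ge> 1" "C_top \<ge> 128 * pi * M / (m * \<delta>\<^sup>2)" by (auto simp: C_top_def)
  have "ua + ub + 1 = (ua + ub + 1) / \<delta> * \<delta>" using delta by simp
  also have "\<dots> \<le> C_top * \<delta>" using * delta(1) by (intro mult_right_mono) (auto simp: C_top_def)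
  finally show "C_top * \<delta> \<ge> ua + ub + 1" .
qed

end

text \<open>
  The function \<open>l\<close> is the logarithm of the growth of the angular momentum, so that
  \<open>1 / c = sqrt k * exp (- l)\<close>. The system is truncated to make it globally Lipschitz: \<open>loss\<close> caps the damping that
  acts on the forcing at the amount possible within time \<open>T\<close>, \<open>floor_u\<close> keeps away from \<open>u = 0\<close>, and a
  penalty proportional to \<open>\<Lambda>\<close> is added to the elapsed time wherever \<open>u\<close> falls below \<open>\<epsilon>\<close>. A trajectory
  with the right end values turns out not to feel the truncation. Values \<open>k \<le> 0\<close> have no mechanical
  meaning; they provide a side of the parameter rectangle on which \<open>u\<close> ends below its target.
\<close>

locale kepler_trajectory = kepler_shooting +
  fixes p k :: real and u y l t :: "real \<Rightarrow> real"
  assumes du: "\<And>s. s \<in> {0..\<alpha>} \<Longrightarrow> (u has_real_derivative y s) (at s within {0..\<alpha>})"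
    and dy: "\<And>s. s \<in> {0..\<alpha>} \<Longrightarrow>
      (y has_real_derivative k * exp (- 2 * loss (l s)) - u s) (at s within {0..\<alpha>})"
    and dl: "\<And>s. s \<in> {0..\<alpha>} \<Longrightarrow> (l has_real_derivative
      d s (floor_u (u s)) * (sqrt (max 0 k) * exp (- loss (l s)) / (floor_u (u s))\<^sup>2)) (at s within {0..\<alpha>})"
    and dt: "\<And>s. s \<in> {0..\<alpha>} \<Longrightarrow> (t has_real_derivative
      sqrt (max 0 k) * exp (- loss (l s)) / (floor_u (u s))\<^sup>2 + \<Lambda> * max 0 (\<epsilon> - u s)) (at s within {0..\<alpha>})"
    and init: "u 0 = ub" "y 0 = p" "l 0 = 0" "t 0 = 0"
begin

text \<open>For positive \<open>k\<close>, \<open>g\<close> is the forcing \<open>1 / c^2\<close>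
  and \<open>\<omega>\<close> the time spent per unit of angle, \<open>1 / (c * u^2)\<close>, both
  truncated and without the penalty.\<close>

definition g :: "real \<Rightarrow> real" where "g s = k * exp (- 2 * loss (l s))"
definition \<omega> :: "real \<Rightarrow> real" where "\<omega> s = sqrt (max 0 k) * exp (- loss (l s)) / (floor_u (u s))\<^sup>2"

sublocale forced_oscillator \<alpha> u y g
  by standard (use du dy in \<open>auto simp: g_def\<close>)

lemma omega_nonneg: "0 \<le> \<omega> s" by (auto simp: \<omega>_def)

lemma dl_bounds: "s \<in> {0..\<alpha>} \<Longrightarrow> 0 \<le> d s (floor_u (u s)) * \<omega> s \<and> d s (floor_u (u s)) * \<omega> s \<le> M * \<omega> s"
  using d[of s "floor_u (u s)"] floor_u(1)[of "u s"] omega_nonneg[of s] by (auto intro: mult_right_mono)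

lemma dl': "s \<in> {a..b} \<Longrightarrow> 0 \<le> a \<Longrightarrow> b \<le> \<alpha> \<Longrightarrow> (l has_real_derivative d s (floor_u (u s)) * \<omega> s) (at s within {a..b})"
  unfolding \<omega>_def by (rule has_field_derivative_subset[OF dl]) auto

lemma dt': "s \<in> {a..b} \<Longrightarrow> 0 \<le> a \<Longrightarrow> b \<le> \<alpha> \<Longrightarrow> (t has_real_derivative \<omega> s + \<Lambda> * max 0 (\<epsilon> - u s)) (at s within {a..b})"
  unfolding \<omega>_def by (rule has_field_derivative_subset[OF dt]) auto

lemma l_mono: "0 \<le> a \<Longrightarrow> a \<le> b \<Longrightarrow> b \<le> \<alpha> \<Longrightarrow> l a \<le> l b"
  using increment_ge[of a b l "\<lambda>s. d s (floor_u (u s)) * \<omega> s" 0] dl' dl_bounds by force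

lemma l_increment: 
  assumes "0 \<le> a" "a \<le> b" "b \<le> \<alpha>" "\<And>s. s \<in> {a..b} \<Longrightarrow> M * \<omega> s \<le> c"
  shows "l b - l a \<le> c * (b - a)"
proof (rule increment_le[OF assms(2) dl'])
  fix s assume s: "s \<in> {a..b}"
  then have "d s (floor_u (u s)) * \<omega> s \<le> M * \<omega> s" using dl_bounds[of s] assms by auto
  then show "d s (floor_u (u s)) * \<omega> s \<le> c" using assms(4)[OF s] by linarith
qed (use assms in auto)

lemma t_increment_ge:
  assumes "0 \<le> a" "a \<le> b" "b \<le> \<alpha>" "\<And>s. s \<in> {a..b} \<Longrightarrow> c \<le> \<omega> s + \<Lambda> * max 0 (\<epsilon> - u s)"
  shows "c * (b - a) \<le> t b - t a"
  by (rule increment_ge[OF assms(2) dt' assms(4)]) (use assms in auto)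

lemma t_mono: "0 \<le> a \<Longrightarrow> a \<le> b \<Longrightarrow> b \<le> \<alpha> \<Longrightarrow> t a \<le> t b"
  using t_increment_ge[of a b 0] omega_nonneg Lam(1) by force

lemma l_nonneg: "s \<in> {0..\<alpha>} \<Longrightarrow> 0 \<le> l s" using l_mono[of 0 s] init by auto

lemma exp_loss: "1 / \<kappa> \<le> exp (- loss x)" "exp (- loss x) \<le> 1"
  using loss[of x] by (auto simp: \<kappa>_def exp_minus inverse_eq_divide intro!: divide_left_mono)

lemma g_alt: "g s = k * (exp (- loss (l s)))\<^sup>2"
  unfolding g_def power2_eq_square exp_add[symmetric] by simp

lemma g_bounds: assumes "0 \<le> k" shows "k / \<kappa>\<^sup>2 \<le> g s" "g s \<le> k" "0 \<le> g s"
proof -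
  have "(1 / \<kappa>)\<^sup>2 \<le> (exp (- loss (l s)))\<^sup>2"
    using exp_loss(1) kappa by (intro power_mono) auto
  from mult_left_mono[OF this assms] show "k / \<kappa>\<^sup>2 \<le> g s" by (simp add: g_alt power_divide)
  have "(exp (- loss (l s)))\<^sup>2 \<le> 1\<^sup>2" using exp_loss(2) by (intro power_mono) auto
  from mult_left_mono[OF this assms] show "g s \<le> k" by (simp add: g_alt)
  show "0 \<le> g s" using assms by (simp add: g_alt)
qed

lemma g_antimono: "0 \<le> k \<Longrightarrow> 0 \<le> a \<Longrightarrow> a \<le> b \<Longrightarrow> b \<le> \<alpha> \<Longrightarrow> g b \<le> g a"
  unfolding g_def using loss_mono[OF l_mono] by (intro mult_left_mono) auto

text \<open>A further loss of at most \<eta> multiplies the forcing by at least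
  \<open>exp (- 2 * \<eta>)\<close>, which is at least \<open>1 - 2 * \<eta>\<close>.\<close>

lemma g_variation:
  assumes "0 \<le> k" "0 \<le> a" "a \<le> b" "b \<le> \<alpha>" "l b - l a \<le> \<eta>"
  shows "g a - g b \<le> 2 * \<eta> * k"
proof -
  have "loss (l b) - loss (l a) \<le> \<eta>" "loss (l a) \<le> loss (l b)"
    using assms l_mono[of a b] by (auto simp: loss_def)
  then have "1 - 2 * \<eta> \<le> 1 + (- 2 * (loss (l b) - loss (l a)))" by simp
  also have "\<dots> \<le> exp (- 2 * (loss (l b) - loss (l a)))" by (rule exp_ge_add_one_self)
  finally have e: "1 - exp (- 2 * (loss (l b) - loss (l a))) \<le> 2 * \<eta>" by simp
  have \<eta>: "0 \<le> \<eta>" using assms l_mono[of a b] by auto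
  have "g b = g a * exp (- 2 * (loss (l b) - loss (l a)))"
    unfolding g_def mult.assoc exp_add[symmetric] by (simp add: algebra_simps)
  then have "g a - g b = g a * (1 - exp (- 2 * (loss (l b) - loss (l a))))" by (simp add: algebra_simps)
  also have "\<dots> \<le> g a * (2 * \<eta>)" using e g_bounds(3)[OF assms(1)] by (intro mult_left_mono) auto
  also have "\<dots> \<le> k * (2 * \<eta>)" using g_bounds(2)[OF assms(1)] \<eta> by (intro mult_right_mono) auto
  finally show ?thesis by (simp add: mult_ac)
qed

lemma omega_le:
  assumes "0 \<le> k" "0 < v" "v \<le> u s"
  shows "\<omega> s \<le> sqrt k / v\<^sup>2"
proof -
  have "v \<le> floor_u (u s)" using assms floor_u(3)[of "u s"] by linarith
  then have "v\<^sup>2 \<le> (floor_u (u s))\<^sup>2" using assms by (intro power_mono) auto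
  moreover have "sqrt k * exp (- loss (l s)) \<le> sqrt k * 1"
    using exp_loss(2) assms by (intro mult_left_mono) auto
  ultimately show ?thesis unfolding \<omega>_def using assms by (intro frac_le) auto
qed

lemma u_lower_pi:
  assumes "0 \<le> k" "0 \<le> s" "s \<le> \<alpha>" "s \<le> pi"
  shows "k / \<kappa>\<^sup>2 * (1 - cos s) - ub - \<bar>p\<bar> \<le> u s"
proof -
  have "k / \<kappa>\<^sup>2 + (ub - k / \<kappa>\<^sup>2) * cos s + p * sin s \<le> u s"
    using lower_forward[of 0 s "k / \<kappa>\<^sup>2"] g_bounds(1)[OF assms(1)] assms init by auto
  moreover have "ub * cos s \<ge> - ub" using ub mult_left_mono[of "-1" "cos s" ub] by auto
  moreover have "\<bar>p * sin s\<bar> \<le> \<bar>p\<bar> * 1" unfolding abs_mult by (intro mult_left_mono) auto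
  moreover have "k / \<kappa>\<^sup>2 + (ub - k / \<kappa>\<^sup>2) * cos s = k / \<kappa>\<^sup>2 * (1 - cos s) + ub * cos s"
    by (simp only: algebra_simps)
  ultimately show ?thesis by linarith
qed

lemma continuous_u: "continuous_on {0..\<alpha>} u"
  by (rule DERIV_continuous_on[OF du])

text \<open>
  Beyond the angle \<open>pi\<close> the kernel of the forcing changes sign, and the bound \<open>k / \<kappa>\<^sup>2 \<le> g \<le> k\<close>
  alone does not control \<open>u\<close>. But as long as \<open>u \<ge> \<delta> * k\<close>, little time elapses, so the forcing is
  almost constant, and for constant forcing \<open>u\<close> stays above this bound.
\<close>

lemma end_above_target:
  assumes k: "C_top * (1 + \<bar>p\<bar>) \<le> k"
  shows "ua < u \<alpha>"
proof -
  have Cp: "C_top \<le> C_top * (1 + \<bar>p\<bar>)" using C_top(1) by (simp add: mult_le_cancel_left1)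
  have kC: "C_top \<le> k" and k1: "1 \<le> k" using C_top(1) k Cp by linarith+
  have "(ua + ub + 1) * (1 + \<bar>p\<bar>) \<le> C_top * \<delta> * (1 + \<bar>p\<bar>)"
    using C_top(2) by (intro mult_right_mono) auto
  also have "\<dots> \<le> k * \<delta>" using mult_right_mono[OF k, of \<delta>] delta by (simp add: mult_ac)
  finally have kd: "(ua + ub + 1) * (1 + \<bar>p\<bar>) \<le> k * \<delta>" .
  have "ua + ub + 1 + \<bar>p\<bar> \<le> (ua + ub + 1) * (1 + \<bar>p\<bar>)" using ua ub by (simp add: algebra_simps)
  then have kd: "ua + ub + 1 + \<bar>p\<bar> \<le> k * \<delta>" using kd by linarith
  have mk: "k * \<delta> \<le> m * k / 4" using delta(2) k1 mult_left_mono[of \<delta> "m/4" k] by simp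
  show ?thesis
  proof (cases "\<alpha> \<le> pi")
    case True
    have "m * k - ub - \<bar>p\<bar> \<le> u \<alpha>"
      using u_lower_pi[of \<alpha>] True alpha k1 by (simp add: m_def mult_ac)
    then show ?thesis using mk kd ua ub by linarith
  next
    case False
    \<comment> \<open>Before \<open>s1\<close> there is no useful lower bound on \<open>u\<close>,
      so the forcing may vary there by as much as \<open>k\<close>; the length \<open>m / 8\<close>
      limits the resulting error to \<open>k * m / 8\<close>.\<close>
    define s1 where "s1 = m / 8"
    have s1: "0 < s1" "s1 < pi" using m pi_gt3 by (auto simp: s1_def)
    have early: "\<delta> * k < u s" if "s1 \<le> s" "s \<le> pi" for s
    proof -
      have "cos s \<le> cos s1" using that s1 by (intro cos_monotone_0_pi_le) auto
      then have "k / \<kappa>\<^sup>2 * (1 - cos s1) \<le> k / \<kappa>\<^sup>2 * (1 - cos s)" using k1 by (intro mult_left_mono) auto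
      moreover have "k * (2 * \<delta>) \<le> k * ((1 - cos s1) / \<kappa>\<^sup>2)"
        using delta(3) k1 by (intro mult_left_mono) (auto simp: s1_def)
      ultimately show ?thesis using u_lower_pi[of s] that s1 False k1 kd ua by (auto simp: mult_ac)
    qed
    have "\<delta> * k < u s" if s: "s \<in> {s1..\<alpha>}" for s
    proof (rule ccontr)
      assume "\<not> \<delta> * k < u s"
      then have ne: "{x \<in> {s1..\<alpha>}. u x \<le> \<delta> * k} \<noteq> {}" using s by auto
      have cl: "closed {x \<in> {s1..\<alpha>}. u x \<le> \<delta> * k}"
        using continuous_closed_preimage[OF continuous_on_subset[OF continuous_u], of "{s1..\<alpha>}" "{..\<delta> * k}"] s1
        by (auto simp: vimage_def Int_def)
      have bd: "bdd_below {x \<in> {s1..\<alpha>}. u x \<le> \<delta> * k}" by (rule bdd_belowI[of _ s1]) auto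
      \<comment> \<open>The first angle from \<open>s1\<close> on at which \<open>u\<close> fails to
        exceed \<open>\<delta> * k\<close>. Up to here little time elapses.\<close>
      define \<psi> where "\<psi> = Inf {x \<in> {s1..\<alpha>}. u x \<le> \<delta> * k}"
      have \<psi>: "\<psi> \<in> {s1..\<alpha>}" "u \<psi> \<le> \<delta> * k"
        using closed_contains_Inf[OF ne bd cl] by (auto simp: \<psi>_def)
      have before: "\<delta> * k \<le> u x" if "x \<in> {s1..\<psi>}" for x
      proof (cases "x = \<psi>")
        case True
        have "\<delta> * k \<le> u \<psi>"
        proof (rule ccontr)
          assume less: "\<not> \<delta> * k \<le> u \<psi>"
          have lt: "s1 < \<psi>" using early[of s1] less s1 \<psi> by (cases "s1 = \<psi>") auto
          obtain x where x: "s1 \<le> x" "x \<le> \<psi>" "u x = \<delta> * k"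
            using IVT2'[of u \<psi> "\<delta> * k" s1] less early[of s1] s1 lt \<psi> continuous_on_subset[OF continuous_u, of "{s1..\<psi>}"]
            by auto
          then have "x \<in> {x \<in> {s1..\<alpha>}. u x \<le> \<delta> * k}" using \<psi>(1) by auto
          then have "\<psi> \<le> x" unfolding \<psi>_def by (rule cInf_lower[OF _ bd])
          then show False using x less by auto
        qed
        then show ?thesis using True by simp
      next
        case False
        then have "x < \<psi>" using that by auto
        then show ?thesis using cInf_lower[OF _ bd, of x] that \<psi>(1) by (fold \<psi>_def) force
      qed
      have "pi < \<psi>" using early[of \<psi>] \<psi> by (cases "\<psi> \<le> pi") auto
      have dk: "0 < \<delta> * k" using delta k1 by auto
      \<comment> \<open>After \<open>s1\<close> the error is at most \<open>2 * \<eta> * k\<close>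
        times a length below 8, that is \<open>k * m / 4\<close>. The last summand of
        \<open>C_top\<close> keeps the growth of \<open>l\<close> below this
        \<open>\<eta>\<close>.\<close>
      define \<eta> where "\<eta> = m / 64"
      have "l \<psi> - l s1 \<le> (M * (sqrt k / (\<delta> * k)\<^sup>2)) * (\<psi> - s1)"
      proof (rule l_increment)
        fix x assume "x \<in> {s1..\<psi>}"
        then show "M * \<omega> x \<le> M * (sqrt k / (\<delta> * k)\<^sup>2)"
          using omega_le[OF _ dk before] M k1 by (intro mult_left_mono) auto
      qed (use s1 \<psi> in auto)
      also have "\<dots> \<le> (M * (sqrt k / (\<delta> * k)\<^sup>2)) * (2 * pi)"
        using s1 \<psi> alpha M k1 by (intro mult_left_mono) auto
      also have "\<dots> \<le> (M * (k / (\<delta> * k)\<^sup>2)) * (2 * pi)"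
        using M k1 by (intro mult_right_mono mult_left_mono divide_right_mono) (auto intro!: real_le_lsqrt simp: power2_eq_square)
      also have "\<dots> = 2 * pi * M / \<delta>\<^sup>2 / k" using k1 by (simp add: power2_eq_square field_simps)
      also have "\<dots> \<le> \<eta>"
      proof -
        have "128 * pi * M / (m * \<delta>\<^sup>2) \<le> k" using C_top(3) kC by linarith
        then show ?thesis using m delta(1) k1 by (simp add: \<eta>_def field_simps)
      qed
      finally have lv: "l \<psi> - l s1 \<le> \<eta>" .
      have gv: "g s1 - g x \<le> 2 * \<eta> * k" if "x \<in> {s1..\<psi>}" for x
        using g_variation[of s1 \<psi> \<eta>] g_antimono[of x \<psi>] lv that s1 \<psi> k1 by auto
      \<comment> \<open>Compare with the forcing frozen at \<open>s1\<close>. The Wronskian based at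
        \<psi> ends in \<open>u \<psi> - ?G\<close>, and its two errors add up to at most
        \<open>3 / 8 * k * m\<close>.\<close>
      let ?G = "g s1"
      have 1: "- k * (s1 - 0) \<le> wr \<psi> ?G s1 - wr \<psi> ?G 0"
      proof (rule wr_increment_ge)
        fix x assume x: "x \<in> {0..s1}"
        have "\<bar>- (g x - ?G) * sin (x - \<psi>)\<bar> \<le> \<bar>g x - ?G\<bar> * 1"
          unfolding abs_mult by (intro mult_mono) auto
        moreover have "\<bar>g x - ?G\<bar> \<le> k"
          using g_bounds[of x] g_bounds[of s1] k1 by auto
        ultimately show "- k \<le> - (g x - ?G) * sin (x - \<psi>)" by (intro neg_le_of_abs_le) simp
      qed (use s1 \<psi> in auto)
      have 2: "- (2 * \<eta> * k) * (\<psi> - s1) \<le> wr \<psi> ?G \<psi> - wr \<psi> ?G s1"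
      proof (rule wr_increment_ge)
        fix x assume x: "x \<in> {s1..\<psi>}"
        have "\<bar>- (g x - ?G) * sin (x - \<psi>)\<bar> \<le> \<bar>g x - ?G\<bar> * 1"
          unfolding abs_mult by (intro mult_mono) auto
        moreover have "\<bar>g x - ?G\<bar> \<le> 2 * \<eta> * k"
          using gv[OF x] g_antimono[of s1 x] x s1 \<psi> k1 by auto
        ultimately show "- (2 * \<eta> * k) \<le> - (g x - ?G) * sin (x - \<psi>)" by (intro neg_le_of_abs_le) simp
      qed (use s1 \<psi> in auto)
      have "2 * \<eta> * k * (\<psi> - s1) \<le> 2 * \<eta> * k * 8"
        using \<psi> s1 alpha pi_less_4 m k1 by (intro mult_left_mono) (auto simp: \<eta>_def)
      then have 3: "wr \<psi> ?G 0 - k * s1 - 2 * \<eta> * k * 8 \<le> wr \<psi> ?G \<psi>" using 1 2 unfolding mult_minus_left diff_0_right by linarith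
      have "wr \<psi> ?G 0 = (ub - ?G) * cos \<psi> + p * sin \<psi>" by (simp add: wr_def init)
      moreover have "ub * cos \<psi> \<ge> - ub" using ub mult_left_mono[of "-1" "cos \<psi>" ub] by auto
      moreover have "\<bar>p * sin \<psi>\<bar> \<le> \<bar>p\<bar> * 1" unfolding abs_mult by (intro mult_left_mono) auto
      moreover have "wr \<psi> ?G \<psi> = u \<psi> - ?G" by (simp add: wr_def)
      ultimately have 4: "u \<psi> \<ge> ?G * (1 - cos \<psi>) - ub - \<bar>p\<bar> - k * m / 8 - k * m / 4"
        using 3 by (simp add: s1_def \<eta>_def algebra_simps)
      have "cos \<psi> \<le> cos \<alpha>"
        using cos_monotone_0_pi_le[of "2 * pi - \<alpha>" "2 * pi - \<psi>"] \<psi> \<open>pi < \<psi>\<close> alpha by (simp add: cos_diff)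
      then have "?G * (1 - cos \<psi>) \<ge> k / \<kappa>\<^sup>2 * (1 - cos \<alpha>)"
        using g_bounds[of s1] k1 cos_alpha by (intro mult_mono) auto
      then have "?G * (1 - cos \<psi>) \<ge> k * m" by (simp add: m_def)
      moreover have "0 \<le> k * m" using m k1 by simp
      \<comment> \<open>At least half of \<open>k * m\<close> survives the errors, whereas
        \<open>u \<psi> \<le> \<delta> * k\<close> is at most a quarter of it. The remaining quarter
        exceeds \<open>ub + |p|\<close> by \<open>kd\<close>.\<close>
      ultimately have "u \<psi> \<ge> k * m / 2 - ub - \<bar>p\<bar>" using 4 by linarith
      then show False using \<psi>(2) mk kd ua by (simp add: mult_ac)
    qed
    from this[of \<alpha>] have "\<delta> * k < u \<alpha>" using False s1 by auto
    then show ?thesis using kd ub by (simp add: mult_ac)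
  qed
qed

end

section \<open>Elapsed time of trajectories that end at the right radius\<close>

context kepler_trajectory
begin

text \<open>
  Around its minimum \<open>u\<close> lies below a parabola of curvature \<open>k - min u\<close>, hence stays small for so long that
  either \<open>1 / (c * u\<^sup>2)\<close> or the penalty consumes more than the time \<open>T\<close>.
\<close>

lemma dip_costs_time:
  assumes k: "0 < k" and end_u: "u \<alpha> = ua" and dip: "s \<in> {0..\<alpha>}" "u s < \<epsilon>"
  shows "T < t \<alpha>"
proof -
  have "{0..\<alpha>} \<noteq> {}" using alpha by auto
  from continuous_attains_inf[OF compact_Icc this continuous_u]
  obtain \<phi> where \<phi>: "\<phi> \<in> {0..\<alpha>}" and min: "\<And>x. x \<in> {0..\<alpha>} \<Longrightarrow> u \<phi> \<le> u x" by auto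
  define \<mu> where "\<mu> = u \<phi>"
  have mu: "\<mu> < \<epsilon>" using min[OF dip(1)] dip(2) by (simp add: \<mu>_def)
  have "\<phi> \<noteq> 0" "\<phi> \<noteq> \<alpha>" using mu init end_u eps by (auto simp: \<mu>_def)
  then have inner: "0 < \<phi>" "\<phi> < \<alpha>" using \<phi> by auto
  have y0: "y \<phi> = 0" by (rule zero_derivative_at_interior_min[OF du[OF \<phi>] inner min])
  have quad: "u x \<le> \<mu> + K * (x - \<phi>)\<^sup>2 / 2"
    if "x \<in> {0..\<alpha>}" "\<bar>x - \<phi>\<bar> \<le> pi" "k - \<mu> \<le> K" "0 \<le> K" for x K
  proof -
    have "u x \<le> k + (\<mu> - k) * cos (x - \<phi>)"
    proof (cases "\<phi> \<le> x")
      case True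
      then show ?thesis using upper_forward[of \<phi> x k] g_bounds(2) k that y0 inner by (auto simp: \<mu>_def)
    next
      case False
      then show ?thesis using upper_backward[of x \<phi> k] g_bounds(2) k that y0 inner cos_minus[of "x - \<phi>"]
        by (auto simp: \<mu>_def)
    qed
    also have "\<dots> = \<mu> + (k - \<mu>) * (1 - cos (x - \<phi>))" by (simp add: algebra_simps)
    also have "(k - \<mu>) * (1 - cos (x - \<phi>)) \<le> K * (1 - cos (x - \<phi>))" using that by (intro mult_right_mono) auto
    also have "\<dots> \<le> K * ((x - \<phi>)\<^sup>2 / 2)" using that one_minus_cos_le by (intro mult_left_mono) auto
    finally show ?thesis by simp
  qed
  \<comment> \<open>At least one side of \<phi> has room for a stretch of length \<open>D\<close>.
    One end of the interval lies within \<open>pi\<close> of \<phi>: 0 if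
    \<open>\<phi> \<le> pi\<close>, and \<alpha> otherwise. As \<open>u\<close> exceeds
    \<open>2 * \<epsilon>\<close> there, that end is farther away than \<open>D\<close>.\<close>
  have wait: "\<tau> * D \<le> t \<alpha>" if D: "0 < D" and near: "\<And>x. x \<in> {0..\<alpha>} \<Longrightarrow> \<bar>x - \<phi>\<bar> \<le> D \<Longrightarrow> \<bar>x - \<phi>\<bar> \<le> pi \<Longrightarrow>
    u x \<le> 2 * \<epsilon> \<and> \<tau> \<le> \<omega> x + \<Lambda> * max 0 (\<epsilon> - u x)" for \<tau> D
  proof -
    obtain c where c: "0 \<le> c" "c + D \<le> \<alpha>" "\<And>x. x \<in> {c..c + D} \<Longrightarrow> \<bar>x - \<phi>\<bar> \<le> D \<and> \<bar>x - \<phi>\<bar> \<le> pi"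
    proof (cases "\<phi> \<le> pi")
      case True
      have "D < \<phi>"
        using near[of 0] True inner init eps by (cases "\<phi> \<le> D") auto
      then show ?thesis using that[of "\<phi> - D"] True inner by auto
    next
      case False
      have "D < \<alpha> - \<phi>"
        using near[of \<alpha>] False inner alpha end_u eps by (cases "\<alpha> - \<phi> \<le> D") auto
      then show ?thesis using that[of \<phi>] False inner alpha by auto
    qed
    have "\<tau> * (c + D - c) \<le> t (c + D) - t c"
      by (rule t_increment_ge) (use c D near in auto)
    moreover have "t (c + D) \<le> t \<alpha>" "t 0 \<le> t c" using c D by (auto intro!: t_mono)
    ultimately show ?thesis using init by simp
  qed
  show ?thesis
  proof (cases "- k \<le> \<mu>")
    case True
    \<comment> \<open>The dip is shallow relative to the forcing: the curvature is at most
      \<open>2 * k\<close>, so \<open>u \<le> 2 * \<epsilon>\<close> within distance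
      \<open>D\<close>. Multiplied by a rate proportional to \<open>sqrt k\<close>, this length
      gives a time from which \<open>k\<close> cancels.\<close>
    define D where "D = sqrt (\<epsilon> / k)"
    have D: "0 < D" "D\<^sup>2 = \<epsilon> / k" using eps k by (auto simp: D_def)
    have "(sqrt k / \<kappa> / (2 * \<epsilon>)\<^sup>2) * D \<le> t \<alpha>"
    proof (rule wait[OF D(1)])
      fix x assume x: "x \<in> {0..\<alpha>}" "\<bar>x - \<phi>\<bar> \<le> D" "\<bar>x - \<phi>\<bar> \<le> pi"
      have "u x \<le> \<mu> + 2 * k * (x - \<phi>)\<^sup>2 / 2" using quad[of x "2 * k"] x True k by auto
      also have "(x - \<phi>)\<^sup>2 \<le> D\<^sup>2" using x D(1) by (simp add: abs_le_square_iff[symmetric])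
      then have "\<mu> + 2 * k * (x - \<phi>)\<^sup>2 / 2 \<le> \<mu> + k * D\<^sup>2" using k by simp
      also have "\<dots> \<le> 2 * \<epsilon>" using mu D k by simp
      finally have u2: "u x \<le> 2 * \<epsilon>" .
      then have "floor_u (u x) \<le> 2 * \<epsilon>" using eps by (auto simp: floor_u_def)
      then have "(floor_u (u x))\<^sup>2 \<le> (2 * \<epsilon>)\<^sup>2" using floor_u(1)[of "u x"] by (intro power_mono) auto
      moreover have "sqrt k * (1 / \<kappa>) \<le> sqrt k * exp (- loss (l x))"
        using exp_loss k by (intro mult_left_mono) auto
      ultimately have "sqrt k / \<kappa> / (2 * \<epsilon>)\<^sup>2 \<le> \<omega> x"
        unfolding \<omega>_def using k floor_u(1)[of "u x"] kappa eps by (intro frac_le) auto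
      moreover have "0 \<le> \<Lambda> * max 0 (\<epsilon> - u x)" using Lam by auto
      ultimately show "u x \<le> 2 * \<epsilon> \<and> sqrt k / \<kappa> / (2 * \<epsilon>)\<^sup>2 \<le> \<omega> x + \<Lambda> * max 0 (\<epsilon> - u x)" using u2 by linarith
    qed
    also have "(sqrt k / \<kappa> / (2 * \<epsilon>)\<^sup>2) * D = sqrt \<epsilon> / (4 * \<kappa> * \<epsilon>\<^sup>2)"
      using k eps by (simp add: D_def real_sqrt_divide field_simps power2_eq_square)
    also have "sqrt \<epsilon> / (4 * \<kappa> * \<epsilon>\<^sup>2) = 1 / (4 * \<kappa> * (\<epsilon> * sqrt \<epsilon>))"
    proof -
      have "\<epsilon>\<^sup>2 = \<epsilon> * sqrt \<epsilon> * sqrt \<epsilon>" using eps by (simp add: power2_eq_square)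
      then show ?thesis using eps by simp
    qed
    finally have "1 / (4 * \<kappa> * (\<epsilon> * sqrt \<epsilon>)) \<le> t \<alpha>" .
    moreover have "T < 1 / (4 * \<kappa> * (\<epsilon> * sqrt \<epsilon>))"
      using eps(1,4) kappa by (simp add: \<kappa>_def field_simps)
    ultimately show ?thesis by linarith
  next
    case False
    \<comment> \<open>Now the depth exceeds the forcing: the curvature is at most
      \<open>- 2 * \<mu>\<close>, so \<open>u\<close> stays nonpositive within distance 1, and the
      penalty alone uses up the time.\<close>
    have "\<Lambda> * \<epsilon> * 1 \<le> t \<alpha>"
    proof (rule wait)
      fix x assume x: "x \<in> {0..\<alpha>}" "\<bar>x - \<phi>\<bar> \<le> 1" "\<bar>x - \<phi>\<bar> \<le> pi"
      have "u x \<le> \<mu> + (- 2 * \<mu>) * (x - \<phi>)\<^sup>2 / 2" using quad[of x "- 2 * \<mu>"] x False k by auto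
      moreover have "(x - \<phi>)\<^sup>2 \<le> 1" using x by (simp add: abs_square_le_1)
      then have "(- \<mu>) * (x - \<phi>)\<^sup>2 \<le> (- \<mu>) * 1" using False k by (intro mult_left_mono) auto
      ultimately have "u x \<le> 0" by simp
      then have "\<Lambda> * \<epsilon> \<le> \<Lambda> * max 0 (\<epsilon> - u x)" using Lam by (intro mult_left_mono) auto
      then show "u x \<le> 2 * \<epsilon> \<and> \<Lambda> * \<epsilon> \<le> \<omega> x + \<Lambda> * max 0 (\<epsilon> - u x)"
        using omega_nonneg[of x] \<open>u x \<le> 0\<close> eps by auto
    qed simp
    then show ?thesis using Lam by simp
  qed
qed

lemma omega_nonpos: "k \<le> 0 \<Longrightarrow> \<omega> s = 0" by (simp add: \<omega>_def)

lemma g_nonpos: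
  assumes "k \<le> 0" "s \<in> {0..\<alpha>}"
  shows "g s = k"
proof -
  have "l s - l 0 \<le> 0 * (s - 0)" by (rule l_increment) (use assms omega_nonpos in auto)
  then have "l s = 0" using l_nonneg[OF assms(2)] init by simp
  then show ?thesis using M T by (simp add: g_def loss_def)
qed

lemma u_nonpos:
  assumes "k \<le> 0" "s \<in> {0..\<alpha>}"
  shows "u s = k + (ub - k) * cos s + p * sin s"
  using exact[of 0 s k] g_nonpos assms init by auto

lemma end_below_target:
  assumes k: "k \<le> - (C_top * (1 + \<bar>p\<bar>))"
  shows "u \<alpha> < ua"
proof -
  have k0: "k \<le> 0" using k C_top(1) by (smt (verit) mult_nonneg_nonneg)
  have "u \<alpha> = ub * cos \<alpha> + p * sin \<alpha> + k * (1 - cos \<alpha>)"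
    using u_nonpos[OF k0, of \<alpha>] alpha by (simp add: algebra_simps)
  moreover have "ub * cos \<alpha> \<le> ub" using ub mult_left_mono[of "cos \<alpha>" 1 ub] by auto
  moreover have "\<bar>p * sin \<alpha>\<bar> \<le> \<bar>p\<bar> * 1" unfolding abs_mult by (intro mult_left_mono) auto
  moreover have "k * (1 - cos \<alpha>) \<le> - (ub + 1 + \<bar>p\<bar>)"
  proof -
    have "\<delta> \<le> m / 1" using delta(2) m by simp
    also have "m \<le> (1 - cos \<alpha>) / 1" unfolding m_def using kappa cos_alpha by (intro divide_left_mono) auto
    finally have "\<delta> \<le> 1 - cos \<alpha>" by simp
    then have "k * (1 - cos \<alpha>) \<le> k * \<delta>" using k0 by (intro mult_left_mono_neg) auto
    also have "\<dots> \<le> - (C_top * (1 + \<bar>p\<bar>)) * \<delta>" using k delta by (intro mult_right_mono) auto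
    also have "\<dots> = - (C_top * \<delta> * (1 + \<bar>p\<bar>))" by (simp add: mult_ac)
    also have "\<dots> \<le> - ((ua + ub + 1) * (1 + \<bar>p\<bar>))" using C_top(2) mult_right_mono[of "ua + ub + 1" "C_top * \<delta>" "1 + \<bar>p\<bar>"] by simp
    also have "\<dots> \<le> - (ub + 1 + \<bar>p\<bar>)" using ua ub by (simp add: algebra_simps)
    finally show ?thesis .
  qed
  ultimately show ?thesis using ua by linarith
qed

text \<open>
  If \<open>pi < \<alpha>\<close>, then \<open>u s + u (s + pi) = 2 * k\<close> is not positive, so the penalty is paid at one of the two angles.
\<close>

lemma nonpos_cases:
  assumes k: "k \<le> 0" and end_u: "u \<alpha> = ua"
  shows "\<alpha> < pi \<and> t \<alpha> = 0 \<or> pi < \<alpha> \<and> T < t \<alpha>"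
proof -
  consider "\<alpha> < pi" | "\<alpha> = pi" | "pi < \<alpha>" by linarith
  then show ?thesis
  proof cases
    case 1
    have sin: "0 < sin \<alpha>" using 1 alpha by (intro sin_gt_zero) auto
    have "\<epsilon> \<le> u s" if s: "s \<in> {0..\<alpha>}" for s
    proof -
      let ?e = "min ua ub"
      have e: "0 < ?e" using ua ub by auto
      \<comment> \<open>On a span shorter than \<open>pi\<close>, \<open>u - k\<close> interpolates
        its end values with weights \<open>sin (\<alpha> - s) / sin \<alpha>\<close> and
        \<open>sin s / sin \<alpha>\<close>, whose sum is at least 1. So \<open>u\<close> never
        falls below \<open>min ua ub\<close>, and no penalty is paid.\<close>
      have "cos (\<alpha> / 2) \<le> cos \<bar>\<alpha> / 2 - s\<bar>" by (rule cos_monotone_0_pi_le) (use s 1 alpha in \<open>auto simp: abs_if\<close>)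
      then have "2 * sin (\<alpha>/2) * cos (\<alpha>/2) \<le> 2 * sin (\<alpha>/2) * cos (\<alpha>/2 - s)"
        using sin_ge_zero[of "\<alpha>/2"] alpha by (intro mult_left_mono) auto
      also have "2 * sin (\<alpha>/2) * cos (\<alpha>/2 - s) = sin (\<alpha> - s) + sin s"
        using sin_plus_sin[of "\<alpha> - s" s] by (simp add: diff_divide_distrib mult_ac)
      finally have ss: "sin \<alpha> \<le> sin (\<alpha> - s) + sin s" using sin_double[of "\<alpha>/2"] by simp
      have "0 \<le> sin (\<alpha> - s)" "0 \<le> sin s" using s 1 by (auto intro!: sin_ge_zero)
      then have "(?e - k) * sin (\<alpha> - s) + (?e - k) * sin s \<le> (ub - k) * sin (\<alpha> - s) + (ua - k) * sin s"
        by (intro add_mono mult_right_mono) auto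
      moreover have "(?e - k) * sin \<alpha> \<le> (?e - k) * (sin (\<alpha> - s) + sin s)" using ss e k by (intro mult_left_mono) auto
      moreover have "(u s - k) * sin \<alpha> = (ub - k) * sin (\<alpha> - s) + (ua - k) * sin s"
      proof -
        have 1: "ua - k = (ub - k) * cos \<alpha> + p * sin \<alpha>" using u_nonpos[OF k, of \<alpha>] end_u alpha by simp
        have 2: "u s - k = (ub - k) * cos s + p * sin s" using u_nonpos[OF k s] by simp
        show ?thesis unfolding 1 2 sin_diff by (simp add: algebra_simps)
      qed
      ultimately have "(?e - k) * sin \<alpha> \<le> (u s - k) * sin \<alpha>" by (simp add: algebra_simps)
      then show ?thesis using sin eps e by (auto simp: mult_le_cancel_right)
    qed
    then have "t \<alpha> - t 0 \<le> 0 * (\<alpha> - 0)"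
      by (intro increment_le[OF _ dt']) (use alpha omega_nonpos[OF k] in auto)
    then show ?thesis using t_mono[of 0 \<alpha>] alpha init 1 by auto
  next
    case 2
    \<comment> \<open>At \<open>pi\<close> the slope drops out and \<open>u\<close> equals
      \<open>2 * k - ub\<close>, which is negative.\<close>
    then show ?thesis using u_nonpos[OF k, of \<alpha>] end_u ua ub k alpha by simp
  next
    case 3
    \<comment> \<open>Times half a turn apart are added, so that the rate is at least
      \<open>\<Lambda> * \<epsilon>\<close>. Since \<open>\<alpha> - pi < pi\<close>, the ranges
      \<open>{0..\<alpha> - pi}\<close> and \<open>{pi..\<alpha>}\<close> do not overlap and no
      stretch is counted twice.\<close>
    define h where "h s = t s + t (s + pi)" for s
    have "\<Lambda> * \<epsilon> * (\<alpha> - pi - 0) \<le> h (\<alpha> - pi) - h 0"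
    proof (rule increment_ge)
      fix s assume s: "s \<in> {0..\<alpha> - pi}"
      let ?t' = "\<lambda>s. \<omega> s + \<Lambda> * max 0 (\<epsilon> - u s)"
      have im: "(\<lambda>s. s + pi) ` {0..\<alpha> - pi} \<subseteq> {0..\<alpha>}" by auto
      have 1: "(t has_real_derivative ?t' s) (at s within {0..\<alpha> - pi})"
        using s by (intro dt') auto
      have "(t has_real_derivative ?t' (s + pi)) (at (s + pi) within (\<lambda>s. s + pi) ` {0..\<alpha> - pi})"
        using s by (intro has_field_derivative_subset[OF dt' im]) auto
      moreover have "((\<lambda>s. s + pi) has_real_derivative 1) (at s within {0..\<alpha> - pi})"
        by (auto intro!: derivative_eq_intros)
      ultimately
      have 2: "((\<lambda>s. t (s + pi)) has_real_derivative ?t' (s + pi)) (at s within {0..\<alpha> - pi})"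
        using DERIV_image_chain[of t _ "\<lambda>s. s + pi"] by (fastforce simp: o_def)
      show "(h has_real_derivative ?t' s + ?t' (s + pi)) (at s within {0..\<alpha> - pi})"
        unfolding h_def by (rule DERIV_add[OF 1 2])
      have "s \<in> {0..\<alpha>}" "s + pi \<in> {0..\<alpha>}" using s pi_gt_zero unfolding atLeastAtMost_iff by linarith+
      then have "u (s + pi) = 2 * k - u s"
        using u_nonpos[OF k, of s] u_nonpos[OF k, of "s + pi"] by (simp add: algebra_simps)
      then have "\<epsilon> \<le> max 0 (\<epsilon> - u s) + max 0 (\<epsilon> - u (s + pi))" using k eps by auto
      then have "\<Lambda> * \<epsilon> \<le> \<Lambda> * (max 0 (\<epsilon> - u s) + max 0 (\<epsilon> - u (s + pi)))" using Lam by (intro mult_left_mono) auto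
      then show "\<Lambda> * \<epsilon> \<le> ?t' s + ?t' (s + pi)" using omega_nonpos[OF k] by (simp add: algebra_simps)
    qed (use 3 in auto)
    moreover have "t (\<alpha> - pi) \<le> t pi" using 3 alpha by (intro t_mono) auto
    ultimately show ?thesis using 3 Lam(3) init by (auto simp: h_def)
  qed
qed

text \<open>With initial slope \<open>- P\<close>, \<open>u\<close> is below \<epsilon> at the angle
  \<open>3 * ub / P\<close> unless \<open>k\<close> is of order \<open>P^2\<close>, and so large a
  \<open>k\<close> overshoots the target. So \<open>u\<close> dips, which takes too long. For
  \<open>k \<le> 0\<close> a span shorter than \<open>pi\<close> is impossible, since
  \<open>u\<close> would end below 0.\<close>

lemma slow_for_steep_fall:
  assumes P: "3 * ub \<le> P" "3 * ub \<le> P * \<alpha>" "9 * ub * (C_top * (1 + P)) \<le> P\<^sup>2" "\<alpha> < pi \<Longrightarrow> ub < P * sin \<alpha>"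
    and p: "p = - P" and end_u: "u \<alpha> = ua"
  shows "T < t \<alpha>"
proof (cases "k \<le> 0")
  case True
  have "\<not> \<alpha> < pi"
  proof
    assume "\<alpha> < pi"
    have "ua = k * (1 - cos \<alpha>) + ub * cos \<alpha> - P * sin \<alpha>"
      using u_nonpos[OF True, of \<alpha>] alpha end_u p by (simp add: algebra_simps)
    moreover have "ub * cos \<alpha> \<le> ub" using ub mult_left_mono[of "cos \<alpha>" 1 ub] by auto
    moreover have "k * (1 - cos \<alpha>) \<le> 0" using True by (intro mult_nonpos_nonneg) auto
    ultimately show False using P(4)[OF \<open>\<alpha> < pi\<close>] ua by linarith
  qed
  then show ?thesis using nonpos_cases[OF True end_u] by auto
next
  case False
  then have k: "0 < k" by simp
  have P0: "0 < P" using P(1) ub by linarith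
  \<comment> \<open>Since \<open>sin s \<ge> s / 2\<close>, the slope removes at least
    \<open>3 / 2 * ub\<close> up to here, which is \<open>ub / 2\<close> more than there
    was.\<close>
  define s where "s = 3 * ub / P"
  have s: "0 < s" "s \<le> 1" "s \<le> \<alpha>" using P P0 ub by (auto simp: s_def field_simps)
  show ?thesis
  proof (rule ccontr)
    assume "\<not> T < t \<alpha>"
    then have "\<epsilon> \<le> u s" using dip_costs_time[OF k end_u, of s] s by force
    moreover have "u s \<le> k + (ub - k) * cos s + (- P) * sin s"
      using upper_forward[of 0 s k] g_bounds(2) k s p init pi_gt3 by auto
    moreover have "ub * cos s \<le> ub" using ub mult_left_mono[of "cos s" 1 ub] by auto
    moreover have "P * sin s \<ge> P * (s / 2)" using sin_ge_half[of s] s P0 by (intro mult_left_mono) auto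
    moreover have "P * (s / 2) = 3 / 2 * ub" using P0 by (simp add: s_def)
    moreover have "k * (1 - cos s) \<le> k * (s\<^sup>2 / 2)" using one_minus_cos_le[of s] k by (intro mult_left_mono) auto
    ultimately have "ub / 2 < k * (s\<^sup>2 / 2)" using eps(1) by (simp add: algebra_simps)
    then have "ub * P\<^sup>2 < k * (9 * ub\<^sup>2)" using P0 by (simp add: s_def power_divide power_mult_distrib field_simps)
    then have "P\<^sup>2 < 9 * ub * k" using ub by (simp add: power2_eq_square mult_ac)
    then have "9 * ub * (C_top * (1 + P)) < 9 * ub * k" using P(3) by simp
    then have "C_top * (1 + P) < k" using ub by (simp only: mult_less_cancel_left_pos) 
    then show False using end_above_target p P0 end_u by auto
  qed
qed

end

lemma exp_minus_diff_le:
  fixes a b :: real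
  assumes "0 \<le> a" "0 \<le> b"
  shows "\<bar>exp (- a) - exp (- b)\<bar> \<le> \<bar>a - b\<bar>"
proof -
  have *: "exp (- a) - exp (- b) \<le> b - a" if "0 \<le> a" "a \<le> b" for a b :: real
  proof -
    have "exp (- a) - exp (- b) = exp (- a) * (1 - exp (- (b - a)))" by (simp add: algebra_simps flip: exp_add)
    also have "\<dots> \<le> 1 * (b - a)"
    proof (rule mult_mono)
      show "1 - exp (- (b - a)) \<le> b - a" using exp_ge_add_one_self[of "- (b - a)"] by linarith
    qed (use that in auto)
    finally show ?thesis by simp
  qed
  show ?thesis
    using *[of a b] *[of b a] assms by (cases "a \<le> b") auto
qed

lemma inverse_square_diff_le:
  fixes c x y :: real
  assumes "0 < c" "c \<le> x" "c \<le> y"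
  shows "\<bar>1 / x\<^sup>2 - 1 / y\<^sup>2\<bar> \<le> 2 / c ^ 3 * \<bar>x - y\<bar>"
proof -
  have pos: "0 < x" "0 < y" using assms by auto
  have "1 / x\<^sup>2 - 1 / y\<^sup>2 = (y - x) * (1 / (x * y\<^sup>2) + 1 / (x\<^sup>2 * y))"
    using pos by (simp add: field_simps power2_eq_square)
  moreover have "0 \<le> 1 / (x * y\<^sup>2) + 1 / (x\<^sup>2 * y)" using pos by simp
  ultimately have "\<bar>1 / x\<^sup>2 - 1 / y\<^sup>2\<bar> = \<bar>x - y\<bar> * (1 / (x * y\<^sup>2) + 1 / (x\<^sup>2 * y))"
    by (simp add: abs_mult abs_minus_commute)
  also have "\<dots> \<le> \<bar>x - y\<bar> * (1 / (c * c\<^sup>2) + 1 / (c\<^sup>2 * c))"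
    using assms pos by (intro mult_left_mono add_mono divide_left_mono mult_mono power_mono mult_pos_pos) auto
  finally show ?thesis by (simp add: power3_eq_cube power2_eq_square mult_ac)
qed

context kepler_shooting
begin

text \<open>Concavity of the sine leaves a slope \<open>2 * h P\<close> of an initial slope
  \<open>P / 2\<close> over half the span. One \<open>h P\<close> pays for the decay of the cosine,
  the other remains as the rate at which \<open>u\<close> rises.\<close>

definition h :: "real \<Rightarrow> real" where "h P = sin (\<alpha> / 2) / (\<alpha> / 2) * P / 4"

lemma sin_half: "0 < sin (\<alpha> / 2)"
  using alpha by (intro sin_gt_zero) auto

end

context kepler_trajectory
begin

text \<open>
  Testing the equation against \<open>sin (s - \<alpha> / 2)\<close>, which is odd about the middle of the interval while the
  forcing decreases, bounds the final slope by \<open>- P / 2\<close>. So \<open>u\<close> rises steeply from both ends.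
\<close>

lemma fast_for_steep_rise:
  assumes P: "0 < P" "2 * (ua + ub) \<le> P * sin (\<alpha> / 2)" "max ua ub \<le> h P"
      "4 * (C_top * (1 + P)) < (T * h P * min ua ub)\<^sup>2" "pi < \<alpha> \<Longrightarrow> ub < - P * sin \<alpha>"
    and p: "p = P" and end_u: "u \<alpha> = ua"
  shows "t \<alpha> < T"
proof (cases "k \<le> 0")
  case True
  have "\<not> pi < \<alpha>"
  proof
    assume "pi < \<alpha>"
    have "ua = k * (1 - cos \<alpha>) + ub * cos \<alpha> + P * sin \<alpha>"
      using u_nonpos[OF True, of \<alpha>] alpha end_u p by (simp add: algebra_simps)
    moreover have "ub * cos \<alpha> \<le> ub" using ub mult_left_mono[of "cos \<alpha>" 1 ub] by auto
    moreover have "k * (1 - cos \<alpha>) \<le> 0" using True by (intro mult_nonpos_nonneg) auto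
    ultimately show False using P(5)[OF \<open>pi < \<alpha>\<close>] ua by linarith
  qed
  then show ?thesis using nonpos_cases[OF True end_u] T by auto
next
  case False
  then have k: "0 < k" by simp
  \<comment> \<open>A larger \<open>k\<close> would overshoot the target. So the factor
    \<open>sqrt k\<close> in the rate of time is only of order \<open>sqrt P\<close>, while the
    slopes of \<open>u\<close> are of order \<open>P\<close>.\<close>
  have kC: "k < C_top * (1 + P)" using end_above_target p P(1) end_u by force
  define e where "e = min ua ub"
  define H where "H = h P"
  have e: "0 < e" using ua ub by (simp add: e_def)
  have H: "0 < H" using P(3) ua by (auto simp: H_def)
  have "0 * (\<alpha> - 0) \<le> wr (\<alpha>/2) (g (\<alpha>/2)) \<alpha> - wr (\<alpha>/2) (g (\<alpha>/2)) 0"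
  proof (rule wr_increment_ge)
    fix s assume s: "s \<in> {0..\<alpha>}"
    show "0 \<le> - (g s - g (\<alpha>/2)) * sin (s - \<alpha>/2)"
    proof (cases "s \<le> \<alpha>/2")
      case True
      then have "g (\<alpha>/2) \<le> g s" using g_antimono[of s "\<alpha>/2"] k s by auto
      moreover have "0 \<le> sin (\<alpha>/2 - s)" using True s alpha by (intro sin_ge_zero) auto
      then have "sin (s - \<alpha>/2) \<le> 0" using sin_minus[of "s - \<alpha>/2"] by simp
      ultimately show ?thesis by (intro mult_nonpos_nonpos) auto
    next
      case False
      then have "g s \<le> g (\<alpha>/2)" using g_antimono[of "\<alpha>/2" s] k s alpha by auto
      moreover have "0 \<le> sin (s - \<alpha>/2)" using False s alpha by (intro sin_ge_zero) auto
      ultimately show ?thesis by (intro mult_nonneg_nonneg) auto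
    qed
  qed (use alpha in auto)
  then have "P * sin (\<alpha>/2) + (ub - ua) * cos (\<alpha>/2) \<le> (- y \<alpha>) * sin (\<alpha>/2)"
    by (simp add: wr_def init end_u p algebra_simps)
  moreover have "\<bar>(ub - ua) * cos (\<alpha>/2)\<bar> \<le> (ua + ub) * 1"
    unfolding abs_mult using ua ub by (intro mult_mono) auto
  ultimately have "P / 2 * sin (\<alpha>/2) \<le> (- y \<alpha>) * sin (\<alpha>/2)" using P(2) unfolding abs_le_iff by linarith
  then have y_end: "P / 2 \<le> - y \<alpha>" using sin_half by (simp only: mult_le_cancel_right_pos)
  have low: "e + H * s \<le> x * cos s + q * sin s"
    if "e \<le> x" "x \<le> H" "P / 2 \<le> q" "0 \<le> s" "s \<le> \<alpha>/2" for x q s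
  proof -
    have "x * (1 - s) \<le> x * cos s" using that e cos_ge_one_minus[of s] by (intro mult_left_mono) auto
    moreover have "x * s \<le> H * s" using that by (intro mult_right_mono) auto
    moreover have "P / 2 * (sin (\<alpha>/2) / (\<alpha>/2) * s) \<le> q * sin s"
      using that P(1) alpha sin_half by (intro mult_mono sin_ge_chord) auto
    moreover have "P / 2 * (sin (\<alpha>/2) / (\<alpha>/2) * s) = 2 * H * s" by (simp add: H_def h_def)
    ultimately show ?thesis using that by (simp add: algebra_simps)
  qed
  have xs: "e \<le> ua" "e \<le> ub" "ua \<le> H" "ub \<le> H" using P(3) by (auto simp: e_def H_def)
  have low1: "e + H * s \<le> u s" if "0 \<le> s" "s \<le> \<alpha>/2" for s
  proof -
    have "ub * cos s + p * sin s \<le> u s"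
      using lower_forward[of 0 s 0] g_bounds(3) k that alpha init by auto
    then show ?thesis using low[of ub P s] that xs p P(1) by auto
  qed
  have low2: "e + H * (\<alpha> - s) \<le> u s" if "\<alpha>/2 \<le> s" "s \<le> \<alpha>" for s
  proof -
    have "ua * cos (\<alpha> - s) - y \<alpha> * sin (\<alpha> - s) \<le> u s"
      using lower_backward[of s \<alpha> 0] g_bounds(3) k that alpha end_u by auto
    then show ?thesis using low[of ua "- y \<alpha>" "\<alpha> - s"] that xs y_end by auto
  qed
  have rate: "\<omega> s + \<Lambda> * max 0 (\<epsilon> - u s) \<le> sqrt k / v\<^sup>2" if "e \<le> v" "v \<le> u s" for s v
  proof -
    have "\<epsilon> - u s \<le> 0" using that eps by (auto simp: e_def)
    then show ?thesis using omega_le[of v s] that e k by auto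
  qed
  \<comment> \<open>The rate \<open>sqrt k / (e + H * s)\<^sup>2\<close> has the antiderivative
    \<open>- q / (e + H * s)\<close>, so each half of the span takes at most the time
    \<open>q / e\<close>.\<close>
  define q where "q = sqrt k / H"
  have q: "0 < q" using k H by (simp add: q_def)
  have first: "t (\<alpha>/2) + q / (e + H * (\<alpha>/2)) - (t 0 + q / (e + H * 0)) \<le> 0 * (\<alpha>/2 - 0)"
  proof (rule increment_le)
    fix s assume s: "s \<in> {0..\<alpha>/2}"
    have pos: "0 < e + H * s" using e H s by (intro add_pos_nonneg) auto
    show "((\<lambda>s. t s + q / (e + H * s)) has_real_derivative
        (\<omega> s + \<Lambda> * max 0 (\<epsilon> - u s)) - sqrt k / (e + H * s)\<^sup>2) (at s within {0..\<alpha>/2})"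
      using pos H s alpha
      by (auto intro!: derivative_eq_intros dt' simp: q_def power2_eq_square)
    show "(\<omega> s + \<Lambda> * max 0 (\<epsilon> - u s)) - sqrt k / (e + H * s)\<^sup>2 \<le> 0"
      using rate[of "e + H * s" s] low1[of s] s H by auto
  qed (use alpha in auto)
  have second: "(t \<alpha> - q / (e + H * (\<alpha> - \<alpha>))) - (t (\<alpha>/2) - q / (e + H * (\<alpha> - \<alpha>/2))) \<le> 0 * (\<alpha> - \<alpha>/2)"
  proof (rule increment_le)
    fix s assume s: "s \<in> {\<alpha>/2..\<alpha>}"
    have pos: "0 < e + H * (\<alpha> - s)" using e H s by (intro add_pos_nonneg) auto
    show "((\<lambda>s. t s - q / (e + H * (\<alpha> - s))) has_real_derivative
        (\<omega> s + \<Lambda> * max 0 (\<epsilon> - u s)) - sqrt k / (e + H * (\<alpha> - s))\<^sup>2) (at s within {\<alpha>/2..\<alpha>})"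
      using pos H s alpha
      by (auto intro!: derivative_eq_intros dt' simp: q_def power2_eq_square)
    show "(\<omega> s + \<Lambda> * max 0 (\<epsilon> - u s)) - sqrt k / (e + H * (\<alpha> - s))\<^sup>2 \<le> 0"
      using rate[of "e + H * (\<alpha> - s)" s] low2[of s] s H by auto
  qed (use alpha in auto)
  have "0 \<le> q / (e + H * \<alpha> / 2)" using q e H alpha by (intro divide_nonneg_pos add_pos_nonneg) auto
  then have "t \<alpha> \<le> 2 * q / e" using first second init by simp
  also have "\<dots> < T"
  proof -
    have "4 * k < (T * H * e)\<^sup>2" using P(4) kC by (simp add: H_def e_def)
    then have "sqrt (4 * k) < T * H * e" using T H e k by (intro real_less_lsqrt) auto
    then have "2 * sqrt k < T * H * e" using k by (simp add: real_sqrt_mult)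
    then show ?thesis using H e by (simp add: q_def field_simps)
  qed
  finally show ?thesis .
qed

end

section \<open>Existence of a truncated trajectory with both end values right\<close>

context kepler_shooting
begin

text \<open>Every requirement is a lower bound on \<open>P\<close>. In the two that involve
  \<open>C_top * (1 + P)\<close> the opposite side is quadratic in \<open>P\<close>, so
  \<open>1 + P \<le> 2 * P\<close> reduces them to linear bounds.\<close>

lemma large_slope:
  obtains P where "0 < P" "3 * ub \<le> P" "3 * ub \<le> P * \<alpha>" "9 * ub * (C_top * (1 + P)) \<le> P\<^sup>2"
    "\<alpha> < pi \<Longrightarrow> ub < P * sin \<alpha>" "2 * (ua + ub) \<le> P * sin (\<alpha> / 2)" "max ua ub \<le> h P"
    "4 * (C_top * (1 + P)) < (T * h P * min ua ub)\<^sup>2" "pi < \<alpha> \<Longrightarrow> ub < - P * sin \<alpha>"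
proof -
  define c where "c = sin (\<alpha>/2) / (\<alpha>/2) / 4"
  have c: "0 < c" using sin_half alpha by (simp add: c_def)
  have hc: "h P = c * P" for P by (simp add: h_def c_def)
  define e where "e = min ua ub"
  have e: "0 < e" using ua ub by (simp add: e_def)
  \<comment> \<open>One threshold per requirement. For \<open>\<alpha> = pi\<close> the entry
    \<open>ub / \<bar>sin \<alpha>\<bar>\<close> is 0 by convention, and neither condition on
    \<open>sin \<alpha>\<close> applies.\<close>
  define S where "S = {1, 3 * ub, 3 * ub / \<alpha>, 18 * ub * C_top, ub / \<bar>sin \<alpha>\<bar>,
    2 * (ua + ub) / sin (\<alpha>/2), max ua ub / c, 8 * C_top / (T * c * e)\<^sup>2}"
  have fin: "finite S" by (simp add: S_def)
  define P where "P = Max S + 1"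
  have P: "x < P" if "x \<in> S" for x
    using Max_ge[OF fin that] unfolding P_def by linarith
  have P1: "1 < P" by (rule P) (simp add: S_def)
  have C1: "0 < C_top" using C_top(1) by linarith
  have 1: "C_top * (1 + P) \<le> C_top * (2 * P)" using C1 P1 by (intro mult_left_mono) auto
  show ?thesis
  proof (rule that[of P])
    show "0 < P" using P1 by simp
    show "3 * ub \<le> P" using P[of "3 * ub"] by (simp add: S_def)
    show "3 * ub \<le> P * \<alpha>" using P[of "3 * ub / \<alpha>"] alpha by (simp add: S_def field_simps)
    show "2 * (ua + ub) \<le> P * sin (\<alpha> / 2)"
      using P[of "2 * (ua + ub) / sin (\<alpha>/2)"] sin_half by (simp add: S_def field_simps)
    show "max ua ub \<le> h P" using P[of "max ua ub / c"] c by (simp add: S_def hc field_simps)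
    have "9 * ub * (C_top * (1 + P)) \<le> 9 * ub * (C_top * (2 * P))" by (rule mult_left_mono[OF 1]) (use ub in auto)
    also have "\<dots> = 18 * ub * C_top * P" by simp
    also have "\<dots> \<le> P * P" using P[of "18 * ub * C_top"] P1 by (intro mult_right_mono) (auto simp: S_def)
    finally show "9 * ub * (C_top * (1 + P)) \<le> P\<^sup>2" by (simp add: power2_eq_square)
    have "8 * C_top / (T * c * e)\<^sup>2 < P" by (rule P) (simp add: S_def)
    then have "8 * C_top < P * (T * c * e)\<^sup>2" using T c e by (simp add: divide_less_eq)
    then have "8 * C_top * P < P * (T * c * e)\<^sup>2 * P" using P1 by (intro mult_strict_right_mono) auto
    also have "\<dots> = (T * h P * min ua ub)\<^sup>2" by (simp add: hc e_def power2_eq_square mult_ac)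
    finally show "4 * (C_top * (1 + P)) < (T * h P * min ua ub)\<^sup>2" using 1 by linarith
    have sa: "ub / \<bar>sin \<alpha>\<bar> < P" by (rule P) (simp add: S_def)
    show "ub < P * sin \<alpha>" if "\<alpha> < pi"
      using sa sin_gt_zero[OF alpha(1) that] by (simp add: field_simps)
    show "ub < - P * sin \<alpha>" if "pi < \<alpha>"
      using sa sin_lt_zero[OF that alpha(2)] by (simp add: field_simps)
  qed
qed

text \<open>\<open>K\<close> controls the quotient \<open>d / u^2\<close> as a single function of
  \<open>u\<close>, the form in which damping drives \<open>l\<close>. Together with the truncations
  it makes the system Lipschitz with one constant for the whole parameter rectangle.\<close>

lemma trajectory_exists:
  assumes contd: "continuous_on ({0..\<alpha>} \<times> {0<..}) (\<lambda>(s, v). d s v)"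
    and K: "0 \<le> K" "\<And>s v w. s \<in> {0..\<alpha>} \<Longrightarrow>
      \<bar>d s (floor_u v) / (floor_u v)\<^sup>2 - d s (floor_u w) / (floor_u w)\<^sup>2\<bar> \<le> K * \<bar>v - w\<bar>"
  obtains p k u y l t where "kepler_trajectory \<alpha> M T ua ub \<epsilon> \<Lambda> d p k u y l t" "u \<alpha> = ua" "t \<alpha> = T"
proof -
  obtain P where P: "0 < P" "3 * ub \<le> P" "3 * ub \<le> P * \<alpha>" "9 * ub * (C_top * (1 + P)) \<le> P\<^sup>2"
    "\<alpha> < pi \<Longrightarrow> ub < P * sin \<alpha>" "2 * (ua + ub) \<le> P * sin (\<alpha> / 2)" "max ua ub \<le> h P"
    "4 * (C_top * (1 + P)) < (T * h P * min ua ub)\<^sup>2" "pi < \<alpha> \<Longrightarrow> ub < - P * sin \<alpha>"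
    by (rule large_slope) blast
  define N where "N = C_top * (1 + P)"
  have N: "0 < N" using P(1) C_top(1) by (simp add: N_def)
  define Q where "Q = {-P..P} \<times> {-N..N}"
  have Q: "compact Q" by (simp add: Q_def compact_Times)
  define f where "f = (\<lambda>(q :: real \<times> real) s (x :: real \<times> real \<times> real \<times> real).
    (fst (snd x),
     snd q * exp (- 2 * loss (fst (snd (snd x)))) - fst x,
     d s (floor_u (fst x)) * (sqrt (max 0 (snd q)) * exp (- loss (fst (snd (snd x)))) / (floor_u (fst x))\<^sup>2),
     sqrt (max 0 (snd q)) * exp (- loss (fst (snd (snd x)))) / (floor_u (fst x))\<^sup>2 + \<Lambda> * max 0 (\<epsilon> - fst x)))"
  define x0 where "x0 = (\<lambda>q :: real \<times> real. (ub, fst q, 0 :: real, 0 :: real))"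
  have cont: "continuous_on (Q \<times> {0..\<alpha>} \<times> UNIV) (\<lambda>(q,s,x). f q s x)"
  proof -
    let ?D = "Q \<times> {0..\<alpha>} \<times> (UNIV :: (real \<times> real \<times> real \<times> real) set)"
    have floor_cont: "continuous_on ?D (\<lambda>w. floor_u (fst (snd (snd w))))"
      unfolding floor_u_def by (intro continuous_intros)
    have loss_cont: "continuous_on ?D (\<lambda>w. loss (fst (snd (snd (snd (snd w))))))"
      unfolding loss_def by (intro continuous_intros)
    have d_cont: "continuous_on ?D (\<lambda>w. d (fst (snd w)) (floor_u (fst (snd (snd w)))))"
      using continuous_on_compose2[OF contd, of ?D "\<lambda>w. (fst (snd w), floor_u (fst (snd (snd w))))"] floor_cont floor_u(1)
      by (force intro!: continuous_intros)
    have nz: "floor_u v \<noteq> 0" for v using floor_u(1)[of v] by simp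
    show ?thesis unfolding f_def case_prod_unfold
      by (intro continuous_intros floor_cont loss_cont d_cont) (auto simp: nz)
  qed
  obtain L where L: "0 \<le> L" "\<And>q s x x'. q \<in> Q \<Longrightarrow> s \<in> {0..\<alpha>} \<Longrightarrow> norm (f q s x - f q s x') \<le> L * norm (x - x')"
  proof -
    define Lf where "Lf = 1 + (2 * N + 1) + (sqrt N * (K + M / \<epsilon>\<^sup>2)) + (sqrt N * (2 / \<epsilon>^3 + 1 / \<epsilon>\<^sup>2) + \<Lambda>)"
    show ?thesis
    proof (rule that[of Lf])
      show "0 \<le> Lf" unfolding Lf_def using N K(1) M eps(1) Lam(1) by (intro add_nonneg_nonneg mult_nonneg_nonneg) auto
      fix q s and x x' :: "real \<times> real \<times> real \<times> real"
      assume q: "q \<in> Q" and s: "s \<in> {0..\<alpha>}"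
      obtain u y l t where x: "x = (u, y, l, t)" by (cases x)
      obtain u' y' l' t' where x': "x' = (u', y', l', t')" by (cases x')
      define n where "n = norm (x - x')"
      have "\<bar>u - u'\<bar> \<le> n \<and> \<bar>y - y'\<bar> \<le> n \<and> \<bar>l - l'\<bar> \<le> n"
        using norm_fst_le[of "u - u'" "(y - y', l - l', t - t')"] norm_fst_le[of "y - y'" "(l - l', t - t')"]
          norm_fst_le[of "l - l'" "t - t'"] norm_snd_le[of "(y - y', l - l', t - t')" "u - u'"]
          norm_snd_le[of "(l - l', t - t')" "y - y'"]
        unfolding x x' n_def diff_Pair real_norm_def by linarith
      then have n: "\<bar>u - u'\<bar> \<le> n" "\<bar>y - y'\<bar> \<le> n" "\<bar>l - l'\<bar> \<le> n" by auto
      define k where "k = snd q"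
      have k: "\<bar>k\<bar> \<le> N" using q by (auto simp: Q_def k_def)
      define r where "r = sqrt (max 0 k)"
      have r: "0 \<le> r" "r \<le> sqrt N" using k by (auto simp: r_def)
      define e where "e v = exp (- loss v)" for v
      have e01: "0 \<le> e v" "\<bar>e v\<bar> \<le> 1" for v using loss[of v] by (auto simp: e_def)
      have "\<bar>loss l - loss l'\<bar> \<le> \<bar>l - l'\<bar>" by (auto simp: loss_def)
      then have el: "\<bar>e l - e l'\<bar> \<le> n" using exp_minus_diff_le[of "loss l" "loss l'"] loss(1) n(3) by (force simp: e_def)
      define B where "B v = 1 / (floor_u v)\<^sup>2" for v
      have "\<bar>floor_u u - floor_u u'\<bar> \<le> \<bar>u - u'\<bar>" by (auto simp: floor_u_def)
      then have "\<bar>B u - B u'\<bar> \<le> 2 / \<epsilon>^3 * \<bar>floor_u u - floor_u u'\<bar>" "\<bar>floor_u u - floor_u u'\<bar> \<le> n"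
        using inverse_square_diff_le[of \<epsilon> "floor_u u" "floor_u u'"] floor_u(2) eps(1) n(1) by (auto simp: B_def)
      then have Bu: "\<bar>B u - B u'\<bar> \<le> 2 / \<epsilon>^3 * n"
        using eps(1) mult_left_mono[of "\<bar>floor_u u - floor_u u'\<bar>" n "2 / \<epsilon>^3"] by fastforce
      have Bb: "0 \<le> B v" "B v \<le> 1 / \<epsilon>\<^sup>2" for v
        using floor_u(2)[of v] eps(1) by (auto simp: B_def intro!: divide_left_mono power_mono mult_pos_pos)
      define A where "A v = d s (floor_u v) / (floor_u v)\<^sup>2" for v
      have "\<bar>A u - A u'\<bar> \<le> K * \<bar>u - u'\<bar>" unfolding A_def by (rule K(2)[OF s])
      also have "\<dots> \<le> K * n" using n(1) K(1) by (rule mult_left_mono)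
      finally have Au: "\<bar>A u - A u'\<bar> \<le> K * n" .
      have Ab: "\<bar>A v\<bar> \<le> M / \<epsilon>\<^sup>2" for v
      proof -
        have "A v = d s (floor_u v) * B v" by (simp add: A_def B_def)
        moreover have "d s (floor_u v) * B v \<le> M * (1 / \<epsilon>\<^sup>2)"
          using d[OF s floor_u(1)[of v]] Bb[of v] M by (intro mult_mono) auto
        moreover have "0 \<le> d s (floor_u v) * B v" using d[OF s floor_u(1)[of v]] Bb[of v] by simp
        ultimately show ?thesis by simp
      qed
      have n0: "0 \<le> n" by (simp add: n_def)
      have f_eq: "f q s (v, w, x, z) = (w, k * (e x)\<^sup>2 - v, r * (A v * e x), r * (B v * e x) + \<Lambda> * max 0 (\<epsilon> - v))" for v w x z
        by (simp add: f_def k_def r_def A_def B_def e_def power2_eq_square flip: exp_add)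
      have 2: "\<bar>(k * (e l)\<^sup>2 - u) - (k * (e l')\<^sup>2 - u')\<bar> \<le> (2 * N + 1) * n"
      proof -
        have "\<bar>e l + e l'\<bar> \<le> 2" using e01[of l] e01[of l'] by linarith
        then have "\<bar>k\<bar> * (\<bar>e l - e l'\<bar> * \<bar>e l + e l'\<bar>) \<le> N * (n * 2)"
          using k el n0 by (intro mult_mono) auto
        moreover have "k * (e l)\<^sup>2 - k * (e l')\<^sup>2 = k * ((e l - e l') * (e l + e l'))"
          by (simp add: power2_eq_square algebra_simps)
        then have "\<bar>k * (e l)\<^sup>2 - k * (e l')\<^sup>2\<bar> = \<bar>k\<bar> * (\<bar>e l - e l'\<bar> * \<bar>e l + e l'\<bar>)" by (simp add: abs_mult)
        ultimately have "\<bar>k * (e l)\<^sup>2 - k * (e l')\<^sup>2\<bar> \<le> 2 * N * n" by simp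
        then show ?thesis using n(1) by (simp only: distrib_right)
      qed
      \<comment> \<open>The factor \<open>e\<close> is bounded by 1 and Lipschitz with constant 1,
        so the factor beside it contributes its Lipschitz constant \<open>c1\<close> plus its bound
        \<open>c2\<close>.\<close>
      have prod: "r * \<bar>a * e l - a' * e l'\<bar> \<le> sqrt N * ((c1 + c2) * n)"
        if "\<bar>a - a'\<bar> \<le> c1 * n" "\<bar>a'\<bar> \<le> c2" for a a' c1 c2
      proof -
        have "a * e l - a' * e l' = (a - a') * e l + a' * (e l - e l')" by (simp add: algebra_simps)
        then have "\<bar>a * e l - a' * e l'\<bar> \<le> \<bar>a - a'\<bar> * \<bar>e l\<bar> + \<bar>a'\<bar> * \<bar>e l - e l'\<bar>"
          by (metis abs_mult abs_triangle_ineq)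
        also have "\<dots> \<le> (c1 * n) * 1 + c2 * n"
          using that el e01[of l] n0 abs_ge_zero[of "a - a'"] abs_ge_zero[of a'] by (intro add_mono mult_mono) linarith+
        finally show ?thesis using r N by (intro mult_mono) (auto simp: algebra_simps)
      qed
      have 3: "\<bar>r * (A u * e l) - r * (A u' * e l')\<bar> \<le> sqrt N * ((K + M / \<epsilon>\<^sup>2) * n)"
        using prod[OF Au Ab] r by (simp add: right_diff_distrib[symmetric] abs_mult)
      have "\<bar>B u'\<bar> \<le> 1 / \<epsilon>\<^sup>2" using Bb[of u'] by simp
      from prod[OF Bu this] have "\<bar>r * (B u * e l) - r * (B u' * e l')\<bar> \<le> sqrt N * ((2 / \<epsilon>^3 + 1 / \<epsilon>\<^sup>2) * n)"
        using r by (simp add: right_diff_distrib[symmetric] abs_mult)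
      moreover have "\<bar>\<Lambda> * max 0 (\<epsilon> - u) - \<Lambda> * max 0 (\<epsilon> - u')\<bar> \<le> \<Lambda> * n"
      proof -
        have "\<bar>max 0 (\<epsilon> - u) - max 0 (\<epsilon> - u')\<bar> \<le> n" using n(1) by auto
        then show ?thesis using Lam(1) by (simp add: right_diff_distrib[symmetric] abs_mult)
      qed
      ultimately have 4: "\<bar>(r * (B u * e l) + \<Lambda> * max 0 (\<epsilon> - u)) - (r * (B u' * e l') + \<Lambda> * max 0 (\<epsilon> - u'))\<bar>
          \<le> sqrt N * ((2 / \<epsilon>^3 + 1 / \<epsilon>\<^sup>2) * n) + \<Lambda> * n"
        by linarith
      have norm4: "norm (a, b, c, w) \<le> \<bar>a\<bar> + \<bar>b\<bar> + \<bar>c\<bar> + \<bar>w\<bar>" for a b c w :: real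
        using norm_Pair_le[of a "(b, c, w)"] norm_Pair_le[of b "(c, w)"] norm_Pair_le[of c w] by simp
      have "norm (f q s x - f q s x') \<le> n + (2 * N + 1) * n + sqrt N * ((K + M / \<epsilon>\<^sup>2) * n)
          + (sqrt N * ((2 / \<epsilon>^3 + 1 / \<epsilon>\<^sup>2) * n) + \<Lambda> * n)"
        unfolding x x' f_eq diff_Pair by (rule order_trans[OF norm4]) (intro add_mono n 2 3 4)
      then show "norm (f q s x - f q s x') \<le> Lf * norm (x - x')"
        by (simp add: Lf_def n_def algebra_simps)
    qed
  qed
  have x0: "continuous_on Q x0" unfolding x0_def by (intro continuous_intros)
  obtain X where X: "\<And>q s. q \<in> Q \<Longrightarrow> s \<in> {0..\<alpha>} \<Longrightarrow>
       (X q has_vector_derivative f q s (X q s)) (at s within {0..\<alpha>})"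
    "\<And>q. q \<in> Q \<Longrightarrow> X q 0 = x0 q" "\<And>s. s \<in> {0..\<alpha>} \<Longrightarrow> continuous_on Q (\<lambda>q. X q s)"
    using ode_family[OF Q _ L(1) cont L(2) x0] alpha by auto
  define U where "U q = fst (X q \<alpha>) - ua" for q
  define \<tau> where "\<tau> q = snd (snd (snd (X q \<alpha>))) - T" for q
  have traj: "kepler_trajectory \<alpha> M T ua ub \<epsilon> \<Lambda> d (fst q) (snd q) (\<lambda>s. fst (X q s)) (\<lambda>s. fst (snd (X q s)))
      (\<lambda>s. fst (snd (snd (X q s)))) (\<lambda>s. snd (snd (snd (X q s))))" if q: "q \<in> Q" for q
  proof (unfold_locales, goal_cases)
    case (1 s)
    have "((\<lambda>s. fst (X q s)) has_vector_derivative fst (f q s (X q s))) (at s within {0..\<alpha>})"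
      by (rule bounded_linear.has_vector_derivative[OF bounded_linear_fst X(1)[OF q 1]])
    then show ?case by (simp add: f_def has_real_derivative_iff_has_vector_derivative)
  next
    case (2 s)
    have "((\<lambda>s. fst (snd (X q s))) has_vector_derivative fst (snd (f q s (X q s)))) (at s within {0..\<alpha>})"
      by (intro bounded_linear.has_vector_derivative[OF bounded_linear_fst]
          bounded_linear.has_vector_derivative[OF bounded_linear_snd] X(1)[OF q 2])
    then show ?case by (simp add: f_def has_real_derivative_iff_has_vector_derivative)
  next
    case (3 s)
    have "((\<lambda>s. fst (snd (snd (X q s)))) has_vector_derivative fst (snd (snd (f q s (X q s))))) (at s within {0..\<alpha>})"
      by (intro bounded_linear.has_vector_derivative[OF bounded_linear_fst]
          bounded_linear.has_vector_derivative[OF bounded_linear_snd] X(1)[OF q 3])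
    then show ?case by (simp add: f_def has_real_derivative_iff_has_vector_derivative)
  next
    case (4 s)
    have "((\<lambda>s. snd (snd (snd (X q s)))) has_vector_derivative snd (snd (snd (f q s (X q s))))) (at s within {0..\<alpha>})"
      by (intro bounded_linear.has_vector_derivative[OF bounded_linear_snd] X(1)[OF q 4])
    then show ?case by (simp add: f_def has_real_derivative_iff_has_vector_derivative)
  qed (simp_all add: X(2)[OF q] x0_def)
  have Xa: "continuous_on Q (\<lambda>q. X q \<alpha>)" using X(3)[of \<alpha>] alpha by auto
  have absP: "\<bar>p\<bar> \<le> P" if "p \<in> {-P..P}" for p using that by auto
  have NP: "C_top * (1 + \<bar>p\<bar>) \<le> N" if "p \<in> {-P..P}" for p
    unfolding N_def using C_top(1) absP[OF that] by (intro mult_left_mono) auto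
  obtain p k where pk: "p \<in> {-P..P}" "k \<in> {-N..N}" "U (p, k) = 0" "\<tau> (p, k) = 0"
  proof (rule poincare_miranda_relaxed[of P N U \<tau>])
    show "continuous_on ({-P..P} \<times> {-N..N}) U" unfolding U_def Q_def[symmetric]
      by (intro continuous_intros Xa)
    show "continuous_on ({-P..P} \<times> {-N..N}) \<tau>" unfolding \<tau>_def Q_def[symmetric]
      by (intro continuous_intros Xa)
    show "U (p, - N) < 0" if p: "p \<in> {-P..P}" for p
      using kepler_trajectory.end_below_target[OF traj, of "(p, - N)"] NP[OF p] p N by (auto simp: U_def Q_def)
    show "0 < U (p, N)" if p: "p \<in> {-P..P}" for p
      using kepler_trajectory.end_above_target[OF traj, of "(p, N)"] NP[OF p] p N by (auto simp: U_def Q_def)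
    show "0 < \<tau> (- P, k)" if k: "k \<in> {-N..N}" and 0: "U (- P, k) = 0" for k
      using kepler_trajectory.slow_for_steep_fall[OF traj P(2-5), of "(- P, k)"] k 0 P(1) by (auto simp: U_def \<tau>_def Q_def)
    show "\<tau> (P, k) < 0" if k: "k \<in> {-N..N}" and 0: "U (P, k) = 0" for k
      using kepler_trajectory.fast_for_steep_rise[OF traj P(1) P(6-9), of "(P, k)"] k 0 P(1) by (auto simp: U_def \<tau>_def Q_def)
  qed (use P(1) N in auto)
  show ?thesis by (rule that[OF traj[of "(p, k)"]]) (use pk in \<open>auto simp: Q_def U_def \<tau>_def\<close>)
qed

end

section \<open>From angular trajectories to rotating arcs\<close>

text \<open>The inverse is continuous by compactness, and its difference quotients are reciprocals
  of those of \<open>t\<close>. Working with limits within the interval also covers the one-sided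
  derivatives at the ends.\<close>

lemma inverse_function_within:
  fixes t :: "real \<Rightarrow> real"
  assumes ab: "a < b"
    and dt: "\<And>s. s \<in> {a..b} \<Longrightarrow> (t has_real_derivative t' s) (at s within {a..b})"
    and pos: "\<And>s. s \<in> {a..b} \<Longrightarrow> 0 < t' s"
  obtains \<phi> where "\<And>\<tau>. \<tau> \<in> {t a..t b} \<Longrightarrow> \<phi> \<tau> \<in> {a..b}" "\<phi> (t a) = a" "\<phi> (t b) = b"
    "\<And>\<tau>. \<tau> \<in> {t a..t b} \<Longrightarrow> (\<phi> has_real_derivative 1 / t' (\<phi> \<tau>)) (at \<tau> within {t a..t b})"
proof -
  have cont: "continuous_on {a..b} t" by (rule DERIV_continuous_on[OF dt])
  have less: "t x < t y" if "a \<le> x" "x < y" "y \<le> b" for x y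
  proof -
    have "\<exists>s\<in>{x<..<y}. t y - t x = (\<lambda>s. (*) (t' s)) s (y - x)"
    proof (rule mvt_simple[OF \<open>x < y\<close>])
      fix s assume "x \<le> s" "s \<le> y"
      then show "(t has_derivative (*) (t' s)) (at s within {x..y})"
        using has_field_derivative_subset[OF dt, of s "{x..y}"] that by (auto simp: has_field_derivative_def)
    qed
    then obtain s where "s \<in> {x<..<y}" "t y - t x = t' s * (y - x)" by auto
    moreover have "0 < t' s * (y - x)" using pos[of s] calculation(1) that by (intro mult_pos_pos) auto
    ultimately show ?thesis by linarith
  qed
  have inj: "inj_on t {a..b}"
  proof (rule inj_onI, rule ccontr)
    fix x y assume "x \<in> {a..b}" "y \<in> {a..b}" "t x = t y" "x \<noteq> y"
    then show False using less[of x y] less[of y x] by (cases "x < y") auto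
  qed
  have img: "t ` {a..b} = {t a..t b}"
  proof
    show "t ` {a..b} \<subseteq> {t a..t b}"
    proof safe
      fix s assume s: "s \<in> {a..b}"
      show "t s \<in> {t a..t b}" using less[of a s] less[of s b] s by (cases "s = a"; cases "s = b") auto
    qed
    show "{t a..t b} \<subseteq> t ` {a..b}"
    proof
      fix \<tau> assume "\<tau> \<in> {t a..t b}"
      then obtain s where "a \<le> s" "s \<le> b" "t s = \<tau>" using IVT'[of t a \<tau> b] cont ab by auto
      then show "\<tau> \<in> t ` {a..b}" by auto
    qed
  qed
  define \<phi> where "\<phi> = inv_into {a..b} t"
  have phi_t: "\<phi> (t s) = s" if "s \<in> {a..b}" for s unfolding \<phi>_def using inj that by simp
  have phi: "\<phi> \<tau> \<in> {a..b}" "t (\<phi> \<tau>) = \<tau>" if "\<tau> \<in> {t a..t b}" for \<tau>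
    using that unfolding img[symmetric] \<phi>_def by (rule inv_into_into, rule f_inv_into_f)
  have cphi: "continuous_on {t a..t b} \<phi>"
    using continuous_on_inv[OF cont compact_Icc, of \<phi>] phi_t unfolding img by blast
  show ?thesis
  proof (rule that[of \<phi>])
    fix \<tau> assume \<tau>: "\<tau> \<in> {t a..t b}"
    let ?s = "\<phi> \<tau>"
    have lim: "((\<lambda>x. (t x - t ?s) / (x - ?s)) \<longlongrightarrow> t' ?s) (at ?s within {a..b})"
      using dt[OF phi(1)[OF \<tau>]] by (simp add: has_field_derivative_iff)
    have "(\<phi> \<longlongrightarrow> ?s) (at \<tau> within {t a..t b})" using cphi \<tau> unfolding continuous_on_def by blast
    moreover have "\<forall>\<^sub>F x in at \<tau> within {t a..t b}. \<phi> x \<in> {a..b} \<and> \<phi> x \<noteq> ?s"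
      unfolding eventually_at_filter
    proof (intro always_eventually allI impI conjI)
      fix x assume x: "x \<noteq> \<tau>" "x \<in> {t a..t b}"
      show "\<phi> x \<in> {a..b}" by (rule phi(1)[OF x(2)])
      show "\<phi> x \<noteq> ?s" using phi(2)[OF x(2)] phi(2)[OF \<tau>] x(1) by auto
    qed
    ultimately have "filterlim \<phi> (at ?s within {a..b}) (at \<tau> within {t a..t b})"
      unfolding filterlim_at by blast
    from filterlim_compose[OF lim this]
    have "((\<lambda>x. inverse ((t (\<phi> x) - t ?s) / (\<phi> x - ?s))) \<longlongrightarrow> inverse (t' ?s)) (at \<tau> within {t a..t b})"
      using pos[OF phi(1)[OF \<tau>]] by (intro tendsto_inverse) simp_all
    moreover have "\<forall>\<^sub>F x in at \<tau> within {t a..t b}. inverse ((t (\<phi> x) - t ?s) / (\<phi> x - ?s)) = (\<phi> x - ?s) / (x - \<tau>)"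
      unfolding eventually_at_filter by (intro always_eventually) (simp add: phi(2) phi(2)[OF \<tau>])
    ultimately have "((\<lambda>x. (\<phi> x - ?s) / (x - \<tau>)) \<longlongrightarrow> inverse (t' ?s)) (at \<tau> within {t a..t b})"
      by (rule Lim_transform_eventually)
    then show "(\<phi> has_real_derivative 1 / t' ?s) (at \<tau> within {t a..t b})"
      unfolding has_field_derivative_iff inverse_eq_divide .
  next
    show "\<phi> (t a) = a" "\<phi> (t b) = b" using phi_t ab by auto
  qed (rule phi(1))
qed

lemma has_vector_derivative_cis_linear:
  "((\<lambda>s. cis (\<theta> - c * s)) has_vector_derivative (- c) *\<^sub>R (\<i> * cis (\<theta> - c * s))) (at s within A)"
  unfolding has_vector_derivative_def
  by (auto intro!: derivative_eq_intros)

text \<open>\<open>z\<close> is the reciprocal of the absolute angular momentum and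
  \<open>sg\<close> the sense of rotation. The angle \<open>\<theta> - sg * s\<close> goes back from
  \<open>B\<close>, and \<open>t\<close> counts the time before arrival, so the motion in true time
  is read off at the inverse of \<open>t\<close> at \<open>- \<tau>\<close>.\<close>

lemma arc_of_angular_trajectory:
  fixes u y z t :: "real \<Rightarrow> real"
  assumes sg: "sg = 1 \<or> sg = - 1" and alpha: "0 < \<alpha>" "\<alpha> < 2 * pi" and T: "0 < T"
    and D: "continuous_on (- {0}) D"
    and u: "\<And>s. s \<in> {0..\<alpha>} \<Longrightarrow> 0 < u s" and z: "\<And>s. s \<in> {0..\<alpha>} \<Longrightarrow> 0 < z s"
    and du: "\<And>s. s \<in> {0..\<alpha>} \<Longrightarrow> (u has_real_derivative y s) (at s within {0..\<alpha>})"
    and dy: "\<And>s. s \<in> {0..\<alpha>} \<Longrightarrow> (y has_real_derivative (z s)\<^sup>2 - u s) (at s within {0..\<alpha>})"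
    and dz: "\<And>s. s \<in> {0..\<alpha>} \<Longrightarrow> (z has_real_derivative
        - D ((1 / u s) *\<^sub>R cis (\<theta> - sg * s)) * (z s)\<^sup>2 / (u s)\<^sup>2) (at s within {0..\<alpha>})"
    and dt: "\<And>s. s \<in> {0..\<alpha>} \<Longrightarrow> (t has_real_derivative z s / (u s)\<^sup>2) (at s within {0..\<alpha>})"
    and t: "t 0 = 0" "t \<alpha> = T"
  shows "\<exists>x x'. is_arc D T ((1 / u \<alpha>) *\<^sub>R cis (\<theta> - sg * \<alpha>)) ((1 / u 0) *\<^sub>R cis \<theta>) x x' \<and>
    (\<forall>\<tau>\<in>{-T..0}. 0 < sg * det2 (x \<tau>) (x' \<tau>))"
proof -
  have sg2: "sg * sg = 1" using sg by auto
  have t'pos: "0 < z s / (u s)\<^sup>2" if "s \<in> {0..\<alpha>}" for s using u[OF that] z[OF that] by simp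
  obtain \<phi> where \<phi>: "\<And>\<tau>. \<tau> \<in> {0..T} \<Longrightarrow> \<phi> \<tau> \<in> {0..\<alpha>}" "\<phi> 0 = 0" "\<phi> T = \<alpha>"
    "\<And>\<tau>. \<tau> \<in> {0..T} \<Longrightarrow> (\<phi> has_real_derivative 1 / (z (\<phi> \<tau>) / (u (\<phi> \<tau>))\<^sup>2)) (at \<tau> within {0..T})"
    using inverse_function_within[OF alpha(1) dt t'pos] unfolding t by metis
  define \<sigma> where "\<sigma> \<tau> = \<phi> (- \<tau>)" for \<tau>
  have sig: "\<sigma> \<tau> \<in> {0..\<alpha>}" if "\<tau> \<in> {-T..0}" for \<tau> using \<phi>(1) that by (auto simp: \<sigma>_def)
  have dsig: "(\<sigma> has_vector_derivative - ((u (\<sigma> \<tau>))\<^sup>2 / z (\<sigma> \<tau>))) (at \<tau> within {-T..0})" if \<tau>: "\<tau> \<in> {-T..0}" for \<tau>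
  proof -
    have "(\<phi> has_real_derivative 1 / (z (\<sigma> \<tau>) / (u (\<sigma> \<tau>))\<^sup>2)) (at (- \<tau>) within uminus ` {-T..0})"
      using \<phi>(4)[of "- \<tau>"] \<tau> by (auto simp: \<sigma>_def)
    moreover have "(uminus has_real_derivative - 1) (at \<tau> within {-T..0})" by (auto intro!: derivative_eq_intros)
    ultimately have "(\<phi> \<circ> uminus has_real_derivative 1 / (z (\<sigma> \<tau>) / (u (\<sigma> \<tau>))\<^sup>2) * - 1) (at \<tau> within {-T..0})"
      by (rule DERIV_image_chain)
    then show ?thesis by (simp add: \<sigma>_def[abs_def] o_def has_real_derivative_iff_has_vector_derivative)
  qed
  define c where "c s = cis (\<theta> - sg * s)" for s
  have dc: "(c has_vector_derivative (- sg) *\<^sub>R (\<i> * c s)) (at s within A)" for s A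
    unfolding c_def by (rule has_vector_derivative_cis_linear)
  have dic: "((\<lambda>s. \<i> * c s) has_vector_derivative \<i> * ((- sg) *\<^sub>R (\<i> * c s))) (at s within A)" for s A
    by (rule has_vector_derivative_mult_right[OF dc])
  define X where "X s = (1 / u s) *\<^sub>R c s" for s
  \<comment> \<open>The velocity in the moving frame \<open>c\<close>, \<open>\<i> * c\<close>:
    radial part \<open>y / z\<close>, tangential part \<open>sg * u / z\<close>. With radius
    \<open>1 / u\<close> the angular momentum is \<open>sg / z\<close>. Derivatives in
    \<open>s\<close> carry a minus sign because \<open>s\<close> runs against time.\<close>
  define V where "V s = (y s / z s) *\<^sub>R c s + (sg * u s / z s) *\<^sub>R (\<i> * c s)" for s
  define Acc where "Acc s = - (D (X s) *\<^sub>R V s) - (u s)\<^sup>2 *\<^sub>R c s" for s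
  have dX: "(X has_vector_derivative (- (z s / (u s)\<^sup>2)) *\<^sub>R V s) (at s within {0..\<alpha>})" if s: "s \<in> {0..\<alpha>}" for s
  proof -
    have "((\<lambda>s. 1 / u s) has_real_derivative - y s / (u s)\<^sup>2) (at s within {0..\<alpha>})"
      using u[OF s] by (auto intro!: derivative_eq_intros du s simp: power2_eq_square)
    from has_vector_derivative_scaleR[OF this dc]
    have "(X has_vector_derivative (1 / u s) *\<^sub>R ((- sg) *\<^sub>R (\<i> * c s)) + (- y s / (u s)\<^sup>2) *\<^sub>R c s) (at s within {0..\<alpha>})"
      by (simp add: X_def[abs_def])
    moreover have "(1 / u s) *\<^sub>R ((- sg) *\<^sub>R (\<i> * c s)) + (- y s / (u s)\<^sup>2) *\<^sub>R c s = (- (z s / (u s)\<^sup>2)) *\<^sub>R V s"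
      using u[OF s] z[OF s] by (simp add: V_def scaleR_add_right power2_eq_square)
    ultimately show ?thesis by simp
  qed
  have dV: "(V has_vector_derivative (- (z s / (u s)\<^sup>2)) *\<^sub>R Acc s) (at s within {0..\<alpha>})" if s: "s \<in> {0..\<alpha>}" for s
  proof -
    let ?d = "D (X s)"
    have 1: "((\<lambda>s. y s / z s) has_real_derivative ((z s)\<^sup>2 - u s) / z s + y s * ?d / (u s)\<^sup>2) (at s within {0..\<alpha>})"
      using u[OF s] z[OF s] by (auto intro!: derivative_eq_intros dy dz s simp: X_def c_def field_simps power2_eq_square)
    have 2: "((\<lambda>s. sg * u s / z s) has_real_derivative sg * (y s / z s + u s * ?d / (u s)\<^sup>2)) (at s within {0..\<alpha>})"
      using u[OF s] z[OF s] by (auto intro!: derivative_eq_intros du dz s simp: X_def c_def field_simps power2_eq_square)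
    have "(V has_vector_derivative
        ((y s / z s) *\<^sub>R ((- sg) *\<^sub>R (\<i> * c s)) + (((z s)\<^sup>2 - u s) / z s + y s * ?d / (u s)\<^sup>2) *\<^sub>R c s) +
        ((sg * u s / z s) *\<^sub>R (\<i> * ((- sg) *\<^sub>R (\<i> * c s))) + (sg * (y s / z s + u s * ?d / (u s)\<^sup>2)) *\<^sub>R (\<i> * c s)))
        (at s within {0..\<alpha>})"
      unfolding V_def by (intro has_vector_derivative_add has_vector_derivative_scaleR 1 2 dc dic)
    moreover have "\<i> * ((- sg) *\<^sub>R (\<i> * c s)) = sg *\<^sub>R c s"
      by (simp add: complex_eq_iff)
    moreover have "((y s / z s) *\<^sub>R ((- sg) *\<^sub>R (\<i> * c s)) + (((z s)\<^sup>2 - u s) / z s + y s * ?d / (u s)\<^sup>2) *\<^sub>R c s) +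
        ((sg * u s / z s) *\<^sub>R (sg *\<^sub>R c s) + (sg * (y s / z s + u s * ?d / (u s)\<^sup>2)) *\<^sub>R (\<i> * c s)) =
        (- (z s / (u s)\<^sup>2)) *\<^sub>R Acc s"
    proof -
      have "((z s)\<^sup>2 - u s) / z s + y s * ?d / (u s)\<^sup>2 + sg * u s / z s * sg = z s / (u s)\<^sup>2 * (?d * (y s / z s) + (u s)\<^sup>2)"
        using u[OF s] z[OF s] sg2 by (simp add: field_simps power2_eq_square)
      moreover have "y s / z s * (- sg) + sg * (y s / z s + u s * ?d / (u s)\<^sup>2) = z s / (u s)\<^sup>2 * (?d * (sg * u s / z s))"
        using u[OF s] z[OF s] by (simp add: field_simps power2_eq_square)
      ultimately have "(((z s)\<^sup>2 - u s) / z s + y s * ?d / (u s)\<^sup>2 + sg * u s / z s * sg) *\<^sub>R c s +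
          (y s / z s * (- sg) + sg * (y s / z s + u s * ?d / (u s)\<^sup>2)) *\<^sub>R (\<i> * c s) =
          (z s / (u s)\<^sup>2 * (?d * (y s / z s) + (u s)\<^sup>2)) *\<^sub>R c s + (z s / (u s)\<^sup>2 * (?d * (sg * u s / z s))) *\<^sub>R (\<i> * c s)"
        by simp
      then show ?thesis
        by (simp only: Acc_def V_def scaleR_add_left scaleR_add_right scaleR_diff_right scaleR_minus_left scaleR_minus_right
            scaleR_scaleR ring_distribs) (simp add: algebra_simps)
    qed
    ultimately show ?thesis by simp
  qed
  have chain: "((\<lambda>\<tau>. F (\<sigma> \<tau>)) has_vector_derivative G (\<sigma> \<tau>)) (at \<tau> within {-T..0})"
    if F: "\<And>s. s \<in> {0..\<alpha>} \<Longrightarrow> (F has_vector_derivative (- (z s / (u s)\<^sup>2)) *\<^sub>R G s) (at s within {0..\<alpha>})"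
      and \<tau>: "\<tau> \<in> {-T..0}" for F G :: "real \<Rightarrow> complex" and \<tau>
  proof -
    let ?s = "\<sigma> \<tau>"
    have "(F has_vector_derivative (- (z ?s / (u ?s)\<^sup>2)) *\<^sub>R G ?s) (at ?s within \<sigma> ` {-T..0})"
      by (rule has_vector_derivative_within_subset[OF F[OF sig[OF \<tau>]]]) (use sig in auto)
    from vector_diff_chain_within[OF dsig[OF \<tau>] this]
    have "((\<lambda>\<tau>. F (\<sigma> \<tau>)) has_vector_derivative (- ((u ?s)\<^sup>2 / z ?s)) *\<^sub>R (- (z ?s / (u ?s)\<^sup>2)) *\<^sub>R G ?s) (at \<tau> within {-T..0})"
      by (simp add: o_def)
    then show ?thesis using u[OF sig[OF \<tau>]] z[OF sig[OF \<tau>]] by simp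
  qed
  define x where "x \<tau> = X (\<sigma> \<tau>)" for \<tau>
  define x' where "x' \<tau> = V (\<sigma> \<tau>)" for \<tau>
  define x'' where "x'' \<tau> = Acc (\<sigma> \<tau>)" for \<tau>
  have nX: "norm (X s) = 1 / u s" "X s \<noteq> 0" if "s \<in> {0..\<alpha>}" for s
    using u[OF that] by (auto simp: X_def c_def)
  have cX: "continuous_on {0..\<alpha>} X" unfolding continuous_on_eq_continuous_within using has_vector_derivative_continuous[OF dX] by blast
  have cV: "continuous_on {0..\<alpha>} V" unfolding continuous_on_eq_continuous_within using has_vector_derivative_continuous[OF dV] by blast
  have cu: "continuous_on {0..\<alpha>} u" by (rule DERIV_continuous_on[OF du])
  have cDX: "continuous_on {0..\<alpha>} (\<lambda>s. D (X s))"
    by (rule continuous_on_compose2[OF D cX]) (use nX in auto)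
  have cA: "continuous_on {0..\<alpha>} Acc" unfolding Acc_def c_def
    by (intro continuous_intros cV cu cDX)
  have csig: "continuous_on {-T..0} \<sigma>" unfolding continuous_on_eq_continuous_within using has_vector_derivative_continuous[OF dsig] by blast
  have ks: "kepler_solution D T x x' x''"
    unfolding kepler_solution_def
  proof (intro conjI ballI)
    show "continuous_on {-T..0} x''"
      unfolding x''_def by (rule continuous_on_compose2[OF cA csig]) (use sig in auto)
    fix \<tau> assume \<tau>: "\<tau> \<in> {-T..0}"
    show "(x has_vector_derivative x' \<tau>) (at \<tau> within {-T..0})"
      unfolding x_def[abs_def] x'_def by (rule chain[OF dX \<tau>])
    show "(x' has_vector_derivative x'' \<tau>) (at \<tau> within {-T..0})"
      unfolding x'_def[abs_def] x''_def by (rule chain[OF dV \<tau>])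
    show "x \<tau> \<noteq> 0" using nX(2)[OF sig[OF \<tau>]] by (simp add: x_def)
    have "(1 / norm (x \<tau>) ^ 3) *\<^sub>R x \<tau> = (u (\<sigma> \<tau>))\<^sup>2 *\<^sub>R c (\<sigma> \<tau>)"
      using nX(1)[OF sig[OF \<tau>]] u[OF sig[OF \<tau>]]
      by (simp add: x_def) (simp add: X_def power_divide power3_eq_cube power2_eq_square)
    then show "x'' \<tau> + D (x \<tau>) *\<^sub>R x' \<tau> = - ((1 / norm (x \<tau>) ^ 3) *\<^sub>R x \<tau>)"
      by (simp add: x''_def Acc_def x_def x'_def)
  qed
  have "arc_condition T x"
    unfolding arc_condition_def
  proof (intro exI[of _ "\<lambda>\<tau>. \<theta> - sg * \<sigma> \<tau>"] conjI ballI)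
    show "continuous_on {-T..0} (\<lambda>\<tau>. \<theta> - sg * \<sigma> \<tau>)" by (intro continuous_intros csig)
    show "x \<tau> = complex_of_real (norm (x \<tau>)) * cis (\<theta> - sg * \<sigma> \<tau>)" if "\<tau> \<in> {-T..0}" for \<tau>
      using nX(1)[OF sig[OF that]] by (simp add: x_def) (simp add: X_def c_def scaleR_conv_of_real)
    show "\<bar>\<theta> - sg * \<sigma> 0 - (\<theta> - sg * \<sigma> (- T))\<bar> < 2 * pi"
      using alpha sg by (auto simp: \<sigma>_def \<phi>)
  qed
  moreover have "x (- T) = (1 / u \<alpha>) *\<^sub>R cis (\<theta> - sg * \<alpha>)" "x 0 = (1 / u 0) *\<^sub>R cis \<theta>"
    by (simp_all add: x_def X_def c_def \<sigma>_def \<phi>)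
  moreover have "0 < sg * det2 (x \<tau>) (x' \<tau>)" if "\<tau> \<in> {-T..0}" for \<tau>
  proof -
    let ?s = "\<sigma> \<tau>"
    have "det2 (x \<tau>) (x' \<tau>) = sg / z ?s * ((Re (c ?s))\<^sup>2 + (Im (c ?s))\<^sup>2)"
      using u[OF sig[OF that]] z[OF sig[OF that]] by (simp add: det2_def x_def x'_def X_def V_def field_simps power2_eq_square)
    also have "(Re (c ?s))\<^sup>2 + (Im (c ?s))\<^sup>2 = 1" by (simp add: c_def)
    finally show ?thesis using z[OF sig[OF that]] sg2 by (simp add: mult.assoc[symmetric])
  qed
  ultimately show ?thesis using ks unfolding is_arc_def by blast
qed

text \<open>In the coordinate \<open>v = 1 / norm x\<close> along a ray, \<open>dx / dv\<close> has
  norm \<open>norm x ^ 2\<close>, so this product bounds the derivative of \<open>D\<close> in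
  \<open>v\<close>. Below norm 1, \<open>norm x ^ 2\<close> is at most \<open>sqrt (norm x)\<close>,
  so the limit at 0 takes care of the puncture; a compact annulus remains.\<close>

lemma gradient_bound:
  assumes D: "damping_ok D gradD"
  obtains G where "0 \<le> G" "\<And>x. x \<noteq> 0 \<Longrightarrow> norm x \<le> R \<Longrightarrow> norm (gradD x) * (norm x)\<^sup>2 \<le> G"
proof -
  have lim: "((\<lambda>x. sqrt (norm x) *\<^sub>R gradD x) \<longlongrightarrow> 0) (at 0)" and cont: "continuous_on (- {0}) gradD"
    using D by (auto simp: damping_ok_def)
  obtain r0 where r0: "0 < r0" "\<And>x. x \<noteq> 0 \<Longrightarrow> norm x < r0 \<Longrightarrow> norm (sqrt (norm x) *\<^sub>R gradD x) < 1"
    using tendstoD[OF lim, of 1] unfolding eventually_at by (auto simp: dist_norm)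
  define r where "r = min r0 1"
  have r: "0 < r" "r \<le> r0" "r \<le> 1" using r0 by (auto simp: r_def)
  let ?K = "cball 0 R - ball 0 r :: complex set"
  have "compact ?K" by (intro compact_diff) auto
  moreover have "continuous_on ?K (\<lambda>x. norm (gradD x) * (norm x)\<^sup>2)"
    by (intro continuous_intros continuous_on_subset[OF cont]) (use r in auto)
  ultimately have "bounded ((\<lambda>x. norm (gradD x) * (norm x)\<^sup>2) ` ?K)"
    by (intro compact_imp_bounded compact_continuous_image)
  then obtain G0 where G0: "\<And>x. x \<in> ?K \<Longrightarrow> \<bar>norm (gradD x) * (norm x)\<^sup>2\<bar> \<le> G0"
    unfolding bounded_iff by (metis (no_types, lifting) imageI real_norm_def)
  show ?thesis
  proof (rule that[of "max G0 1"])
    fix x :: complex assume x: "x \<noteq> 0" "norm x \<le> R"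
    show "norm (gradD x) * (norm x)\<^sup>2 \<le> max G0 1"
    proof (cases "norm x < r")
      case True
      have n: "0 < norm x" "norm x < 1" using x True r by auto
      have "(norm x)\<^sup>2 \<le> norm x * 1" unfolding power2_eq_square using n by (intro mult_left_mono) auto
      also have "\<dots> = sqrt (norm x) * sqrt (norm x)" using n by simp
      also have "\<dots> \<le> sqrt (norm x) * 1" using n by (intro mult_left_mono) auto
      finally have "norm (gradD x) * (norm x)\<^sup>2 \<le> norm (gradD x) * sqrt (norm x)" by (intro mult_left_mono) auto
      also have "\<dots> \<le> 1" using r0(2)[of x] x True r by (simp add: mult.commute)
      finally show ?thesis by simp
    next
      case False
      then show ?thesis using G0[of x] x by (simp add: le_max_iff_disj)
    qed
  qed simp
qed

lemma damping_bound:
  assumes "damping_ok D gradD"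
  obtains M where "0 < M" "\<And>x. x \<noteq> 0 \<Longrightarrow> 0 \<le> D x \<and> D x \<le> M"
proof -
  have "bounded (D ` (- {0}))" "\<forall>x. x \<noteq> 0 \<longrightarrow> 0 \<le> D x" using assms by (auto simp: damping_ok_def)
  then obtain M where M: "\<And>x. x \<noteq> 0 \<Longrightarrow> \<bar>D x\<bar> \<le> M" "\<And>x. x \<noteq> 0 \<Longrightarrow> 0 \<le> D x"
    unfolding bounded_iff by auto
  show ?thesis by (rule that[of "max M 1"]) (use M in \<open>fastforce+\<close>)
qed

lemma damping_continuous:
  assumes "damping_ok D gradD"
  shows "continuous_on (- {0}) D"
proof (rule continuous_at_imp_continuous_on, rule ballI)
  fix x :: complex assume "x \<in> - {0}"
  then show "isCont D x" using assms by (auto simp: damping_ok_def intro: has_derivative_continuous)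
qed

text \<open>The two terms of \<open>K\<close> come from the product rule: the derivative of
  \<open>D\<close> along the ray over \<open>v^2\<close>, and \<open>D\<close> times the derivative
  of \<open>1 / v^2\<close>.\<close>

lemma damping_radial_lipschitz:
  assumes D: "damping_ok D gradD" and e: "0 < \<epsilon>"
  obtains K where "0 \<le> K" "\<And>\<theta> v w. \<epsilon> \<le> v \<Longrightarrow> \<epsilon> \<le> w \<Longrightarrow>
    \<bar>D ((1 / v) *\<^sub>R cis \<theta>) / v\<^sup>2 - D ((1 / w) *\<^sub>R cis \<theta>) / w\<^sup>2\<bar> \<le> K * \<bar>v - w\<bar>"
proof -
  obtain M where M: "0 < M" "\<And>x. x \<noteq> 0 \<Longrightarrow> 0 \<le> D x \<and> D x \<le> M" by (rule damping_bound[OF D]) blast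
  obtain G where G: "0 \<le> G" "\<And>x. x \<noteq> 0 \<Longrightarrow> norm x \<le> 1 / \<epsilon> \<Longrightarrow> norm (gradD x) * (norm x)\<^sup>2 \<le> G"
    by (rule gradient_bound[OF D, of "1 / \<epsilon>"]) blast
  define K where "K = G / \<epsilon>\<^sup>2 + 2 * M / \<epsilon> ^ 3"
  show ?thesis
  proof (rule that[of K])
    show "0 \<le> K" using G M e by (simp add: K_def)
    fix \<theta> v w :: real assume vw: "\<epsilon> \<le> v" "\<epsilon> \<le> w"
    let ?x = "\<lambda>v :: real. (1 / v) *\<^sub>R cis \<theta>"
    let ?F' = "\<lambda>v. (gradD (?x v) \<bullet> ((- 1 / v\<^sup>2) *\<^sub>R cis \<theta>)) / v\<^sup>2 - 2 * D (?x v) / v ^ 3"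
    have "norm (D (?x v) / v\<^sup>2 - D (?x w) / w\<^sup>2) \<le> K * norm (v - w)"
    proof (rule field_differentiable_bound[of "{\<epsilon>..}" "\<lambda>v. D (?x v) / v\<^sup>2" ?F'])
      fix v assume "v \<in> {\<epsilon>..}"
      then have v: "\<epsilon> \<le> v" "0 < v" using e by auto
      have nx: "norm (?x v) = 1 / v" "?x v \<noteq> 0" using v by auto
      have "(?x has_derivative (\<lambda>h. h *\<^sub>R ((- 1 / v\<^sup>2) *\<^sub>R cis \<theta>))) (at v within {\<epsilon>..})"
        using v by (auto intro!: derivative_eq_intros simp: power2_eq_square field_simps)
      moreover have "(D has_derivative (\<lambda>h. gradD (?x v) \<bullet> h)) (at (?x v))"
        using D nx(2) by (auto simp: damping_ok_def)
      ultimately have "((\<lambda>v. D (?x v)) has_derivative (\<lambda>h. gradD (?x v) \<bullet> (h *\<^sub>R ((- 1 / v\<^sup>2) *\<^sub>R cis \<theta>)))) (at v within {\<epsilon>..})"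
        by (rule has_derivative_compose)
      then have "((\<lambda>v. D (?x v)) has_real_derivative gradD (?x v) \<bullet> ((- 1 / v\<^sup>2) *\<^sub>R cis \<theta>)) (at v within {\<epsilon>..})"
        unfolding has_field_derivative_def by (rule has_derivative_eq_rhs) (simp add: fun_eq_iff mult_ac)
      then show "((\<lambda>v. D (?x v) / v\<^sup>2) has_real_derivative ?F' v) (at v within {\<epsilon>..})"
        by (rule DERIV_cong[OF DERIV_divide]) (use v in \<open>auto intro!: derivative_eq_intros simp: field_simps power2_eq_square power3_eq_cube\<close>)
      have "norm (gradD (?x v) \<bullet> ((- 1 / v\<^sup>2) *\<^sub>R cis \<theta>)) \<le> norm (gradD (?x v)) * norm ((- 1 / v\<^sup>2) *\<^sub>R cis \<theta>)"
        by (rule Cauchy_Schwarz_ineq2[unfolded real_norm_def[symmetric]])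
      also have "\<dots> = norm (gradD (?x v)) * (norm (?x v))\<^sup>2" using v by (simp add: power_divide)
      also have "\<dots> \<le> G" using G(2)[OF nx(2)] nx(1) v e by (simp add: divide_left_mono)
      finally have "norm ((gradD (?x v) \<bullet> ((- 1 / v\<^sup>2) *\<^sub>R cis \<theta>)) / v\<^sup>2) \<le> G / \<epsilon>\<^sup>2"
        unfolding norm_divide using v e G(1) by (intro frac_le) (auto intro!: power_mono)
      moreover have "norm (2 * D (?x v) / v ^ 3) \<le> 2 * M / \<epsilon> ^ 3"
        unfolding norm_divide using v e M(2)[OF nx(2)] by (intro frac_le) (auto intro!: power_mono)
      ultimately show "norm (?F' v) \<le> K" unfolding K_def by (rule norm_triangle_le_diff[OF add_mono])
    qed (use vw in auto)
    then show "\<bar>D (?x v) / v\<^sup>2 - D (?x w) / w\<^sup>2\<bar> \<le> K * \<bar>v - w\<bar>" by simp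
  qed
qed

section \<open>Removing the truncation and returning to the plane\<close>

context kepler_trajectory
begin

text \<open>Arrival at exactly \<open>T\<close> rules out \<open>k \<le> 0\<close>, where the time
  is 0 or too long, and rules out dips. Since damping is at most \<open>M\<close>,
  \<open>l - M * t\<close> does not increase, so \<open>l \<le> M * T\<close> and the cap in
  \<open>loss\<close> is never reached.\<close>

lemma untruncated:
  assumes end_u: "u \<alpha> = ua" and end_t: "t \<alpha> = T"
  shows "0 < k" "\<And>s. s \<in> {0..\<alpha>} \<Longrightarrow> \<epsilon> \<le> u s" "\<And>s. s \<in> {0..\<alpha>} \<Longrightarrow> loss (l s) = l s"
proof -
  show k: "0 < k" using nonpos_cases[OF _ end_u] end_t T by force
  show u: "\<epsilon> \<le> u s" if "s \<in> {0..\<alpha>}" for s using dip_costs_time[OF k end_u that] end_t by force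
  show "loss (l s) = l s" if s: "s \<in> {0..\<alpha>}" for s
  proof -
    have "(l s - M * t s) - (l 0 - M * t 0) \<le> 0 * (s - 0)"
    proof (rule increment_le)
      fix r assume r: "r \<in> {0..s}"
      show "((\<lambda>s. l s - M * t s) has_real_derivative d r (floor_u (u r)) * \<omega> r - M * (\<omega> r + \<Lambda> * max 0 (\<epsilon> - u r))) (at r within {0..s})"
        using r s by (intro DERIV_diff DERIV_cmult dl' dt') auto
      have "0 \<le> M * (\<Lambda> * max 0 (\<epsilon> - u r))" using M Lam by auto
      then show "d r (floor_u (u r)) * \<omega> r - M * (\<omega> r + \<Lambda> * max 0 (\<epsilon> - u r)) \<le> 0"
        using dl_bounds[of r] r s by (simp add: distrib_left)
    qed (use s in auto)
    moreover have "M * t s \<le> M * T" using t_mono[of s \<alpha>] s end_t M by auto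
    ultimately show ?thesis using l_nonneg[OF s] init by (simp add: loss_def)
  qed
qed

end

text \<open>The swept angle is \<open>sg * Arg (B / A)\<close> up to a full turn; it avoids 0
  because the points lie on different rays.\<close>

lemma polar_angle_between:
  assumes A: "A \<noteq> 0" and B: "B \<noteq> 0" and ray: "\<not> same_ray A B" and sg: "sg = 1 \<or> sg = - 1"
  obtains \<alpha> where "0 < \<alpha>" "\<alpha> < 2 * pi" "A = norm A *\<^sub>R cis (Arg B - sg * \<alpha>)"
proof -
  define \<beta> where "\<beta> = Arg (B / A)"
  have BA: "B / A \<noteq> 0" using A B by simp
  have b: "- pi < \<beta>" "\<beta> \<le> pi" using Arg_bounded[of "B / A"] by (auto simp: \<beta>_def)
  have "\<beta> \<noteq> 0"
  proof
    assume "\<beta> = 0"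
    then have "B / A = of_real (norm (B / A))" using rcis_cmod_Arg[of "B / A"] by (simp add: \<beta>_def rcis_def)
    then have "B = norm (B / A) *\<^sub>R A" using A by (simp add: field_simps scaleR_conv_of_real)
    then show False using ray BA by (auto simp: same_ray_def intro!: exI[of _ "norm (B / A)"])
  qed
  define \<alpha> where "\<alpha> = (if sg * \<beta> > 0 then sg * \<beta> else sg * \<beta> + 2 * pi)"
  have al: "0 < \<alpha>" "\<alpha> < 2 * pi" using b sg \<open>\<beta> \<noteq> 0\<close> pi_gt_zero unfolding \<alpha>_def by (auto split: if_splits)
  have "cis (sg * \<alpha>) = cis \<beta>"
  proof (cases "sg * \<beta> > 0")
    case True
    then show ?thesis using sg by (auto simp: \<alpha>_def)
  next
    case False
    then have "sg * \<alpha> = \<beta> + sg * (2 * pi)" using sg by (auto simp: \<alpha>_def)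
    then have "cis (sg * \<alpha>) = cis \<beta> * cis (sg * (2 * pi))" by (simp add: cis_mult)
    moreover have "cis (sg * (2 * pi)) = 1" using sg by (auto simp: complex_eq_iff)
    ultimately show ?thesis by simp
  qed
  then have "cis (Arg B - sg * \<alpha>) = cis (Arg B) / cis \<beta>" by (simp add: cis_divide[symmetric])
  also have "\<dots> = sgn B / sgn (B / A)" using A B by (simp add: \<beta>_def cis_Arg)
  also have "\<dots> = sgn A" using A B by (simp add: sgn_div_norm norm_divide field_simps scaleR_conv_of_real)
  finally have "A = norm A *\<^sub>R cis (Arg B - sg * \<alpha>)" using A by (simp add: sgn_div_norm)
  then show ?thesis using that al by blast
qed

lemma rotating_arc_exists:
  assumes D: "damping_ok D gradD" and T: "0 < T" and A: "A \<noteq> 0" and B: "B \<noteq> 0"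
    and ray: "\<not> same_ray A B" and sg: "sg = 1 \<or> sg = - 1"
  shows "\<exists>x x'. is_arc D T A B x x' \<and> (\<forall>\<tau>\<in>{-T..0}. 0 < sg * det2 (x \<tau>) (x' \<tau>))"
proof -
  obtain \<alpha> where alpha: "0 < \<alpha>" "\<alpha> < 2 * pi" and A_polar: "A = norm A *\<^sub>R cis (Arg B - sg * \<alpha>)"
    using polar_angle_between[OF A B ray sg] .
  obtain M where M: "0 < M" "\<And>x. x \<noteq> 0 \<Longrightarrow> 0 \<le> D x \<and> D x \<le> M" by (rule damping_bound[OF D]) blast
  define ua ub where "ua = 1 / norm A" and "ub = 1 / norm B"
  have ua: "0 < ua" and ub: "0 < ub" using A B by (auto simp: ua_def ub_def)
  define d where "d s v = D ((1 / v) *\<^sub>R cis (Arg B - sg * s))" for s v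
  have sin: "0 < sin (\<alpha> / 2)" using alpha by (intro sin_gt_zero) auto
  define E where "E = exp (M * T)"
  have E: "0 < E" by (simp add: E_def)
  \<comment> \<open>One bound per requirement: a third gives strictly more than
    \<open>2 * \<epsilon>\<close> at the ends, \<open>\<epsilon> \<le> 1\<close> allows replacing
    \<open>\<epsilon> * sqrt \<epsilon>\<close> by \<open>\<epsilon>\<close>, and 5 instead of 4
    makes the time bound strict.\<close>
  define \<epsilon> where "\<epsilon> = min (min ua ub / 3) (min (sin (\<alpha> / 2) * min ua ub) (min 1 (1 / (5 * E * T))))"
  have eps: "0 < \<epsilon>" "\<epsilon> \<le> min ua ub / 3" "\<epsilon> \<le> sin (\<alpha> / 2) * min ua ub" "\<epsilon> \<le> 1" "\<epsilon> \<le> 1 / (5 * E * T)"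
    using ua ub sin E T by (auto simp: \<epsilon>_def)
  have eps2: "4 * E * T * (\<epsilon> * sqrt \<epsilon>) < 1"
  proof -
    have "\<epsilon> * sqrt \<epsilon> \<le> \<epsilon> * 1" using eps by (intro mult_left_mono) auto
    then have "\<epsilon> * sqrt \<epsilon> \<le> 1 / (5 * E * T)" using eps(5) by linarith
    then have "4 * E * T * (\<epsilon> * sqrt \<epsilon>) \<le> 4 * E * T * (1 / (5 * E * T))" by (rule mult_left_mono) (use E T in auto)
    also have "\<dots> = 4 / 5" using E T by simp
    finally show ?thesis by simp
  qed
  \<comment> \<open>The first factor gives \<open>T < \<Lambda> * \<epsilon>\<close>, the second
    compensates for a span barely longer than \<open>pi\<close>. At \<open>\<alpha> = pi\<close> the
    quotient is 0 by convention.\<close>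
  define \<Lambda> where "\<Lambda> = (T + 1) / \<epsilon> * (1 + 1 / \<bar>\<alpha> - pi\<bar>)"
  have Le: "\<Lambda> * \<epsilon> = (T + 1) * (1 + 1 / \<bar>\<alpha> - pi\<bar>)" using eps(1) by (simp add: \<Lambda>_def)
  have Lam: "0 < \<Lambda>" unfolding \<Lambda>_def using T eps(1) by (intro mult_pos_pos divide_pos_pos add_pos_nonneg) auto
  have "(T + 1) * 1 \<le> \<Lambda> * \<epsilon>" unfolding Le using T by (intro mult_left_mono) auto
  then have Lam1: "T < \<Lambda> * \<epsilon>" by simp
  have Lam2: "T < \<Lambda> * \<epsilon> * (\<alpha> - pi)" if "pi < \<alpha>"
  proof -
    have "\<Lambda> * \<epsilon> * (\<alpha> - pi) = (T + 1) * (\<alpha> - pi + 1)" unfolding Le using that by (simp add: field_simps)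
    also have "\<dots> \<ge> (T + 1) * 1" using that T by (intro mult_left_mono) auto
    finally show ?thesis by simp
  qed
  have xnz: "(1 / v) *\<^sub>R cis s \<noteq> 0" if "0 < v" for v s :: real using that by simp
  interpret kepler_shooting \<alpha> M T ua ub \<epsilon> \<Lambda> d
    by unfold_locales (use alpha M(1) T ua ub eps eps2 Lam Lam1 Lam2 M(2)[OF xnz] in \<open>auto simp: d_def E_def\<close>)
  have contd: "continuous_on ({0..\<alpha>} \<times> {0<..}) (\<lambda>(s, v). d s v)"
    unfolding d_def case_prod_unfold
    by (rule continuous_on_compose2[OF damping_continuous[OF D]]) (auto intro!: continuous_intros)
  obtain K where K: "0 \<le> K" "\<And>\<theta> v w. \<epsilon> \<le> v \<Longrightarrow> \<epsilon> \<le> w \<Longrightarrow>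
    \<bar>D ((1 / v) *\<^sub>R cis \<theta>) / v\<^sup>2 - D ((1 / w) *\<^sub>R cis \<theta>) / w\<^sup>2\<bar> \<le> K * \<bar>v - w\<bar>"
    by (rule damping_radial_lipschitz[OF D eps(1)]) blast
  have lip: "\<bar>d s (floor_u v) / (floor_u v)\<^sup>2 - d s (floor_u w) / (floor_u w)\<^sup>2\<bar> \<le> K * \<bar>v - w\<bar>" for s v w
  proof -
    have "\<bar>d s (floor_u v) / (floor_u v)\<^sup>2 - d s (floor_u w) / (floor_u w)\<^sup>2\<bar> \<le> K * \<bar>floor_u v - floor_u w\<bar>"
      unfolding d_def by (intro K(2) floor_u(2))
    also have "\<bar>floor_u v - floor_u w\<bar> \<le> \<bar>v - w\<bar>" by (auto simp: floor_u_def)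
    then have "K * \<bar>floor_u v - floor_u w\<bar> \<le> K * \<bar>v - w\<bar>" using K(1) by (rule mult_left_mono)
    finally show ?thesis .
  qed
  obtain p k u y l t where tr: "kepler_trajectory \<alpha> M T ua ub \<epsilon> \<Lambda> d p k u y l t" and fin: "u \<alpha> = ua" "t \<alpha> = T"
    by (rule trajectory_exists[OF contd K(1) lip])
  interpret kepler_trajectory \<alpha> M T ua ub \<epsilon> \<Lambda> d p k u y l t by (rule tr)
  note free = untruncated[OF fin]
  have fl: "floor_u (u s) = u s" if "s \<in> {0..\<alpha>}" for s using free(2)[OF that] by (simp add: floor_u_def)
  define z where "z s = sqrt k * exp (- l s)" for s
  have zz: "(z s)\<^sup>2 = k * exp (- 2 * l s)" for s
  proof -
    have "(exp (- l s))\<^sup>2 = exp (- 2 * l s)" by (simp add: power2_eq_square flip: exp_add)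
    then show ?thesis using free(1) by (simp add: z_def power_mult_distrib)
  qed
  have "\<exists>x x'. is_arc D T ((1 / u \<alpha>) *\<^sub>R cis (Arg B - sg * \<alpha>)) ((1 / u 0) *\<^sub>R cis (Arg B)) x x' \<and>
    (\<forall>\<tau>\<in>{-T..0}. 0 < sg * det2 (x \<tau>) (x' \<tau>))"
  proof (rule arc_of_angular_trajectory[OF sg alpha T damping_continuous[OF D], where u = u and z = z and y = y and t = t])
    fix s assume s: "s \<in> {0..\<alpha>}"
    show "0 < u s" using free(2)[OF s] eps(1) by linarith
    show "0 < z s" using free(1) by (simp add: z_def)
    show "(u has_real_derivative y s) (at s within {0..\<alpha>})" by (rule du[OF s])
    show "(y has_real_derivative (z s)\<^sup>2 - u s) (at s within {0..\<alpha>})"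
      using dy[OF s] free(3)[OF s] by (simp add: zz)
    have l': "(l has_real_derivative d s (u s) * z s / (u s)\<^sup>2) (at s within {0..\<alpha>})"
      using dl[OF s] free(1) free(3)[OF s] by (simp add: fl[OF s] z_def)
    have "(z has_real_derivative sqrt k * (exp (- l s) * - (d s (u s) * z s / (u s)\<^sup>2))) (at s within {0..\<alpha>})"
      unfolding z_def[abs_def] by (rule derivative_eq_intros l'[unfolded z_def] refl)+ simp
    then show "(z has_real_derivative - D ((1 / u s) *\<^sub>R cis (Arg B - sg * s)) * (z s)\<^sup>2 / (u s)\<^sup>2) (at s within {0..\<alpha>})"
      by (rule DERIV_cong) (simp add: z_def d_def power2_eq_square)
    show "(t has_real_derivative z s / (u s)\<^sup>2) (at s within {0..\<alpha>})"
      using dt[OF s] free(1) free(2)[OF s] free(3)[OF s] by (simp add: fl[OF s] z_def)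
  qed (use init fin in auto)
  moreover have "(1 / u \<alpha>) *\<^sub>R cis (Arg B - sg * \<alpha>) = A" using A_polar fin A by (simp add: ua_def)
  moreover have "(1 / u 0) *\<^sub>R cis (Arg B) = B" using init B by (simp add: ub_def cis_Arg sgn_div_norm)
  ultimately show ?thesis by simp
qed

section \<open>Rectilinear arcs\<close>

lemma positive_component:
  fixes f :: "real \<Rightarrow> real"
  assumes f: "continuous_on {a..b} f" "f a = 0" "f b = 0" and c: "c \<in> {a..b}" "0 < f c"
  obtains p q where "a \<le> p" "p < q" "q \<le> b" "f p = 0" "f q = 0" "\<And>s. p < s \<Longrightarrow> s < q \<Longrightarrow> 0 < f s"
proof -
  define Z1 where "Z1 = {s \<in> {a..c}. f s = 0}"
  define Z2 where "Z2 = {s \<in> {c..b}. f s = 0}"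
  have closed_zeros: "closed {s \<in> {x..y}. f s = 0}" if "a \<le> x" "y \<le> b" for x y
    using continuous_closed_preimage[OF continuous_on_subset[OF f(1)], of "{x..y}" "{0}"] that
    by (auto simp: vimage_def Int_def)
  have cl: "closed Z1" "closed Z2"
    using closed_zeros[of a c] closed_zeros[of c b] c unfolding Z1_def Z2_def by auto
  have ne: "Z1 \<noteq> {}" "Z2 \<noteq> {}" using f c by (auto simp: Z1_def Z2_def)
  have bd: "bdd_above Z1" "bdd_below Z2" by (auto simp: Z1_def Z2_def intro!: bdd_aboveI[of _ c] bdd_belowI[of _ c])
  define p where "p = Sup Z1"
  define q where "q = Inf Z2"
  have p: "p \<in> Z1" unfolding p_def by (rule closed_contains_Sup[OF ne(1) bd(1) cl(1)])
  have q: "q \<in> Z2" unfolding q_def by (rule closed_contains_Inf[OF ne(2) bd(2) cl(2)])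
  have pc: "a \<le> p" "p < c" "f p = 0" using p c by (auto simp: Z1_def less_le)
  have qc: "c < q" "q \<le> b" "f q = 0" using q c by (auto simp: Z2_def less_le)
  show ?thesis
  proof (rule that[of p q])
    fix s assume s: "p < s" "s < q"
    show "0 < f s"
    proof (rule ccontr)
      assume "\<not> 0 < f s"
      then have fs: "f s \<le> 0" by simp
      show False
      proof (cases "s \<le> c")
        case True
        obtain r where "s \<le> r" "r \<le> c" "f r = 0"
          using IVT'[of f s 0 c] fs c True pc s continuous_on_subset[OF f(1), of "{s..c}"] by auto
        then have "r \<in> Z1" using s pc by (auto simp: Z1_def)
        then have "r \<le> p" unfolding p_def by (rule cSup_upper[OF _ bd(1)])
        then show False using s \<open>s \<le> r\<close> by simp
      next
        case False
        obtain r where "c \<le> r" "r \<le> s" "f r = 0"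
          using IVT2'[of f s 0 c] fs c False qc s continuous_on_subset[OF f(1), of "{c..s}"] by auto
        then have "r \<in> Z2" using s qc by (auto simp: Z2_def)
        then have "q \<le> r" unfolding q_def by (rule cInf_lower[OF _ bd(2)])
        then show False using s \<open>r \<le> s\<close> by simp
      qed
    qed
  qed (use pc qc in auto)
qed

text \<open>Without angular momentum the velocity is parallel to the position, so the direction
  \<open>x / norm x\<close> has derivative 0 and the equation projects to a fixed ray.\<close>

lemma rectilinear_radial:
  assumes ks: "kepler_solution D T x x' x''" and T: "0 < T"
    and det: "\<And>t. t \<in> {-T..0} \<Longrightarrow> det2 (x t) (x' t) = 0"
  defines "e \<equiv> sgn (x (- T))"
  obtains r r' where "\<And>t. t \<in> {-T..0} \<Longrightarrow> 0 < r t" "\<And>t. t \<in> {-T..0} \<Longrightarrow> x t = r t *\<^sub>R e"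
    "\<And>t. t \<in> {-T..0} \<Longrightarrow> (r has_real_derivative r' t) (at t within {-T..0})"
    "\<And>t. t \<in> {-T..0} \<Longrightarrow> (r' has_real_derivative - D (r t *\<^sub>R e) * r' t - 1 / (r t)\<^sup>2) (at t within {-T..0})"
proof -
  let ?I = "{-T..0}"
  have ksD: "(x has_vector_derivative x' t) (at t within ?I)" "(x' has_vector_derivative x'' t) (at t within ?I)"
    "x t \<noteq> 0" "x'' t + D (x t) *\<^sub>R x' t = - ((1 / norm (x t) ^ 3) *\<^sub>R x t)" if "t \<in> ?I" for t
    using ks that by (auto simp: kepler_solution_def)
  define r where "r t = norm (x t)" for t
  have r: "0 < r t" if "t \<in> ?I" for t using ksD(3)[OF that] by (simp add: r_def)
  have "((\<lambda>t. (1 / r t) *\<^sub>R x t) has_vector_derivative 0) (at t within ?I)" if t: "t \<in> ?I" for t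
  proof -
    have "(r has_derivative (\<lambda>h. (h *\<^sub>R x' t) \<bullet> sgn (x t))) (at t within ?I)"
      unfolding r_def
      using has_derivative_compose[OF ksD(1)[OF t, unfolded has_vector_derivative_def] has_derivative_norm[OF ksD(3)[OF t]]] .
    then have dr: "(r has_real_derivative (x' t \<bullet> x t) / r t) (at t within ?I)"
      unfolding has_field_derivative_def
      by (rule has_derivative_eq_rhs) (auto simp: fun_eq_iff sgn_div_norm r_def divide_simps)
    have "((\<lambda>t. 1 / r t) has_real_derivative - ((x' t \<bullet> x t) / r t) / (r t)\<^sup>2) (at t within ?I)"
      using r[OF t] by (auto intro!: derivative_eq_intros dr simp: power2_eq_square)
    from has_vector_derivative_scaleR[OF this ksD(1)[OF t]]
    have "((\<lambda>t. (1 / r t) *\<^sub>R x t) has_vector_derivative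
        (1 / r t) *\<^sub>R x' t + (- ((x' t \<bullet> x t) / r t) / (r t)\<^sup>2) *\<^sub>R x t) (at t within ?I)" .
    moreover have "(1 / r t) *\<^sub>R x' t + (- ((x' t \<bullet> x t) / r t) / (r t)\<^sup>2) *\<^sub>R x t =
        (1 / r t ^ 3) *\<^sub>R ((r t)\<^sup>2 *\<^sub>R x' t - (x' t \<bullet> x t) *\<^sub>R x t)"
      using r[OF t] by (simp add: scaleR_diff_right power2_eq_square power3_eq_cube)
    \<comment> \<open>This vector is \<open>det2 (x t) (x' t)\<close> times
      \<open>\<i> * x t\<close>.\<close>
    moreover have "(r t)\<^sup>2 *\<^sub>R x' t - (x' t \<bullet> x t) *\<^sub>R x t = 0"
    proof -
      have r2: "(r t)\<^sup>2 = (Re (x t))\<^sup>2 + (Im (x t))\<^sup>2" by (simp add: r_def cmod_def)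
      have d: "Re (x t) * Im (x' t) = Im (x t) * Re (x' t)" using det[OF t] by (simp add: det2_def)
      have "Re ((r t)\<^sup>2 *\<^sub>R x' t - (x' t \<bullet> x t) *\<^sub>R x t) = Im (x t) * (Im (x t) * Re (x' t) - Re (x t) * Im (x' t))"
        unfolding r2 by (simp add: inner_complex_def power2_eq_square algebra_simps)
      moreover have "Im ((r t)\<^sup>2 *\<^sub>R x' t - (x' t \<bullet> x t) *\<^sub>R x t) = Re (x t) * (Re (x t) * Im (x' t) - Im (x t) * Re (x' t))"
        unfolding r2 by (simp add: inner_complex_def power2_eq_square algebra_simps)
      ultimately show ?thesis using d by (simp add: complex_eq_iff)
    qed
    ultimately show ?thesis by simp
  qed
  then have "\<exists>c. \<forall>t\<in>?I. (1 / r t) *\<^sub>R x t = c"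
    by (intro has_derivative_zero_constant) (auto simp: has_vector_derivative_def)
  then have const: "(1 / r t) *\<^sub>R x t = e" if "t \<in> ?I" for t
    using that T by (auto simp: e_def sgn_div_norm r_def divide_inverse)
  have x: "x t = r t *\<^sub>R e" if "t \<in> ?I" for t
    using const[OF that, symmetric] r[OF that] by simp
  have ee: "e \<bullet> e = 1" using ksD(3)[of "- T"] T by (simp add: e_def dot_square_norm norm_sgn)
  have rx: "r t = x t \<bullet> e" if "t \<in> ?I" for t by (subst x[OF that]) (simp add: ee)
  show ?thesis
  proof (rule that[of r "\<lambda>t. x' t \<bullet> e"])
    fix t assume t: "t \<in> ?I"
    have "((\<lambda>t. x t \<bullet> e) has_real_derivative x' t \<bullet> e) (at t within ?I)"
      using bounded_linear.has_vector_derivative[OF bounded_linear_inner_left ksD(1)[OF t]]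
      by (simp add: has_real_derivative_iff_has_vector_derivative)
    then show "(r has_real_derivative x' t \<bullet> e) (at t within ?I)"
      using rx t by (subst has_field_derivative_cong_eventually[where g = "\<lambda>t. x t \<bullet> e"])
        (auto simp: eventually_at_filter intro!: always_eventually)
    have "x'' t = - ((1 / norm (x t) ^ 3) *\<^sub>R x t) - D (x t) *\<^sub>R x' t" using ksD(4)[OF t] by (simp only: eq_diff_eq)
    then have "x'' t \<bullet> e = - D (x t) * (x' t \<bullet> e) - (1 / r t ^ 3) * (x t \<bullet> e)"
      by (simp add: inner_diff_left inner_minus_left r_def)
    also have "\<dots> = - D (r t *\<^sub>R e) * (x' t \<bullet> e) - 1 / (r t)\<^sup>2"
      using rx[OF t] x[OF t] r[OF t] by (simp add: power2_eq_square power3_eq_cube)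
    finally show "((\<lambda>t. x' t \<bullet> e) has_real_derivative - D (r t *\<^sub>R e) * (x' t \<bullet> e) - 1 / (r t)\<^sup>2) (at t within ?I)"
      using bounded_linear.has_vector_derivative[OF bounded_linear_inner_left ksD(2)[OF t], of e]
      by (simp add: has_real_derivative_iff_has_vector_derivative)
  qed (use r x in auto)
qed

lemma radial_antiderivative:
  fixes D :: "complex \<Rightarrow> real"
  assumes D: "continuous_on (- {0}) D" and e: "e \<noteq> 0" and \<delta>: "0 < \<delta>" "\<delta> \<le> R"
  obtains G where "G \<delta> = (0 :: real)"
    "\<And>\<rho>. \<rho> \<in> {\<delta>..R} \<Longrightarrow> (G has_real_derivative D (\<rho> *\<^sub>R e)) (at \<rho> within {\<delta>..R})"
proof -
  have "continuous_on {\<delta>..R} (\<lambda>\<rho>. D (\<rho> *\<^sub>R e))"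
    by (rule continuous_on_compose2[OF D]) (use \<delta> e in \<open>auto intro!: continuous_intros\<close>)
  then show ?thesis
    by (intro that[of "\<lambda>\<rho>. integral {\<delta>..\<rho>} (\<lambda>\<rho>. D (\<rho> *\<^sub>R e))"])
      (auto intro: integral_has_real_derivative)
qed

text \<open>On an interval where \<open>r1\<close> exceeds \<open>r2\<close>, the slope difference
  is nonnegative at the left end and nonpositive at the right end. There the radii agree, so the
  terms with \<open>G\<close> cancel and \<open>H\<close> does not increase across the interval; yet
  its derivative \<open>1 / r2^2 - 1 / r1^2\<close> is positive inside.\<close>

lemma radial_solution_le:
  fixes D :: "complex \<Rightarrow> real" and r1 r2 :: "real \<Rightarrow> real"
  assumes D: "continuous_on (- {0}) D" and e: "e \<noteq> 0" and T: "0 < T"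
    and pos1: "\<And>t. t \<in> {-T..0} \<Longrightarrow> 0 < r1 t" and pos2: "\<And>t. t \<in> {-T..0} \<Longrightarrow> 0 < r2 t"
    and d1: "\<And>t. t \<in> {-T..0} \<Longrightarrow> (r1 has_real_derivative v1 t) (at t within {-T..0})"
    and d2: "\<And>t. t \<in> {-T..0} \<Longrightarrow> (r2 has_real_derivative v2 t) (at t within {-T..0})"
    and dd1: "\<And>t. t \<in> {-T..0} \<Longrightarrow> (v1 has_real_derivative - D (r1 t *\<^sub>R e) * v1 t - 1 / (r1 t)\<^sup>2) (at t within {-T..0})"
    and dd2: "\<And>t. t \<in> {-T..0} \<Longrightarrow> (v2 has_real_derivative - D (r2 t *\<^sub>R e) * v2 t - 1 / (r2 t)\<^sup>2) (at t within {-T..0})"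
    and ends: "r1 (- T) = r2 (- T)" "r1 0 = r2 0" and c: "c \<in> {-T..0}"
  shows "r1 c \<le> r2 c"
proof (rule ccontr)
  assume less: "\<not> r1 c \<le> r2 c"
  let ?I = "{-T..0}"
  have ne: "?I \<noteq> {}" using T by simp
  have c1: "continuous_on ?I r1" and c2: "continuous_on ?I r2" by (rule DERIV_continuous_on, erule d1 d2)+
  have range: "\<exists>\<delta> R. 0 < \<delta> \<and> (\<forall>t\<in>?I. \<delta> \<le> r t \<and> r t \<le> R)"
    if "continuous_on ?I r" "\<And>t. t \<in> ?I \<Longrightarrow> 0 < r t" for r :: "real \<Rightarrow> real"
    using continuous_attains_inf[OF compact_Icc ne that(1)] continuous_attains_sup[OF compact_Icc ne that(1)] that(2) by metis
  obtain \<delta>1 R1 \<delta>2 R2 where b: "0 < \<delta>1" "0 < \<delta>2" "\<And>t. t \<in> ?I \<Longrightarrow> \<delta>1 \<le> r1 t \<and> r1 t \<le> R1" "\<And>t. t \<in> ?I \<Longrightarrow> \<delta>2 \<le> r2 t \<and> r2 t \<le> R2"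
    using range[OF c1 pos1] range[OF c2 pos2] by metis
  define \<delta> R where "\<delta> = min \<delta>1 \<delta>2" and "R = max R1 R2"
  have in1: "r1 t \<in> {\<delta>..R}" and in2: "r2 t \<in> {\<delta>..R}" if "t \<in> ?I" for t
    using b(3,4)[OF that] by (auto simp: \<delta>_def R_def)
  have "0 < \<delta>" "\<delta> \<le> R" using b in1[OF c] by (auto simp: \<delta>_def)
  then obtain G where G: "\<And>\<rho>. \<rho> \<in> {\<delta>..R} \<Longrightarrow> (G has_real_derivative D (\<rho> *\<^sub>R e)) (at \<rho> within {\<delta>..R})"
    using radial_antiderivative[OF D e] by metis
  have dG: "((\<lambda>t. G (r t)) has_real_derivative D (r t *\<^sub>R e) * v t) (at t within ?I)"
    if "t \<in> ?I" "(r has_real_derivative v t) (at t within ?I)" "\<And>t. t \<in> ?I \<Longrightarrow> r t \<in> {\<delta>..R}" for r v t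
  proof -
    have "(G has_real_derivative D (r t *\<^sub>R e)) (at (r t) within r ` ?I)"
      by (rule has_field_derivative_subset[OF G]) (use that in auto)
    from DERIV_image_chain[OF this that(2)] show ?thesis by (simp add: o_def)
  qed
  define f where "f t = r1 t - r2 t" for t
  have cf: "continuous_on ?I f" unfolding f_def by (intro continuous_intros c1 c2)
  have fc: "0 < f c" using less by (simp add: f_def)
  obtain p q where pq: "- T \<le> p" "p < q" "q \<le> 0" "f p = 0" "f q = 0" "\<And>s. p < s \<Longrightarrow> s < q \<Longrightarrow> 0 < f s"
    using positive_component[OF cf _ _ c fc] ends by (auto simp: f_def)
  have pI: "p \<in> ?I" and qI: "q \<in> ?I" using pq by auto
  have df: "(f has_real_derivative v1 t - v2 t) (at t within ?I)" if "t \<in> ?I" for t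
    unfolding f_def by (intro DERIV_diff d1 d2 that)
  have left: "0 \<le> v1 p - v2 p"
  proof (rule ccontr)
    assume "\<not> 0 \<le> v1 p - v2 p"
    then obtain \<eta> where \<eta>: "0 < \<eta>" "\<And>h. 0 < h \<Longrightarrow> p + h \<in> ?I \<Longrightarrow> h < \<eta> \<Longrightarrow> f (p + h) < f p"
      using has_real_derivative_neg_dec_right[OF df[OF pI]] by auto
    define h where "h = min \<eta> (q - p) / 2"
    have "0 < h" "h < \<eta>" "h < q - p" using \<eta>(1) pq(2) by (auto simp: h_def min_def)
    then show False using \<eta>(2)[of h] pq(6)[of "p + h"] pq(1-4) by auto
  qed
  have right: "v1 q - v2 q \<le> 0"
  proof (rule ccontr)
    assume "\<not> v1 q - v2 q \<le> 0"
    then obtain \<eta> where \<eta>: "0 < \<eta>" "\<And>h. 0 < h \<Longrightarrow> q - h \<in> ?I \<Longrightarrow> h < \<eta> \<Longrightarrow> f (q - h) < f q"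
      using has_real_derivative_pos_inc_left[OF df[OF qI]] by auto
    define h where "h = min \<eta> (q - p) / 2"
    have "0 < h" "h < \<eta>" "h < q - p" using \<eta>(1) pq(2) by (auto simp: h_def min_def)
    then show False using \<eta>(2)[of h] pq(6)[of "q - h"] pq(1-5) by auto
  qed
  define H where "H t = (v1 t + G (r1 t)) - (v2 t + G (r2 t))" for t
  have dH: "(H has_real_derivative 1 / (r2 t)\<^sup>2 - 1 / (r1 t)\<^sup>2) (at t within ?I)" if t: "t \<in> ?I" for t
  proof -
    have "(H has_real_derivative ((- D (r1 t *\<^sub>R e) * v1 t - 1 / (r1 t)\<^sup>2) + D (r1 t *\<^sub>R e) * v1 t)
        - ((- D (r2 t *\<^sub>R e) * v2 t - 1 / (r2 t)\<^sup>2) + D (r2 t *\<^sub>R e) * v2 t)) (at t within ?I)"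
      unfolding H_def using t in1 in2 by (intro DERIV_diff DERIV_add dd1 dd2 dG d1 d2)
    then show ?thesis by simp
  qed
  have "\<exists>s\<in>{p<..<q}. H q - H p = (\<lambda>t. (*) (1 / (r2 t)\<^sup>2 - 1 / (r1 t)\<^sup>2)) s (q - p)"
  proof (rule mvt_simple[OF pq(2)])
    fix t assume "p \<le> t" "t \<le> q"
    then show "(H has_derivative (*) (1 / (r2 t)\<^sup>2 - 1 / (r1 t)\<^sup>2)) (at t within {p..q})"
      using has_field_derivative_subset[OF dH, of t "{p..q}"] pq by (auto simp: has_field_derivative_def)
  qed
  then obtain s where s: "p < s" "s < q" "H q - H p = (1 / (r2 s)\<^sup>2 - 1 / (r1 s)\<^sup>2) * (q - p)" by auto
  have sI: "s \<in> ?I" using s pq by auto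
  have "r2 s < r1 s" using pq(6)[OF s(1,2)] by (simp add: f_def)
  then have "(r2 s)\<^sup>2 < (r1 s)\<^sup>2" using pos2[OF sI] by (intro power_strict_mono) auto
  then have "1 / (r1 s)\<^sup>2 < 1 / (r2 s)\<^sup>2" using pos1[OF sI] pos2[OF sI] by (intro divide_strict_left_mono) auto
  then have "0 < H q - H p" unfolding s(3) using s by (intro mult_pos_pos) auto
  moreover have "H q - H p = (v1 q - v2 q) - (v1 p - v2 p)" using pq by (simp add: H_def f_def)
  ultimately show False using left right by linarith
qed

lemma rectilinear_unique:
  assumes D: "continuous_on (- {0}) D" and T: "0 < T"
    and x: "rectilinear_arc D T A B x" and y: "rectilinear_arc D T A B y" and t: "t \<in> {-T..0}"
  shows "y t = x t"
proof -
  have *: "\<exists>r v. (\<forall>t\<in>{-T..0}. 0 < r t \<and> x t = r t *\<^sub>R sgn A \<and> (r has_real_derivative v t) (at t within {-T..0}) \<and>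
      (v has_real_derivative - D (r t *\<^sub>R sgn A) * v t - 1 / (r t)\<^sup>2) (at t within {-T..0})) \<and>
      r (- T) = norm A \<and> r 0 = norm B"
    if rect: "rectilinear_arc D T A B x" for x
  proof -
    obtain x' x'' where ks: "kepler_solution D T x x' x''" and det: "\<forall>t\<in>{-T..0}. det2 (x t) (x' t) = 0"
      and ends: "x (- T) = A" "x 0 = B"
      using rect unfolding rectilinear_arc_def is_arc_def by blast
    have A: "A \<noteq> 0" using ks T ends by (auto simp: kepler_solution_def)
    obtain r v where rv: "\<And>t. t \<in> {-T..0} \<Longrightarrow> 0 < r t" "\<And>t. t \<in> {-T..0} \<Longrightarrow> x t = r t *\<^sub>R sgn A"
      "\<And>t. t \<in> {-T..0} \<Longrightarrow> (r has_real_derivative v t) (at t within {-T..0})"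
      "\<And>t. t \<in> {-T..0} \<Longrightarrow> (v has_real_derivative - D (r t *\<^sub>R sgn A) * v t - 1 / (r t)\<^sup>2) (at t within {-T..0})"
      using rectilinear_radial[OF ks T] det unfolding ends by metis
    have "r t = norm (x t)" if "t \<in> {-T..0}" for t
      using rv(1)[OF that] A by (subst rv(2)[OF that]) (simp add: norm_sgn)
    then have "r (- T) = norm A" "r 0 = norm B" using T ends by auto
    then show ?thesis using rv by blast
  qed
  obtain r1 v1 where 1: "\<And>t. t \<in> {-T..0} \<Longrightarrow> 0 < r1 t \<and> x t = r1 t *\<^sub>R sgn A \<and> (r1 has_real_derivative v1 t) (at t within {-T..0}) \<and>
      (v1 has_real_derivative - D (r1 t *\<^sub>R sgn A) * v1 t - 1 / (r1 t)\<^sup>2) (at t within {-T..0})"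
      "r1 (- T) = norm A" "r1 0 = norm B"
    using *[OF x] by blast
  obtain r2 v2 where 2: "\<And>t. t \<in> {-T..0} \<Longrightarrow> 0 < r2 t \<and> y t = r2 t *\<^sub>R sgn A \<and> (r2 has_real_derivative v2 t) (at t within {-T..0}) \<and>
      (v2 has_real_derivative - D (r2 t *\<^sub>R sgn A) * v2 t - 1 / (r2 t)\<^sup>2) (at t within {-T..0})"
      "r2 (- T) = norm A" "r2 0 = norm B"
    using *[OF y] by blast
  have "x (- T) \<noteq> 0" using x T by (auto simp: rectilinear_arc_def is_arc_def kepler_solution_def)
  then have e: "sgn A \<noteq> 0" using x by (auto simp: rectilinear_arc_def is_arc_def sgn_zero_iff)
  have "r1 t \<le> r2 t" by (rule radial_solution_le[OF D e T, where ?v1.0 = v1 and ?v2.0 = v2]) (use 1 2 t in auto)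
  moreover have "r2 t \<le> r1 t" by (rule radial_solution_le[OF D e T, where ?v1.0 = v2 and ?v2.0 = v1]) (use 1 2 t in auto)
  ultimately show ?thesis using 1(1)[OF t] 2(1)[OF t] by simp
qed

text \<open>With \<open>w = v + G r\<close> as second unknown, the damping enters only through
  \<open>G\<close>, which is Lipschitz because \<open>D\<close> is bounded. Clamping
  \<open>r\<close> then gives a globally Lipschitz system, and the initial value of \<open>w\<close>
  is found by the intermediate value theorem.\<close>

lemma radial_boundary_value_problem:
  fixes D :: "complex \<Rightarrow> real"
  assumes Dc: "continuous_on (- {0}) D" and Db: "\<And>x. x \<noteq> 0 \<Longrightarrow> 0 \<le> D x \<and> D x \<le> M"
    and e: "e \<noteq> 0" and T: "0 < T" and a: "0 < a" and b: "0 < b"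
  obtains r v where "r 0 = a" "r T = b" "\<And>s. s \<in> {0..T} \<Longrightarrow> 0 < r s"
    "\<And>s. s \<in> {0..T} \<Longrightarrow> (r has_real_derivative v s) (at s within {0..T})"
    "\<And>s. s \<in> {0..T} \<Longrightarrow> (v has_real_derivative - D (r s *\<^sub>R e) * v s - 1 / (r s)\<^sup>2) (at s within {0..T})"
proof -
  have M: "0 \<le> M" using Db[of 1] by auto
  define \<delta> where "\<delta> = min a b"
  \<comment> \<open>After a maximum above \<open>R\<close> the radius falls at speed at most
    \<open>T / \<delta>\<^sup>2\<close>, hence by at most
    \<open>T\<^sup>2 / \<delta>\<^sup>2\<close> in total; such a motion could not come down to
    \<open>b\<close>.\<close>
  define R where "R = a + b + T\<^sup>2 / \<delta>\<^sup>2 + 1"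
  have \<delta>: "0 < \<delta>" "\<delta> \<le> a" "\<delta> \<le> b" using a b by (auto simp: \<delta>_def)
  have "0 \<le> T\<^sup>2 / \<delta>\<^sup>2" by simp
  then have R: "a \<le> R" "b + T\<^sup>2 / \<delta>\<^sup>2 < R" "\<delta> \<le> R" using a b \<delta> unfolding R_def by linarith+
  obtain G where G: "G \<delta> = (0 :: real)" "\<And>\<rho>. \<rho> \<in> {\<delta>..R} \<Longrightarrow> (G has_real_derivative D (\<rho> *\<^sub>R e)) (at \<rho> within {\<delta>..R})"
    using radial_antiderivative[OF Dc e \<delta>(1) R(3)] by metis
  have De: "0 \<le> D (\<rho> *\<^sub>R e)" "D (\<rho> *\<^sub>R e) \<le> M" if "\<rho> \<in> {\<delta>..R}" for \<rho>
    using Db[of "\<rho> *\<^sub>R e"] that \<delta> e by auto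
  have G_incr: "0 \<le> G y - G x \<and> G y - G x \<le> M * (y - x)" if "\<delta> \<le> x" "x \<le> y" "y \<le> R" for x y
  proof -
    have dG: "(G has_real_derivative D (\<rho> *\<^sub>R e)) (at \<rho> within {x..y})" if "\<rho> \<in> {x..y}" for \<rho>
      using \<open>\<delta> \<le> x\<close> \<open>y \<le> R\<close> that by (intro has_field_derivative_subset[OF G(2)]) auto
    have "0 * (y - x) \<le> G y - G x"
      by (rule increment_ge[OF that(2) dG]) (use De that in auto)
    moreover have "G y - G x \<le> M * (y - x)"
      by (rule increment_le[OF that(2) dG]) (use De that in auto)
    ultimately show ?thesis by simp
  qed
  define cl where "cl \<rho> = max \<delta> (min R \<rho>)" for \<rho>
  have cl: "\<delta> \<le> cl \<rho>" "cl \<rho> \<le> R" for \<rho> using R \<delta> by (auto simp: cl_def)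
  define F where "F \<rho> = G (cl \<rho>)" for \<rho>
  have F_bounds: "0 \<le> F \<rho>" "F \<rho> \<le> F R" "F R \<le> M * R" for \<rho>
  proof -
    show "0 \<le> F \<rho>" using G_incr[of \<delta> "cl \<rho>"] cl[of \<rho>] G(1) by (simp add: F_def)
    show "F \<rho> \<le> F R" using G_incr[of "cl \<rho>" R] cl[of \<rho>] R by (simp add: F_def cl_def)
    have "F R \<le> M * (R - \<delta>)" using G_incr[of \<delta> R] R G(1) by (simp add: F_def cl_def)
    also have "\<dots> \<le> M * R" using M \<delta> by (intro mult_left_mono) auto
    finally show "F R \<le> M * R" .
  qed
  have F_lip: "\<bar>F x - F y\<bar> \<le> M * \<bar>x - y\<bar>" for x y
  proof -
    have "\<bar>F x - F y\<bar> \<le> M * \<bar>cl x - cl y\<bar>"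
      using G_incr[of "cl x" "cl y"] G_incr[of "cl y" "cl x"] cl[of x] cl[of y] by (cases "cl x \<le> cl y") (auto simp: F_def)
    also have "\<bar>cl x - cl y\<bar> \<le> \<bar>x - y\<bar>" by (auto simp: cl_def)
    then have "M * \<bar>cl x - cl y\<bar> \<le> M * \<bar>x - y\<bar>" using M by (rule mult_left_mono)
    finally show ?thesis .
  qed
  \<comment> \<open>Starting with \<open>w = - W\<close>, \<open>r\<close> falls by at least
    \<open>a\<close>. Starting with \<open>w = W\<close>, the velocity stays at least
    \<open>b / T\<close> after subtracting the attraction \<open>T / \<delta>\<^sup>2\<close> and
    the damping \<open>M * R\<close>.\<close>
  define W where "W = a / T + b / T + T / \<delta>\<^sup>2 + M * R"
  have W: "0 < W" using a b T M R \<delta> by (auto simp: W_def intro!: add_pos_nonneg)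
  define f where "f = (\<lambda>(q :: real) (s :: real) (x :: real \<times> real). (snd x - F (fst x), - 1 / (max (fst x) \<delta>)\<^sup>2))"
  have contF: "continuous_on UNIV F"
    by (rule lipschitz_on_continuous_on[of M]) (auto simp: lipschitz_on_def dist_real_def F_lip M)
  have cont: "continuous_on ({-W..W} \<times> {0..T} \<times> UNIV) (\<lambda>(q,s,x). f q s x)"
    unfolding f_def case_prod_unfold
    by (intro continuous_intros continuous_on_compose2[OF contF]) (use \<delta> in auto)
  have lip: "norm (f q s x - f q s x') \<le> (1 + M + 2 / \<delta> ^ 3) * norm (x - x')" for q s x x'
  proof -
    obtain \<rho> w where x: "x = (\<rho>, w)" by (cases x)
    obtain \<rho>' w' where x': "x' = (\<rho>', w')" by (cases x')
    define n where "n = norm (x - x')"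
    have n: "\<bar>\<rho> - \<rho>'\<bar> \<le> n" "\<bar>w - w'\<bar> \<le> n"
      using norm_fst_le[of "\<rho> - \<rho>'" "w - w'"] norm_snd_le[of "w - w'" "\<rho> - \<rho>'"] by (auto simp: n_def x x')
    have 1: "\<bar>F \<rho> - F \<rho>'\<bar> \<le> M * n" using F_lip[of \<rho> \<rho>'] mult_left_mono[OF n(1) M] by linarith
    have "\<bar>max \<rho> \<delta> - max \<rho>' \<delta>\<bar> \<le> n" using n(1) by auto
    then have "2 / \<delta> ^ 3 * \<bar>max \<rho> \<delta> - max \<rho>' \<delta>\<bar> \<le> 2 / \<delta> ^ 3 * n" using \<delta> by (intro mult_left_mono) auto
    then have 2: "\<bar>1 / (max \<rho> \<delta>)\<^sup>2 - 1 / (max \<rho>' \<delta>)\<^sup>2\<bar> \<le> 2 / \<delta> ^ 3 * n"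
      using inverse_square_diff_le[OF \<delta>(1), of "max \<rho> \<delta>" "max \<rho>' \<delta>"] by auto
    have "norm (f q s x - f q s x') \<le> \<bar>(w - F \<rho>) - (w' - F \<rho>')\<bar> + \<bar>1 / (max \<rho> \<delta>)\<^sup>2 - 1 / (max \<rho>' \<delta>)\<^sup>2\<bar>"
      using norm_Pair_le[of "(w - F \<rho>) - (w' - F \<rho>')" "- 1 / (max \<rho> \<delta>)\<^sup>2 - (- 1 / (max \<rho>' \<delta>)\<^sup>2)"]
      by (simp add: f_def x x' abs_minus_commute)
    also have "\<dots> \<le> (n + M * n) + 2 / \<delta> ^ 3 * n" using n(2) 1 2 by (intro add_mono) linarith+
    finally show ?thesis by (simp add: n_def algebra_simps)
  qed
  have L: "0 \<le> 1 + M + 2 / \<delta> ^ 3" using M \<delta> by simp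
  have init: "continuous_on {-W..W} (\<lambda>q. (a, q))" by (intro continuous_intros)
  obtain X where X: "\<And>q s. q \<in> {-W..W} \<Longrightarrow> s \<in> {0..T} \<Longrightarrow> (X q has_vector_derivative f q s (X q s)) (at s within {0..T})"
    "\<And>q. q \<in> {-W..W} \<Longrightarrow> X q 0 = (a, q)" "\<And>s. s \<in> {0..T} \<Longrightarrow> continuous_on {-W..W} (\<lambda>q. X q s)"
    using ode_family[OF compact_Icc _ L cont lip init] T by auto
  have dr: "((\<lambda>s. fst (X q s)) has_real_derivative snd (X q s) - F (fst (X q s))) (at s within {0..T})"
    if "q \<in> {-W..W}" "s \<in> {0..T}" for q s
    using bounded_linear.has_vector_derivative[OF bounded_linear_fst X(1)[OF that]]
    by (simp add: f_def has_real_derivative_iff_has_vector_derivative)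
  have dw: "((\<lambda>s. snd (X q s)) has_real_derivative - 1 / (max (fst (X q s)) \<delta>)\<^sup>2) (at s within {0..T})"
    if "q \<in> {-W..W}" "s \<in> {0..T}" for q s
    using bounded_linear.has_vector_derivative[OF bounded_linear_snd X(1)[OF that]]
    by (simp add: f_def has_real_derivative_iff_has_vector_derivative)
  have w_step: "- (T / \<delta>\<^sup>2) \<le> snd (X q s2) - snd (X q s1) \<and> snd (X q s2) - snd (X q s1) \<le> 0"
    if q: "q \<in> {-W..W}" and s: "0 \<le> s1" "s1 \<le> s2" "s2 \<le> T" for q s1 s2
  proof -
    have d: "((\<lambda>s. snd (X q s)) has_real_derivative - 1 / (max (fst (X q s)) \<delta>)\<^sup>2) (at s within {s1..s2})"
      if "s \<in> {s1..s2}" for s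
      using s that by (intro has_field_derivative_subset[OF dw[OF q]]) auto
    have "- (1 / \<delta>\<^sup>2) * (s2 - s1) \<le> snd (X q s2) - snd (X q s1)"
      by (rule increment_ge[OF s(2) d]) (use \<delta> in \<open>auto intro!: divide_left_mono power_mono mult_pos_pos\<close>)
    moreover have "snd (X q s2) - snd (X q s1) \<le> 0 * (s2 - s1)"
      by (rule increment_le[OF s(2) d]) auto
    moreover have "1 / \<delta>\<^sup>2 * (s2 - s1) \<le> 1 / \<delta>\<^sup>2 * T" using s by (intro mult_left_mono) auto
    ultimately show ?thesis by simp
  qed
  have r_step: "c1 * (s2 - s1) \<le> fst (X q s2) - fst (X q s1)"
    if q: "q \<in> {-W..W}" and s: "0 \<le> s1" "s1 \<le> s2" "s2 \<le> T"
      and c1: "\<And>s. s \<in> {s1..s2} \<Longrightarrow> c1 \<le> snd (X q s) - F (fst (X q s))" for q s1 s2 c1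
    by (rule increment_ge[OF s(2) _ c1]) (use s in \<open>auto intro!: has_field_derivative_subset[OF dr[OF q]]\<close>)
  have r_step': "fst (X q s2) - fst (X q s1) \<le> c1 * (s2 - s1)"
    if q: "q \<in> {-W..W}" and s: "0 \<le> s1" "s1 \<le> s2" "s2 \<le> T"
      and c1: "\<And>s. s \<in> {s1..s2} \<Longrightarrow> snd (X q s) - F (fst (X q s)) \<le> c1" for q s1 s2 c1
    by (rule increment_le[OF s(2) _ c1]) (use s in \<open>auto intro!: has_field_derivative_subset[OF dr[OF q]]\<close>)
  have low: "fst (X (- W) T) \<le> b"
  proof -
    have "fst (X (- W) T) - fst (X (- W) 0) \<le> (- W) * (T - 0)"
    proof (rule r_step')
      fix s assume "s \<in> {0..T}"
      then show "snd (X (- W) s) - F (fst (X (- W) s)) \<le> - W"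
        using w_step[of "- W" 0 s] W X(2)[of "- W"] F_bounds(1)[of "fst (X (- W) s)"] by auto
    qed (use W T in auto)
    moreover have "a \<le> W * T"
    proof -
      have "a / T \<le> W" using a b T M R \<delta> by (auto simp: W_def intro!: add_nonneg_nonneg)
      then show ?thesis using T by (simp add: field_simps)
    qed
    ultimately show ?thesis using X(2)[of "- W"] W b by simp
  qed
  have high: "b \<le> fst (X W T)"
  proof -
    have "(b / T) * (T - 0) \<le> fst (X W T) - fst (X W 0)"
    proof (rule r_step)
      fix s assume "s \<in> {0..T}"
      then have "W - T / \<delta>\<^sup>2 \<le> snd (X W s)" using w_step[of W 0 s] W X(2)[of W] by auto
      moreover have "F (fst (X W s)) \<le> M * R" using F_bounds(2,3) order_trans by blast
      moreover have "0 \<le> a / T" using a T by simp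
      ultimately show "b / T \<le> snd (X W s) - F (fst (X W s))" using W_def by linarith
    qed (use W T in auto)
    then show ?thesis using X(2)[of W] W T a by simp
  qed
  have "continuous_on {-W..W} (\<lambda>q. fst (X q T))" using X(3)[of T] T by (auto intro!: continuous_intros)
  then obtain q where q: "q \<in> {-W..W}" and rT: "fst (X q T) = b"
    using IVT'[of "\<lambda>q. fst (X q T)" "- W" b W] low high W by auto
  define r where "r s = fst (X q s)" for s
  define w where "w s = snd (X q s)" for s
  have r0: "r 0 = a" "r T = b" using X(2)[OF q] rT by (auto simp: r_def)
  have dr': "(r has_real_derivative w s - F (r s)) (at s within {0..T})" if "s \<in> {0..T}" for s
    using dr[OF q that] by (simp add: r_def[abs_def] w_def)
  have cr: "continuous_on {0..T} r" by (rule DERIV_continuous_on[OF dr'])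
  have ne: "{0..T} \<noteq> {}" using T by auto
  \<comment> \<open>At an interior minimum below \<delta> the clamped \<open>F\<close> vanishes, so
    \<open>w = 0\<close> there. As \<open>w\<close> only decreases, \<open>r\<close> could never
    climb back to \<open>b\<close>.\<close>
  have lower: "\<delta> \<le> r s" if s: "s \<in> {0..T}" for s
  proof (rule ccontr)
    assume "\<not> \<delta> \<le> r s"
    moreover obtain c where c: "c \<in> {0..T}" "\<And>s. s \<in> {0..T} \<Longrightarrow> r c \<le> r s"
      using continuous_attains_inf[OF compact_Icc ne cr] by blast
    ultimately have rc: "r c < \<delta>" using s by fastforce
    then have inner: "0 < c" "c < T" using c(1) r0 \<delta> by (auto simp: less_le)
    have "w c - F (r c) = 0" by (rule zero_derivative_at_interior_min[OF dr'[OF c(1)] inner c(2)])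
    moreover have "F (r c) = 0" using rc R G(1) by (simp add: F_def cl_def)
    ultimately have wc: "w c = 0" by simp
    have "r T - r c \<le> 0 * (T - c)"
      unfolding r_def
    proof (rule r_step'[OF q])
      fix s assume "s \<in> {c..T}"
      then have "w s \<le> 0" using w_step[OF q, of c s] wc c(1) by (auto simp: w_def)
      then show "snd (X q s) - F (fst (X q s)) \<le> 0" using F_bounds(1)[of "fst (X q s)"] by (simp add: w_def)
    qed (use inner in auto)
    then show False using rc r0 \<delta> by simp
  qed
  \<comment> \<open>At an interior maximum above \<open>R\<close>, \<open>w\<close> equals the
    largest value \<open>F R\<close>, and later it lies at most \<open>T / \<delta>\<^sup>2\<close>
    below it; this bounds the speed of fall.\<close>
  have upper: "r s \<le> R" if s: "s \<in> {0..T}" for s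
  proof (rule ccontr)
    assume "\<not> r s \<le> R"
    moreover obtain c where c: "c \<in> {0..T}" "\<And>s. s \<in> {0..T} \<Longrightarrow> r s \<le> r c"
      using continuous_attains_sup[OF compact_Icc ne cr] by blast
    ultimately have rc: "R < r c" using s by fastforce
    have bR: "b < R" using R(2) zero_le_divide_iff[of "T\<^sup>2" "\<delta>\<^sup>2"] by (smt (verit) zero_le_power2)
    then have inner: "0 < c" "c < T" using c(1) r0 R(1) rc by (auto simp: less_le)
    have "w c - F (r c) = 0" by (rule zero_derivative_at_interior_max[OF dr'[OF c(1)] inner c(2)])
    moreover have "F (r c) = F R" using rc R by (simp add: F_def cl_def)
    ultimately have wc: "w c = F R" by simp
    have "(- (T / \<delta>\<^sup>2)) * (T - c) \<le> r T - r c"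
      unfolding r_def
    proof (rule r_step[OF q])
      fix s assume "s \<in> {c..T}"
      then have "F R - T / \<delta>\<^sup>2 \<le> w s" using w_step[OF q, of c s] wc c(1) by (auto simp: w_def)
      then show "- (T / \<delta>\<^sup>2) \<le> snd (X q s) - F (fst (X q s))" using F_bounds(2)[of "fst (X q s)"] by (simp add: w_def)
    qed (use inner in auto)
    moreover have "T / \<delta>\<^sup>2 * (T - c) \<le> T / \<delta>\<^sup>2 * T" using inner T by (intro mult_left_mono) auto
    ultimately have "r c \<le> b + T\<^sup>2 / \<delta>\<^sup>2" using r0 by (simp add: power2_eq_square)
    then show False using rc R(2) by linarith
  qed
  have FG: "F (r s) = G (r s)" if "s \<in> {0..T}" for s using lower[OF that] upper[OF that] by (simp add: F_def cl_def)
  show ?thesis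
  proof (rule that[of r "\<lambda>s. w s - F (r s)"])
    fix s assume s: "s \<in> {0..T}"
    show "0 < r s" using lower[OF s] \<delta> by linarith
    show "(r has_real_derivative w s - F (r s)) (at s within {0..T})" by (rule dr'[OF s])
    have "(G has_real_derivative D (r s *\<^sub>R e)) (at (r s) within r ` {0..T})"
      by (rule has_field_derivative_subset[OF G(2)]) (use lower upper s in auto)
    from DERIV_image_chain[OF this dr'[OF s]]
    have "((\<lambda>s. G (r s)) has_real_derivative D (r s *\<^sub>R e) * (w s - F (r s))) (at s within {0..T})" by (simp add: o_def)
    then have dF: "((\<lambda>s. F (r s)) has_real_derivative D (r s *\<^sub>R e) * (w s - F (r s))) (at s within {0..T})"
      by (rule has_field_derivative_transform_within[where d = 1]) (use s FG in auto)
    have "(w has_real_derivative - 1 / (r s)\<^sup>2) (at s within {0..T})"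
      using dw[OF q s] lower[OF s] by (simp add: w_def[abs_def] r_def max_absorb1)
    from DERIV_diff[OF this dF]
    show "((\<lambda>s. w s - F (r s)) has_real_derivative - D (r s *\<^sub>R e) * (w s - F (r s)) - 1 / (r s)\<^sup>2) (at s within {0..T})"
      by (rule DERIV_cong) simp
  qed (rule r0)+
qed

lemma rectilinear_exists:
  fixes D :: "complex \<Rightarrow> real"
  assumes Dc: "continuous_on (- {0}) D" and Db: "\<And>x. x \<noteq> 0 \<Longrightarrow> 0 \<le> D x \<and> D x \<le> M"
    and T: "0 < T" and A: "A \<noteq> 0" and ray: "same_ray A B"
  shows "\<exists>x. rectilinear_arc D T A B x"
proof -
  obtain c where c: "0 < c" "B = c *\<^sub>R A" using ray by (auto simp: same_ray_def)
  define e where "e = sgn A"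
  have e: "e \<noteq> 0" "norm e = 1" using A by (auto simp: e_def sgn_zero_iff norm_sgn)
  have AB: "A = norm A *\<^sub>R e" "B = (c * norm A) *\<^sub>R e" using A c by (auto simp: e_def sgn_div_norm)
  have pos: "0 < norm A" "0 < c * norm A" using A c by auto
  obtain r v where rv: "r 0 = norm A" "r T = c * norm A" "\<And>s. s \<in> {0..T} \<Longrightarrow> 0 < r s"
    "\<And>s. s \<in> {0..T} \<Longrightarrow> (r has_real_derivative v s) (at s within {0..T})"
    "\<And>s. s \<in> {0..T} \<Longrightarrow> (v has_real_derivative - D (r s *\<^sub>R e) * v s - 1 / (r s)\<^sup>2) (at s within {0..T})"
    using radial_boundary_value_problem[OF Dc Db e(1) T pos] by metis
  define acc where "acc s = - D (r s *\<^sub>R e) * v s - 1 / (r s)\<^sup>2" for s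
  have shift: "((\<lambda>t. F (t + T) *\<^sub>R e) has_vector_derivative F' (t + T) *\<^sub>R e) (at t within {-T..0})"
    if "\<And>s. s \<in> {0..T} \<Longrightarrow> (F has_real_derivative F' s) (at s within {0..T})" "t \<in> {-T..0}" for F F' :: "real \<Rightarrow> real" and t
  proof -
    have "(F has_real_derivative F' (t + T)) (at (t + T) within (\<lambda>t. t + T) ` {-T..0})"
      using that(1)[of "t + T"] that(2) by simp
    moreover have "((\<lambda>t. t + T) has_real_derivative 1) (at t within {-T..0})" by (auto intro!: derivative_eq_intros)
    ultimately have "(F \<circ> (\<lambda>t. t + T) has_real_derivative F' (t + T) * 1) (at t within {-T..0})" by (rule DERIV_image_chain)
    then have "((\<lambda>t. F (t + T)) has_real_derivative F' (t + T)) (at t within {-T..0})" by (simp add: o_def)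
    from has_vector_derivative_scaleR[OF this has_vector_derivative_const[of e]] show ?thesis by simp
  qed
  have cr: "continuous_on {0..T} r" by (rule DERIV_continuous_on[OF rv(4)])
  have cv: "continuous_on {0..T} v" by (rule DERIV_continuous_on[OF rv(5)])
  have pos': "r s *\<^sub>R e \<noteq> 0" "r s \<noteq> 0" if "s \<in> {0..T}" for s using rv(3)[OF that] e by auto
  have cD: "continuous_on {0..T} (\<lambda>s. D (r s *\<^sub>R e))"
    by (rule continuous_on_compose2[OF Dc]) (use pos' cr in \<open>auto intro!: continuous_intros\<close>)
  have cacc: "continuous_on {0..T} acc"
    unfolding acc_def by (intro continuous_intros cD cv cr) (use pos' in auto)
  define x where "x t = r (t + T) *\<^sub>R e" for t
  define x' where "x' t = v (t + T) *\<^sub>R e" for t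
  define x'' where "x'' t = acc (t + T) *\<^sub>R e" for t
  have nx: "norm (x t) = r (t + T)" "0 < r (t + T)" if "t \<in> {-T..0}" for t
    using rv(3)[of "t + T"] that e by (auto simp: x_def)
  have "kepler_solution D T x x' x''"
    unfolding kepler_solution_def
  proof (intro conjI ballI)
    show "continuous_on {-T..0} x''"
      unfolding x''_def by (intro continuous_intros continuous_on_compose2[OF cacc]) auto
    fix t assume t: "t \<in> {-T..0}"
    show "(x has_vector_derivative x' t) (at t within {-T..0})"
      unfolding x_def[abs_def] x'_def by (rule shift[OF rv(4) t])
    show "(x' has_vector_derivative x'' t) (at t within {-T..0})"
      unfolding x'_def[abs_def] x''_def by (rule shift[OF _ t]) (use rv(5) in \<open>auto simp: acc_def\<close>)
    show "x t \<noteq> 0" using nx[OF t] by auto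
    have "x'' t + D (x t) *\<^sub>R x' t = - ((1 / (r (t + T))\<^sup>2) *\<^sub>R e)"
      by (simp add: x''_def x'_def acc_def x_def flip: scaleR_add_left)
    moreover have "(1 / norm (x t) ^ 3) *\<^sub>R x t = (1 / (r (t + T))\<^sup>2) *\<^sub>R e"
      using nx[OF t] by (simp add: x_def power2_eq_square power3_eq_cube)
    ultimately show "x'' t + D (x t) *\<^sub>R x' t = - ((1 / norm (x t) ^ 3) *\<^sub>R x t)"
      by (simp only:)
  qed
  moreover have "arc_condition T x"
    unfolding arc_condition_def
  proof (intro exI[of _ "\<lambda>_. Arg A"] conjI ballI)
    fix t assume t: "t \<in> {-T..0}"
    show "x t = complex_of_real (norm (x t)) * cis (Arg A)"
      unfolding nx(1)[OF t] using A by (simp add: x_def e_def cis_Arg scaleR_conv_of_real)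
  qed auto
  moreover have "x (- T) = A" "x 0 = B" using rv AB by (auto simp: x_def)
  moreover have "\<forall>t\<in>{-T..0}. det2 (x t) (x' t) = 0" by (simp add: det2_def x_def x'_def)
  ultimately show ?thesis unfolding rectilinear_arc_def is_arc_def by blast
qed

theorem theorem1p1:
  fixes D :: "complex \<Rightarrow> real" and gradD :: "complex \<Rightarrow> complex"
    and T :: real and A B :: complex
  assumes "damping_ok D gradD"
    and "T > 0" and "A \<noteq> 0" and "B \<noteq> 0"
  shows "(same_ray A B \<longrightarrow>
            (\<exists>x. rectilinear_arc D T A B x \<and>
                 (\<forall>y. rectilinear_arc D T A B y \<longrightarrow> (\<forall>t\<in>{-T..0}. y t = x t))))
       \<and> (\<not> same_ray A B \<longrightarrow>
            (\<exists>x. cw_arc D T A B x) \<and> (\<exists>x. ccw_arc D T A B x))"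
proof -
  have D: "continuous_on (- {0}) D" by (rule damping_continuous[OF assms(1)])
  obtain M where M: "\<And>x. x \<noteq> 0 \<Longrightarrow> 0 \<le> D x \<and> D x \<le> M" using damping_bound[OF assms(1)] by metis
  have "\<exists>x. rectilinear_arc D T A B x \<and>
      (\<forall>y. rectilinear_arc D T A B y \<longrightarrow> (\<forall>t\<in>{-T..0}. y t = x t))" if "same_ray A B"
    using rectilinear_exists[OF D M assms(2,3) that] rectilinear_unique[OF D assms(2)] by blast
  moreover have "(\<exists>x. cw_arc D T A B x) \<and> (\<exists>x. ccw_arc D T A B x)" if "\<not> same_ray A B"
    using rotating_arc_exists[OF assms that, of "- 1"] rotating_arc_exists[OF assms that, of 1]
    by (auto simp: cw_arc_def ccw_arc_def)
  ultimately show ?thesis by blast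
qed

end
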